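(* Let $n\in\mathbb{N}$ and suppose $B$ is an $H^\infty_1$-interpolating Blaschke product with zeros $\{z_j\}_{j\in\mathbb{N}}$. For $k\in\mathbb{N}$ let $I_k:=\{f\in H^\infty_{n+1}:\ fB^k\in H^\infty_{n+1}\}$, and for $j\in\mathbb{N}$ let $d_j:=\inf\{|z_j-z_l|:\ l\in\mathbb{N}\setminus\{j\}\}$. The following are equivalent: (i) The ideals $I_1,\dots,I_n$ are all nonideal (as subspaces of $H^\infty_{n+1}$). (ii) The inclusions $I_1\supset\dots\supset I_n\supset I_{n+1}$ are all proper. (iii) $I_n$ is nonideal (as a subspace of $H^\infty_{n+1}$). (iv) $I_{n+1}\ne I_n$. (v) One has $\displaystyle\sup_j\frac{d_j}{1-|z_j|}=\infty$.
   Context: Notation: $\mathbb{N}=\{1,2,\dots\}$, $\mathbb{D}=\{z\in\mathbb{C}:|z|<1\}$, $\mathbb{T}=\partial\mathbb{D}$; $H^\infty$ is the algebra of bounded analytic functions on $\mathbb{D}$. For $N\in\mathbb{N}$, $H^\infty_N:=\{f\in H^\infty:\ f^{(N)}\in H^\infty\}$, an algebra under pointwise multiplication. Functions in $H^\infty_1$ are Lipschitz on $\mathbb{D}$, hence extend continuously to $\mathrm{clos}\,\mathbb{D}$. The sets $I_k$ are (possibly nonclosed) ideals of the algebra $H^\infty_{n+1}$, and the (not necessarily strict) inclusions $I_k\supset I_{k+1}$ always hold. Ideal subspaces: a linear subspace $X$ (not necessarily closed) of $H^\infty_{n+1}$ is an ideal subspace of $H^\infty_{n+1}$ if, whenever $f\in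 X$, $g\in H^\infty_{n+1}$ and $|g|\le|f|$ everywhere on $\mathbb{D}$, it follows that $g\in X$. An ideal of $H^\infty_{n+1}$ is called nonideal if it is not an ideal subspace of $H^\infty_{n+1}$. Blaschke product: for a sequence $\{z_j\}\subset\mathbb{D}$ with $\sum_j(1-|z_j|)<\infty$, the Blaschke product with zeros $\{z_j\}$ is $B(z)=\prod_j\frac{\bar z_j}{|z_j|}\frac{z_j-z}{1-\bar z_jz}$ (with the factor interpreted as $z$ if $z_j=0$). A Blaschke product $B$ with zeros $\{z_j\}$ is $H^\infty_1$-interpolating if its zeros are all simple (so the $z_j$ are pairwise distinct) and the set $E:=\mathrm{clos}\{z_j\}$ is an $H^\infty_1$-interpolating set, i.e., every function $\varphi:E\to\mathbb{C}$ satisfying $|\varphi(z)-\varphi(w)|\le C|z-w|$ for all $z,w\in E$, with some constant $C$, can be written as $\varphi=f|_E$ for some $f\in H^\infty_1$. *)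

theory Defs
  imports "HOL-Complex_Analysis.Complex_Analysis" "HOL-Library.Extended_Real"
begin

(* Functions on the unit disc are represented by total functions on the complex plane. Membership
   in Hinf and HinfN depends only on the values on the open unit disc, so equality of
   the sets I_k below agrees with equality of the corresponding sets of functions on the disc. *)

definition Hinf :: "(complex \<Rightarrow> complex) set" where
  "Hinf = {f. f holomorphic_on ball 0 1 \<and> bounded (f ` ball 0 1)}"

definition HinfN :: "nat \<Rightarrow> (complex \<Rightarrow> complex) set" where
  "HinfN N = {f \<in> Hinf. (deriv ^^ N) f \<in> Hinf}"

definition linear_subspace ::
  "(complex \<Rightarrow> complex) set \<Rightarrow> (complex \<Rightarrow> complex) set \<Rightarrow> bool" where
  "linear_subspace A X \<longleftrightarrow>
     X \<subseteq> A \<and> (\<lambda>w. 0) \<in> X \<and>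
     (\<forall>f\<in>X. \<forall>g\<in>X. (\<lambda>w. f w + g w) \<in> X) \<and>
     (\<forall>c. \<forall>f\<in>X. (\<lambda>w. c * f w) \<in> X)"

definition algebra_ideal ::
  "(complex \<Rightarrow> complex) set \<Rightarrow> (complex \<Rightarrow> complex) set \<Rightarrow> bool" where
  "algebra_ideal A X \<longleftrightarrow>
     linear_subspace A X \<and> (\<forall>f\<in>X. \<forall>g\<in>A. (\<lambda>w. f w * g w) \<in> X)"

definition ideal_subspace ::
  "(complex \<Rightarrow> complex) set \<Rightarrow> (complex \<Rightarrow> complex) set \<Rightarrow> bool" where
  "ideal_subspace A X \<longleftrightarrow>
     linear_subspace A X \<and>
     (\<forall>f\<in>X. \<forall>g\<in>A. (\<forall>w\<in>ball 0 1. norm (g w) \<le> norm (f w)) \<longrightarrow> g \<in> X)"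

definition nonideal ::
  "(complex \<Rightarrow> complex) set \<Rightarrow> (complex \<Rightarrow> complex) set \<Rightarrow> bool" where
  "nonideal A X \<longleftrightarrow> algebra_ideal A X \<and> \<not> ideal_subspace A X"

(* Sequences indexed by the positive integers are indexed here by nat, starting at 0. *)
definition blaschke_seq :: "(nat \<Rightarrow> complex) \<Rightarrow> bool" where
  "blaschke_seq z \<longleftrightarrow> range z \<subseteq> ball 0 1 \<and> summable (\<lambda>j. 1 - norm (z j))"

definition blaschke :: "(nat \<Rightarrow> complex) \<Rightarrow> complex \<Rightarrow> complex" where
  "blaschke z w =
     (\<Prod>j. if z j = 0 then w
           else cnj (z j) / of_real (norm (z j)) * ((z j - w) / (1 - cnj (z j) * w)))"

(* A function in HinfN 1 extends continuously and uniquely to the closed disc. The total function f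
   below carries this extension: its values on the unit circle are the boundary values. *)
definition Hinf1_interpolating_set :: "complex set \<Rightarrow> bool" where
  "Hinf1_interpolating_set E \<longleftrightarrow>
     E \<subseteq> cball 0 1 \<and>
     (\<forall>\<phi> :: complex \<Rightarrow> complex. (\<exists>C. C-lipschitz_on E \<phi>) \<longrightarrow>
        (\<exists>f\<in>HinfN 1. continuous_on (cball 0 1) f \<and> (\<forall>x\<in>E. f x = \<phi> x)))"

definition Hinf1_interpolating_blaschke :: "(nat \<Rightarrow> complex) \<Rightarrow> bool" where
  "Hinf1_interpolating_blaschke z \<longleftrightarrow>
     blaschke_seq z \<and>
     (\<forall>w\<in>ball 0 1. blaschke z w = 0 \<longrightarrow> zorder (blaschke z) w = 1) \<and>
     Hinf1_interpolating_set (closure (range z))"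

definition I_ideal :: "nat \<Rightarrow> (complex \<Rightarrow> complex) \<Rightarrow> nat \<Rightarrow> (complex \<Rightarrow> complex) set" where
  "I_ideal n B k = {f \<in> HinfN (n + 1). (\<lambda>w. f w * B w ^ k) \<in> HinfN (n + 1)}"

definition sep_dist :: "(nat \<Rightarrow> complex) \<Rightarrow> nat \<Rightarrow> real" where
  "sep_dist z j = (INF l\<in>UNIV - {j}. norm (z j - z l))"

end

theory Submission
  imports Defs
begin

text \<open>
  Extending a gliding hump over the interpolation data gives bump functions at the zeros with
  uniform constants, and the maximum principle turns these into a Carleson-type condition on the
  zeros. Under it, division by \<open>B\<close> maps \<open>g B \<in> H\<^sup>\<infinity>\<^sub>N\<close> boundedly to \<open>g\<close>: near a point of the disc,
  the \<open>N\<close> nearest zeros are divided out one at a time, and the remaining product is smooth at the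
  scale of the distance to the last of them. Hence, if \<open>f \<in> I\<^sub>k\<close> but \<open>f \<notin> I\<^bsub>k+1\<^esub>\<close>, then \<open>f B\<close> is dominated by
  \<open>f\<close> without lying in \<open>I\<^sub>k\<close>, and \<open>f B\<^bsup>n-k\<^esup>\<close> carries properness of \<open>I\<^bsub>n+1\<^esub> \<subseteq> I\<^sub>n\<close> down to every \<open>k\<close>.

  If \<open>d\<^sub>j \<le> A (1 - \<bar>z\<^sub>j\<bar>)\<close> for all \<open>j\<close>, then \<open>f B\<^sup>n\<close> with \<open>f \<in> I\<^sub>n\<close> has \<open>2 n \<ge> n + 1\<close> zeros at distance
  comparable to \<open>1 - \<bar>z\<^sub>j\<bar>\<close> from each \<open>z\<^sub>j\<close>. This makes \<open>I\<^sub>n\<close>, and likewise \<open>I\<^bsub>n+1\<^esub>\<close>, equal to the set of \<open>f\<close> with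
  \<open>\<bar>f(w)\<bar> \<le> K \<bar>1 - cnj z\<^sub>j w\<bar>\<^bsup>n+1\<^esup>\<close>, a pure size condition.

  If \<open>d\<^sub>j / (1 - \<bar>z\<^sub>j\<bar>)\<close> is unbounded, then a function of size \<open>d\<^sub>j (1 - cnj z\<^sub>j w)\<^sup>n\<close> near \<open>z\<^sub>j\<close>, cut off at
  scale \<open>d\<^sub>j\<close> by a factor \<open>exp (- M h)\<close> that is small near all other zeros, has uniform norm in \<open>I\<^sub>n\<close>,
  while the \<open>(n+1)\<close>st derivative of its product with \<open>B\<^bsup>n+1\<^esup>\<close> at \<open>z\<^sub>j\<close> is of order
  \<open>d\<^sub>j / (1 - \<bar>z\<^sub>j\<bar>)\<close>. A second gliding hump sums these functions to an element of \<open>I\<^sub>n\<close> outside \<open>I\<^bsub>n+1\<^esub>\<close>.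
\<close>

section \<open>Functions with a bounded derivative on the disc\<close>

text \<open>Nothing forces \<open>d j\<close> to be comparable to \<open>1 - norm (z j)\<close>:
  zeros may cluster far below their depth, and a bump at \<open>z j\<close> that vanishes at the
  others is then tiny. The estimates are therefore made at Euclidean scales, through sums of
  \<open>(1 - norm (z l)) / (norm (z l - z0))\<^sup>2\<close> over zeros beyond the nearest ones.
  Finite products carry every estimate. They are holomorphic across the circle, so the maximum
  principle reduces a derivative bound to points so close to the circle that each zero has depth at
  most twice its distance. Constants independent of the number of zeros then pass to
  \<open>B\<close> by normal families. The hypothesis gives interpolating functions without control
  of their size, and a sum of test functions may suffer cancellation. Both difficulties are met by
  letting the index set of a series range over all sets of naturals and extracting bounds for single
  terms. The exponent \<open>h\<close> of the cut-off is a sum of Herglotz kernels whose poles lie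
  just outside the circle near the other zeros, one family per dyadic scale; counting scales
  produces the logarithm.\<close>

abbreviation disc :: "complex set" where "disc \<equiv> ball 0 1"

text \<open>The constant is part of the predicate because it has to survive limits over finite
  products. Only the top derivative is bounded: lower ones follow by integration from 0.\<close>

definition deriv_bounded :: "nat \<Rightarrow> real \<Rightarrow> (complex \<Rightarrow> complex) \<Rightarrow> bool" where
  "deriv_bounded N K f \<longleftrightarrow> f holomorphic_on disc \<and> (\<forall>z\<in>disc. norm ((deriv ^^ N) f z) \<le> K)"

lemma deriv_bounded_holo: "deriv_bounded N K f \<Longrightarrow> f holomorphic_on disc"
  by (simp add: deriv_bounded_def)

lemma deriv_boundedD: "deriv_bounded N K f \<Longrightarrow> norm z < 1 \<Longrightarrow> norm ((deriv ^^ N) f z) \<le> K"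
  by (simp add: deriv_bounded_def)

lemma deriv_bounded_nonneg: "deriv_bounded N K f \<Longrightarrow> 0 \<le> K"
  using order_trans[OF norm_ge_zero deriv_boundedD[of N K f 0]] by simp

lemma deriv_bounded_mono: "deriv_bounded N K f \<Longrightarrow> K \<le> K' \<Longrightarrow> deriv_bounded N K' f"
  by (force simp: deriv_bounded_def)

lemma deriv_bounded_cong:
  assumes "\<And>z. norm z < 1 \<Longrightarrow> f z = g z"
  shows "deriv_bounded N K f \<longleftrightarrow> deriv_bounded N K g"
proof -
  have "f holomorphic_on disc \<longleftrightarrow> g holomorphic_on disc"
    by (rule holomorphic_cong) (auto simp: assms)
  moreover have "(deriv ^^ N) f z = (deriv ^^ N) g z" if "f holomorphic_on disc" "z \<in> disc" for z
    by (rule higher_deriv_transform_within_open[of f disc g]) 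
      (use that assms calculation in auto)
  ultimately show ?thesis by (auto simp: deriv_bounded_def)
qed

lemma HinfN_iff: "f \<in> HinfN N \<longleftrightarrow> (\<exists>K. deriv_bounded 0 K f \<and> deriv_bounded N K f)"
proof
  assume "f \<in> HinfN N"
  then have h: "f holomorphic_on disc" "bounded (f ` disc)" "bounded ((deriv ^^ N) f ` disc)"
    by (auto simp: HinfN_def Hinf_def)
  obtain K1 where K1: "\<forall>z\<in>disc. norm (f z) \<le> K1" using h(2) by (auto simp: bounded_iff)
  obtain K2 where K2: "\<forall>z\<in>disc. norm ((deriv ^^ N) f z) \<le> K2" using h(3) by (auto simp: bounded_iff)
  have "deriv_bounded 0 (max K1 K2) f \<and> deriv_bounded N (max K1 K2) f"
    using h(1) K1 K2 by (auto simp: deriv_bounded_def le_max_iff_disj)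
  then show "\<exists>K. deriv_bounded 0 K f \<and> deriv_bounded N K f" by blast
next
  assume "\<exists>K. deriv_bounded 0 K f \<and> deriv_bounded N K f"
  then obtain K where K: "deriv_bounded 0 K f" "deriv_bounded N K f" by blast
  have h: "f holomorphic_on disc" "(deriv ^^ N) f holomorphic_on disc"
    using deriv_bounded_holo[OF K(1)] holomorphic_higher_deriv by auto
  have "bounded (f ` disc)" "bounded ((deriv ^^ N) f ` disc)"
    using K unfolding bounded_iff deriv_bounded_def by auto
  with h show "f \<in> HinfN N"
    by (simp add: HinfN_def Hinf_def)
qed

lemma deriv_bounded_lower:
  assumes "deriv_bounded (Suc N) K f"
  shows "deriv_bounded N (K + norm ((deriv ^^ N) f 0)) f"
  unfolding deriv_bounded_def
proof (intro conjI ballI)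
  have h: "f holomorphic_on disc" by (rule deriv_bounded_holo[OF assms])
  then show "f holomorphic_on disc" .
  fix z :: complex assume z: "z \<in> disc"
  have "norm ((deriv ^^ N) f z - (deriv ^^ N) f 0) \<le> K * norm (z - 0)"
  proof (rule field_differentiable_bound[where S = disc and f' = "(deriv ^^ Suc N) f"])
    fix w :: complex assume w: "w \<in> disc"
    show "((deriv ^^ N) f has_field_derivative (deriv ^^ Suc N) f w) (at w within disc)"
      using has_field_derivative_higher_deriv[OF h open_ball w, of N] has_field_derivative_at_within by blast
    show "norm ((deriv ^^ Suc N) f w) \<le> K"
      using deriv_boundedD[OF assms, of w] w by simp
  qed (use z in auto)
  also have "\<dots> \<le> K * 1"
    using z deriv_bounded_nonneg[OF assms] by (intro mult_left_mono) auto
  finally show "norm ((deriv ^^ N) f z) \<le> K + norm ((deriv ^^ N) f 0)"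
    using norm_triangle_ineq2[of "(deriv ^^ N) f z" "(deriv ^^ N) f 0"] by linarith
qed

lemma deriv_bounded_all_lower:
  assumes "deriv_bounded N K f"
  shows "\<exists>K'\<ge>0. \<forall>i\<le>N. deriv_bounded i K' f"
  using assms
proof (induction N arbitrary: K)
  case 0
  then show ?case using deriv_bounded_nonneg[of 0 K f] by (intro exI[of _ K]) simp
next
  case (Suc N)
  obtain K' where K': "K' \<ge> 0" "\<forall>i\<le>N. deriv_bounded i K' f"
    using Suc.IH[OF deriv_bounded_lower[OF Suc.prems]] by metis
  have "deriv_bounded i (max K K') f" if "i \<le> Suc N" for i
  proof (cases "i = Suc N")
    case True
    then show ?thesis using deriv_bounded_mono[OF Suc.prems] by simp
  next
    case False
    then have "deriv_bounded i K' f" using K'(2) that by simp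
    then show ?thesis by (rule deriv_bounded_mono) simp
  qed
  then show ?case using K'(1) by (intro exI[of _ "max K K'"]) auto
qed

lemma HinfN_all: "f \<in> HinfN N \<longleftrightarrow> (\<exists>K\<ge>0. \<forall>i\<le>N. deriv_bounded i K f)"
  unfolding HinfN_iff
proof
  assume "\<exists>K. deriv_bounded 0 K f \<and> deriv_bounded N K f"
  then show "\<exists>K\<ge>0. \<forall>i\<le>N. deriv_bounded i K f" using deriv_bounded_all_lower by blast
qed auto

lemma HinfN_from: "deriv_bounded N K f \<Longrightarrow> f \<in> HinfN N"
  using deriv_bounded_all_lower HinfN_all by blast

lemma HinfN_iff': "f \<in> HinfN N \<longleftrightarrow> (\<exists>K. deriv_bounded N K f)"
  using HinfN_from HinfN_iff by blast

lemma HinfN_holo: "f \<in> HinfN N \<Longrightarrow> f holomorphic_on disc"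
  by (auto simp: HinfN_def Hinf_def)

lemma deriv_bounded_add:
  assumes "deriv_bounded N K f" "deriv_bounded N L g"
  shows "deriv_bounded N (K + L) (\<lambda>z. f z + g z)"
  using assms unfolding deriv_bounded_def
  by (auto intro!: holomorphic_intros simp: higher_deriv_add[of f disc g] intro: norm_triangle_mono)

lemma deriv_bounded_diff:
  assumes "deriv_bounded N K f" "deriv_bounded N L g"
  shows "deriv_bounded N (K + L) (\<lambda>z. f z - g z)"
  using assms unfolding deriv_bounded_def
  by (auto intro!: holomorphic_intros simp: higher_deriv_diff[of f disc g] intro: norm_triangle_le_diff add_mono)

lemma higher_deriv_cmult_open:
  assumes "f holomorphic_on A" "open A" "z \<in> A"
  shows "(deriv ^^ N) (\<lambda>w. c * f w) z = c * (deriv ^^ N) f z"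
  using assms(3)
proof (induction N arbitrary: z)
  case (Suc N)
  have "deriv ((deriv ^^ N) (\<lambda>w. c * f w)) z = deriv (\<lambda>w. c * (deriv ^^ N) f w) z"
  proof (rule complex_derivative_transform_within_open[OF _ _ assms(2) Suc.prems])
    show "(deriv ^^ N) (\<lambda>w. c * f w) holomorphic_on A" "(\<lambda>w. c * (deriv ^^ N) f w) holomorphic_on A"
      using assms by (intro holomorphic_higher_deriv holomorphic_intros; simp)+
  qed (use Suc in auto)
  also have "\<dots> = c * deriv ((deriv ^^ N) f) z"
    using assms Suc.prems holomorphic_higher_deriv[OF assms(1,2)] 
    by (intro deriv_cmult) (auto intro: holomorphic_on_imp_differentiable_at)
  finally show ?case by simp
qed simp

lemma deriv_bounded_cmult:
  assumes "deriv_bounded N K f"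
  shows "deriv_bounded N (norm c * K) (\<lambda>z. c * f z)"
  using assms unfolding deriv_bounded_def
  by (auto intro!: holomorphic_intros mult_left_mono simp: higher_deriv_cmult_open[of f disc] norm_mult)

lemma HinfN_add: "f \<in> HinfN N \<Longrightarrow> g \<in> HinfN N \<Longrightarrow> (\<lambda>z. f z + g z) \<in> HinfN N"
  using HinfN_iff' deriv_bounded_add by metis

lemma HinfN_cmult: "f \<in> HinfN N \<Longrightarrow> (\<lambda>z. c * f z) \<in> HinfN N"
  using HinfN_iff' deriv_bounded_cmult by metis

lemma HinfN_zero: "(\<lambda>z. 0) \<in> HinfN N"
proof -
  have "(deriv ^^ N) (\<lambda>z. 0::complex) = (\<lambda>z. 0)"
    by (induction N) auto
  then show ?thesis unfolding HinfN_iff' deriv_bounded_def by auto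
qed

lemma leibniz_bound:
  assumes "f holomorphic_on A" "g holomorphic_on A" "open A" "z \<in> A"
    and "\<And>i. i \<le> N \<Longrightarrow> norm ((deriv ^^ i) f z) \<le> F i"
    and "\<And>i. i \<le> N \<Longrightarrow> norm ((deriv ^^ i) g z) \<le> G i"
  shows "norm ((deriv ^^ N) (\<lambda>w. f w * g w) z) \<le> (\<Sum>i=0..N. real (N choose i) * (F i * G (N - i)))"
proof -
  have F0: "0 \<le> F i" if "i \<le> N" for i using assms(5)[OF that] norm_ge_zero order_trans by blast
  have "norm ((deriv ^^ N) (\<lambda>w. f w * g w) z)
      \<le> (\<Sum>i=0..N. norm (of_nat (N choose i) * (deriv ^^ i) f z * (deriv ^^ (N - i)) g z))"
    unfolding higher_deriv_mult[OF assms(1-4)] by (rule norm_sum)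
  also have "\<dots> \<le> (\<Sum>i=0..N. real (N choose i) * (F i * G (N - i)))"
    by (intro sum_mono) (auto simp: norm_mult mult.assoc intro!: mult_left_mono mult_mono assms F0)
  finally show ?thesis .
qed

lemma HinfN_mult:
  assumes "f \<in> HinfN N" "g \<in> HinfN N"
  shows "(\<lambda>z. f z * g z) \<in> HinfN N"
proof -
  obtain K where K: "K \<ge> 0" "\<forall>i\<le>N. deriv_bounded i K f" using assms HinfN_all by blast
  obtain L where L: "L \<ge> 0" "\<forall>i\<le>N. deriv_bounded i L g" using assms HinfN_all by blast
  have h: "f holomorphic_on disc" "g holomorphic_on disc" using assms HinfN_holo by auto
  have "deriv_bounded N (\<Sum>i=0..N. real (N choose i) * (K * L)) (\<lambda>z. f z * g z)"
    unfolding deriv_bounded_def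
  proof (intro conjI ballI)
    fix z assume z: "z \<in> disc"
    show "norm ((deriv ^^ N) (\<lambda>z. f z * g z) z) \<le> (\<Sum>i=0..N. real (N choose i) * (K * L))"
      by (rule leibniz_bound[OF h open_ball z, where F = "\<lambda>_. K" and G = "\<lambda>_. L"])
        (use K L z deriv_boundedD in auto)
  qed (use h in \<open>auto intro: holomorphic_intros\<close>)
  then show ?thesis using HinfN_iff' by blast
qed

section \<open>Taylor estimates, the maximum principle and normal families\<close>

lemma taylor_bound:
  assumes "deriv_bounded (Suc N) K f" "norm w < 1" "norm z < 1"
  shows "norm (f z - (\<Sum>i\<le>N. (deriv ^^ i) f w * (z - w) ^ i / fact i)) \<le> K * norm (z - w) ^ Suc N / fact N"
  using complex_Taylor[of disc N "\<lambda>i. (deriv ^^ i) f" K w z] assms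
    has_field_derivative_higher_deriv[OF deriv_bounded_holo[OF assms(1)] open_ball]
  by (auto simp: deriv_bounded_def intro: has_field_derivative_at_within)

text \<open>Serves derivatives that need not extend continuously to the circle: the bound is only
  asymptotic there, and the classical principle is applied on discs of radius
  \<open>s < 1\<close>.\<close>

lemma max_principle:
  assumes H: "H holomorphic_on disc"
    and lim: "\<And>e. e > 0 \<Longrightarrow> \<exists>r<1. \<forall>z. r < norm z \<and> norm z < 1 \<longrightarrow> norm (H z) \<le> C + e"
    and z: "norm z < 1"
  shows "norm (H z) \<le> C"
proof (rule field_le_epsilon)
  fix e :: real assume "e > 0"
  then obtain r where r: "r < 1" "\<And>z. r < norm z \<and> norm z < 1 \<Longrightarrow> norm (H z) \<le> C + e"
    using lim by blast
  obtain s where s: "max r (norm z) < s" "s < 1"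
    using dense[of "max r (norm z)" 1] r z by auto
  show "norm (H z) \<le> C + e"
  proof (rule maximum_modulus_frontier[of H "cball 0 s"])
    show "continuous_on (closure (cball 0 s)) H"
      using s by (auto intro!: holomorphic_on_imp_continuous_on holomorphic_on_subset[OF H])
    show "H holomorphic_on interior (cball 0 s)"
      using s by (auto intro!: holomorphic_on_subset[OF H])
    show "norm (H w) \<le> C + e" if "w \<in> frontier (cball 0 s)" for w
      using that s r(2)[of w] z by (auto simp: frontier_cball)
  qed (use s z in auto)
qed

lemma radial_uniform:
  assumes "continuous_on (cball 0 1) (g :: complex \<Rightarrow> 'a::real_normed_vector)" "e > 0"
  shows "\<exists>r. 0 \<le> r \<and> r < 1 \<and> (\<forall>z. r < norm z \<and> norm z < 1 \<longrightarrow> norm (g z - g (z / norm z)) < e)"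
proof -
  have "uniformly_continuous_on (cball 0 1) g"
    by (intro compact_uniformly_continuous assms) auto
  then obtain d where d: "d > 0" "\<And>x y. x \<in> cball 0 1 \<Longrightarrow> y \<in> cball 0 1 \<Longrightarrow> dist y x < d \<Longrightarrow> dist (g y) (g x) < e"
    using assms(2) unfolding uniformly_continuous_on_def by metis
  have "norm (g z - g (z / norm z)) < e" if z: "max (1 - d) 0 < norm z" "norm z < 1" for z
  proof -
    have "z - z / norm z = (z / norm z) * (norm z - 1)"
      using z by (simp add: field_split_simps)
    then have "norm (z - z / norm z) = norm (z / norm z) * norm (complex_of_real (norm z - 1))"
      by (metis norm_mult of_real_diff of_real_1)
    also have "\<dots> = 1 - norm z"
      using z unfolding norm_of_real by (simp add: norm_divide)
    finally have "norm (z - z / norm z) = 1 - norm z" .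
    then show ?thesis
      using d(2)[of "z / norm z" z] z by (auto simp: dist_norm norm_divide)
  qed
  then show ?thesis
    using d(1) by (intro exI[of _ "max (1 - d) 0"]) auto
qed

text \<open>Montel's theorem with Weierstrass's theorem on derivatives: the convergence is locally
  uniform, so every derivative converges along the same subsequence.\<close>

lemma bounded_deriv_limit:
  assumes h: "\<And>i. f i holomorphic_on disc" and b: "\<And>i z. norm z < 1 \<Longrightarrow> norm (f i z) \<le> C"
  obtains g r where "g holomorphic_on disc" "strict_mono (r :: nat \<Rightarrow> nat)"
    "\<And>z. norm z < 1 \<Longrightarrow> (\<lambda>i. f (r i) z) \<longlonglongrightarrow> g z"
    "\<And>N z. norm z < 1 \<Longrightarrow> (\<lambda>i. (deriv ^^ N) (f (r i)) z) \<longlonglongrightarrow> (deriv ^^ N) g z"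
proof -
  have 1: "k holomorphic_on disc" if "k \<in> range f" for k
    using h that by blast
  have 2: "\<exists>B. \<forall>k\<in>range f. \<forall>z\<in>K. norm (k z) \<le> B" if "compact K" "K \<subseteq> disc" for K
    using b that by (intro exI[of _ C]) auto
  obtain g r where g: "g holomorphic_on disc" "strict_mono (r :: nat \<Rightarrow> nat)"
     "\<And>x. x \<in> disc \<Longrightarrow> ((\<lambda>n. f (r n) x) \<longlonglongrightarrow> g x)"
     "\<And>K. \<lbrakk>compact K; K \<subseteq> disc\<rbrakk> \<Longrightarrow> uniform_limit K (f \<circ> r) g sequentially"
  proof (rule Montel[of disc "range f" f, OF open_ball])
    fix g r
    assume "g holomorphic_on disc" "strict_mono (r :: nat \<Rightarrow> nat)"
     "\<And>x. x \<in> disc \<Longrightarrow> ((\<lambda>n. f (r n) x) \<longlonglongrightarrow> g x)"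
     "\<And>K. \<lbrakk>compact K; K \<subseteq> disc\<rbrakk> \<Longrightarrow> uniform_limit K (f \<circ> r) g sequentially"
    then show thesis by (rule that)
  qed (rule 1 2 order_refl; assumption)+
  have lim: "(\<lambda>i. (deriv ^^ N) (f (r i)) z) \<longlonglongrightarrow> (deriv ^^ N) g z" if z: "norm z < 1" for N z
  proof -
    obtain s where s: "norm z < s" "s < 1" using dense[OF z] by blast
    have "uniform_limit (ball 0 s) (f \<circ> r) g sequentially"
      by (rule uniform_limit_on_subset[OF g(4)[of "cball 0 s"]]) (use s in auto)
    moreover have "(f \<circ> r) i holomorphic_on ball 0 s" for i
      using s(2) by (auto intro!: holomorphic_on_subset[OF h])
    ultimately have "(\<lambda>i. (deriv ^^ N) ((f \<circ> r) i) z) \<longlonglongrightarrow> (deriv ^^ N) g z"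
      using s(1) by (intro higher_deriv_complex_uniform_limit[of "f \<circ> r" "ball 0 s" g sequentially z]) auto
    then show ?thesis by simp
  qed
  show ?thesis
    by (rule that[OF g(1,2) _ lim]) (use g(3) in auto)
qed

text \<open>The bound \<open>C\<close> supplies normality; pointwise convergence identifies the
  limit of the subsequence, and \<open>K\<close> passes to it without loss.\<close>

lemma deriv_bounded_pointwise_limit:
  assumes f: "\<And>i. deriv_bounded N K (f i)" and b: "\<And>i z. norm z < 1 \<Longrightarrow> norm (f i z) \<le> C"
    and lim: "\<And>z. norm z < 1 \<Longrightarrow> (\<lambda>i. f i z) \<longlonglongrightarrow> g z"
  shows "deriv_bounded N K g"
proof -
  obtain g' r where g: "g' holomorphic_on disc" "strict_mono (r :: nat \<Rightarrow> nat)"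
    "\<And>z. norm z < 1 \<Longrightarrow> (\<lambda>i. f (r i) z) \<longlonglongrightarrow> g' z"
    "\<And>N z. norm z < 1 \<Longrightarrow> (\<lambda>i. (deriv ^^ N) (f (r i)) z) \<longlonglongrightarrow> (deriv ^^ N) g' z"
    using bounded_deriv_limit[of f C, OF deriv_bounded_holo[OF f] b] by metis
  have "g' z = g z" if "norm z < 1" for z
    using LIMSEQ_unique[OF g(3)[OF that] LIMSEQ_subseq_LIMSEQ[OF lim[OF that] g(2), unfolded o_def]] .
  moreover have "deriv_bounded N K g'"
    unfolding deriv_bounded_def
  proof (intro conjI ballI g(1))
    fix z assume "z \<in> disc"
    then show "norm ((deriv ^^ N) g' z) \<le> K"
      by (intro Lim_norm_ubound[OF _ g(4)]) (use f in \<open>auto simp: deriv_bounded_def\<close>)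
  qed
  ultimately show ?thesis using deriv_bounded_cong[of g' g] by simp
qed

section \<open>Finite Blaschke products\<close>

text \<open>The unimodular constant is -1 at \<open>a = 0\<close>, which turns
  \<open>(a - w) / (1 - cnj a * w)\<close> into \<open>w\<close>; a zero at the origin then needs no
  separate formula.\<close>

definition bfactor :: "complex \<Rightarrow> complex \<Rightarrow> complex" where
  "bfactor a w = (if a = 0 then -1 else cnj a / of_real (norm a)) * ((a - w) / (1 - cnj a * w))"

definition bprod :: "(nat \<Rightarrow> complex) \<Rightarrow> nat set \<Rightarrow> complex \<Rightarrow> complex" where
  "bprod z S w = (\<Prod>j\<in>S. bfactor (z j) w)"

lemma blaschke_eq: "blaschke z w = (\<Prod>j. bfactor (z j) w)"
  unfolding blaschke_def bfactor_def by (intro arg_cong[where f = prodinf] ext) auto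

lemma norm_bfactor: "norm (bfactor a w) = norm (a - w) / norm (1 - cnj a * w)"
  by (simp add: bfactor_def norm_mult norm_divide)

text \<open>Basic identity of the pseudohyperbolic metric. It gives modulus at most 1 inside the
  disc, modulus 1 on the circle, and the exact defect in \<open>norm_bfactor_square\<close>.\<close>

lemma cnj_dist_identity:
  "(norm (1 - cnj a * w))\<^sup>2 = (norm (a - w))\<^sup>2 + (1 - (norm a)\<^sup>2) * (1 - (norm w)\<^sup>2)"
  unfolding cmod_power2 by (simp add: algebra_simps power2_eq_square)

lemma one_minus_cnj_pos:
  assumes "norm a < 1" "norm w \<le> 1"
  shows "0 < Re (1 - cnj a * w)" "1 - norm a \<le> norm (1 - cnj a * w)" "1 - cnj a * w \<noteq> 0"
proof -
  have "norm (cnj a * w) \<le> norm a"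
    using assms by (simp add: norm_mult mult_left_le)
  then have le: "1 - norm a \<le> 1 - norm (cnj a * w)" by simp
  also have "\<dots> \<le> norm (1 - cnj a * w)"
    by (metis norm_one norm_triangle_ineq2)
  finally show "1 - norm a \<le> norm (1 - cnj a * w)" .
  then show "1 - cnj a * w \<noteq> 0" using assms by auto
  have "Re (cnj a * w) \<le> norm (cnj a * w)" by (rule complex_Re_le_cmod)
  with le assms show "0 < Re (1 - cnj a * w)" by simp
qed

lemma dist_le_cnj:
  assumes "norm a \<le> 1" "norm w \<le> 1"
  shows "norm (a - w) \<le> norm (1 - cnj a * w)"
proof (rule power2_le_imp_le)
  have "0 \<le> (1 - (norm a)\<^sup>2) * (1 - (norm w)\<^sup>2)"
    using assms by (intro mult_nonneg_nonneg) (auto simp: power_le_one)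
  then show "(norm (a - w))\<^sup>2 \<le> (norm (1 - cnj a * w))\<^sup>2"
    unfolding cnj_dist_identity by simp
qed simp

text \<open>With \<open>dist_le_cnj\<close> and \<open>one_minus_cnj_pos\<close> this makes
  \<open>norm (1 - cnj a * w)\<close> comparable to \<open>1 - norm a + norm (w - a)\<close>; that
  is how Blaschke denominators become Euclidean distances.\<close>

lemma cnj_le_dist:
  assumes "norm a \<le> 1"
  shows "norm (1 - cnj a * w) \<le> 2 * (1 - norm a) + norm (w - a)"
proof -
  have "1 - cnj a * w = of_real (1 - (norm a)\<^sup>2) - cnj a * (w - a)"
    by (simp add: algebra_simps complex_norm_square[symmetric])
  then have "norm (1 - cnj a * w) \<le> norm (of_real (1 - (norm a)\<^sup>2) :: complex) + norm (cnj a * (w - a))"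
    by (metis norm_triangle_ineq4)
  moreover have "norm (of_real (1 - (norm a)\<^sup>2) :: complex) = (1 - norm a) * (1 + norm a)"
    using assms unfolding norm_of_real
    by (subst abs_of_nonneg) (auto simp: power_le_one power2_eq_square algebra_simps mult_le_one)
  moreover have "(1 - norm a) * (1 + norm a) \<le> (1 - norm a) * 2"
    using assms by (intro mult_left_mono) auto
  moreover have "norm (cnj a * (w - a)) \<le> norm (w - a)"
    using assms by (simp add: norm_mult mult_left_le_one_le)
  ultimately show ?thesis by linarith
qed

lemma bfactor_holo: 
  assumes "norm a < 1" shows "bfactor a holomorphic_on ball 0 1" "continuous_on (cball 0 1) (bfactor a)"
  unfolding bfactor_def[abs_def] using one_minus_cnj_pos(3)[OF assms]
  by (auto intro!: holomorphic_intros continuous_intros)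

lemma norm_bfactor_le_1:
  assumes "norm a < 1" "norm w \<le> 1"
  shows "norm (bfactor a w) \<le> 1"
  unfolding norm_bfactor using dist_le_cnj[of a w] assms one_minus_cnj_pos(3)[OF assms] by simp

lemma norm_bfactor_circle:
  assumes "norm a < 1" "norm w = 1"
  shows "norm (bfactor a w) = 1"
proof -
  have "(norm (1 - cnj a * w))\<^sup>2 = (norm (a - w))\<^sup>2"
    unfolding cnj_dist_identity using assms by simp
  then have "norm (1 - cnj a * w) = norm (a - w)" by (rule power2_eq_imp_eq) auto
  then show ?thesis using one_minus_cnj_pos(3)[of a w] assms by (auto simp: norm_bfactor)
qed

lemma norm_bfactor_square:
  assumes "1 - cnj a * w \<noteq> 0"
  shows "(norm (bfactor a w))\<^sup>2 = 1 - (1 - (norm a)\<^sup>2) * (1 - (norm w)\<^sup>2) / (norm (1 - cnj a * w))\<^sup>2"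
  using cnj_dist_identity[of a w] assms by (simp add: norm_bfactor power_divide field_simps)

lemma bprod_holo: 
  assumes "\<forall>j\<in>S. norm (z j) < 1" 
  shows "bprod z S holomorphic_on ball 0 1" "continuous_on (cball 0 1) (bprod z S)"
  unfolding bprod_def[abs_def] using bfactor_holo assms
  by (auto intro!: holomorphic_on_prod continuous_on_prod)

lemma norm_bprod_le_1:
  assumes "\<forall>j\<in>S. norm (z j) < 1" "norm w \<le> 1"
  shows "norm (bprod z S w) \<le> 1"
  unfolding bprod_def prod_norm[symmetric] using assms by (intro prod_le_1) (auto intro: norm_bfactor_le_1)

lemma norm_bprod_circle:
  assumes "\<forall>j\<in>S. norm (z j) < 1" "norm w = 1"
  shows "norm (bprod z S w) = 1"
  unfolding bprod_def prod_norm[symmetric] using assms by (intro prod.neutral ballI norm_bfactor_circle) auto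

lemma bprod_boundary:
  assumes "\<forall>j\<in>S. norm (z j) < 1" "e > 0"
  shows "\<exists>r. 0 \<le> r \<and> r < 1 \<and> (\<forall>w. r < norm w \<and> norm w < 1 \<longrightarrow> 1 - e < norm (bprod z S w))"
proof -
  obtain r where r: "0 \<le> r" "r < 1"
    "\<And>w. r < norm w \<and> norm w < 1 \<Longrightarrow> norm (bprod z S w - bprod z S (w / norm w)) < e"
    using radial_uniform[OF bprod_holo(2)[OF assms(1)] assms(2)] by blast
  have "1 - e < norm (bprod z S w)" if w: "r < norm w" "norm w < 1" for w
  proof -
    have "norm (bprod z S (w / norm w)) = 1"
      by (rule norm_bprod_circle[OF assms(1)]) (use w r in \<open>auto simp: norm_divide\<close>)
    moreover have "norm (bprod z S (w / norm w)) - norm (bprod z S w) \<le> norm (bprod z S w - bprod z S (w / norm w))"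
      by (metis norm_minus_commute norm_triangle_ineq2)
    ultimately show ?thesis using r(3)[of w] w by linarith
  qed
  with r show ?thesis by blast
qed

lemma inner_division_finite:
  assumes S: "\<forall>j\<in>S. norm (z j) < 1" and H: "H holomorphic_on disc"
    and b: "\<And>w. norm w < 1 \<Longrightarrow> norm (H w * bprod z S w) \<le> C" and w: "norm w < 1"
  shows "norm (H w) \<le> C"
proof (rule max_principle[OF H _ w])
  fix e :: real assume e: "e > 0"
  have C: "C \<ge> 0" using order_trans[OF norm_ge_zero b[of 0]] by simp
  \<comment> \<open>Chosen so that \<open>(C + e) * (1 - t) = C\<close>: a value of \<open>H\<close>
    above \<open>C + e\<close> would push the product above \<open>C\<close>.\<close>
  define t where "t = e / (C + e)"
  have t: "0 < t" "t \<le> 1" "(C + e) * (1 - t) = C" using e C by (auto simp: t_def field_simps)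
  obtain r where r: "r < 1" "\<And>w. r < norm w \<and> norm w < 1 \<Longrightarrow> 1 - t < norm (bprod z S w)"
    using bprod_boundary[OF S t(1)] by blast
  have "norm (H w) \<le> C + e" if w: "r < norm w" "norm w < 1" for w
  proof (rule ccontr)
    assume "\<not> ?thesis"
    then have "(C + e) * (1 - t) < norm (H w) * norm (bprod z S w)"
      using t e C r(2)[of w] w by (intro mult_strict_mono') auto
    with b[OF w(2)] t(3) show False by (simp add: norm_mult)
  qed
  with r(1) show "\<exists>r<1. \<forall>z. r < norm z \<and> norm z < 1 \<longrightarrow> norm (H z) \<le> C + e" by blast
qed

section \<open>Division by a single linear or Blaschke factor, and local derivative bounds\<close>

lemma higher_deriv_linear:
  "(deriv ^^ i) (\<lambda>z. c + d * z) w = (if i = 0 then c + d * w else if i = 1 then d else (0::complex))"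
proof (cases i)
  case (Suc k)
  have 1: "deriv (\<lambda>z. c + d * z) = (\<lambda>_. d)"
    by (intro ext DERIV_imp_deriv) (auto intro!: derivative_eq_intros)
  have "(deriv ^^ Suc k) (\<lambda>z. c + d * z) = (if k = 0 then (\<lambda>_. d) else (\<lambda>_. 0))" for k
    by (induction k) (auto simp: 1)
  then show ?thesis unfolding Suc by (auto simp del: funpow.simps)
qed simp

text \<open>Only orders 0 and 1 of the linear factor survive in the Leibniz sum. For
  \<open>N = 0\<close> the truncated \<open>N - 1\<close> is harmless, since its term carries the
  factor 0.\<close>

lemma higher_deriv_linear_mult:
  assumes "G holomorphic_on A" "open A" "w \<in> A" 
  shows "(deriv ^^ N) (\<lambda>z. (c + d * z) * G z) w = 
     (c + d * w) * (deriv ^^ N) G w + of_nat N * d * (deriv ^^ (N - 1)) G w"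
proof -
  have "(deriv ^^ N) (\<lambda>z. (c + d * z) * G z) w = 
     (\<Sum>i=0..N. of_nat (N choose i) * (deriv ^^ i) (\<lambda>z. c + d * z) w * (deriv ^^ (N - i)) G w)"
    by (rule higher_deriv_mult[OF _ assms]) (intro holomorphic_intros)
  also have "\<dots> = (\<Sum>i\<in>{0..N} \<inter> {0,1}. of_nat (N choose i) * (deriv ^^ i) (\<lambda>z. c + d * z) w * (deriv ^^ (N - i)) G w)"
    by (rule sum.mono_neutral_right) (auto simp: higher_deriv_linear)
  also have "\<dots> = (c + d * w) * (deriv ^^ N) G w + of_nat N * d * (deriv ^^ (N - 1)) G w"
  proof (cases N)
    case (Suc k)
    then have "{0..N} \<inter> {0,1::nat} = {0,1}" by auto
    then show ?thesis unfolding \<open>{0..N} \<inter> {0,1::nat} = {0,1}\<close> by (simp add: higher_deriv_linear del: funpow.simps)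
  qed (simp add: higher_deriv_linear)
  finally show ?thesis .
qed

text \<open>Division by \<open>z - a\<close> costs one derivative and no constant. The second bound
  recovers the lost derivative with the weight \<open>norm (z - a)\<close>, which is what
  \<open>bfactor_division\<close> needs near the circle.\<close>

lemma linear_quotient:
  assumes G: "G holomorphic_on disc" and F: "deriv_bounded (Suc N) K (\<lambda>z. (z - a) * G z)" and a: "norm a < 1"
  shows "deriv_bounded N K G"
    and "\<And>z. norm z < 1 \<Longrightarrow> norm (z - a) * norm ((deriv ^^ Suc N) G z) \<le> (real N + 2) * K"
proof -
  define F' where "F' = (\<lambda>z. (z - a) * G z)"
  have der: "(deriv ^^ i) F' z = (z - a) * (deriv ^^ i) G z + of_nat i * (deriv ^^ (i - 1)) G z"
    if "norm z < 1" for i z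
    using higher_deriv_linear_mult[OF G open_ball, of z i "- a" 1] that by (simp add: F'_def)
  have ne: "norm ((deriv ^^ N) G z) \<le> K" if z: "norm z < 1" "z \<noteq> a" for z
  proof -
    \<comment> \<open>The Taylor polynomial of \<open>F'\<close> at \<open>z\<close>, evaluated at the zero \<open>a\<close>, telescopes.\<close>
    have tele: "(\<Sum>i\<le>m. (deriv ^^ i) F' z * (a - z) ^ i / fact i) = - ((a - z) ^ Suc m * (deriv ^^ m) G z / fact m)" for m
    proof (induction m)
      case (Suc m)
      have "(deriv ^^ Suc m) F' z * (a - z) ^ Suc m / fact (Suc m) =
        - ((a - z) ^ Suc (Suc m) * (deriv ^^ Suc m) G z / fact (Suc m)) + (a - z) ^ Suc m * (deriv ^^ m) G z / fact m"
        unfolding der[OF z(1)] by (simp add: field_simps del: funpow.simps of_nat_Suc)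
      then show ?case using Suc.IH by (simp del: funpow.simps fact_Suc power_Suc)
    qed (simp add: der[OF z(1), of 0, simplified] algebra_simps)
    have "norm (F' a - (\<Sum>i\<le>N. (deriv ^^ i) F' z * (a - z) ^ i / fact i)) \<le> K * norm (a - z) ^ Suc N / fact N"
      by (rule taylor_bound) (use F z a in \<open>auto simp: F'_def\<close>)
    also have "F' a - (\<Sum>i\<le>N. (deriv ^^ i) F' z * (a - z) ^ i / fact i) = (a - z) ^ Suc N * (deriv ^^ N) G z / fact N"
      unfolding tele by (simp add: F'_def)
    finally have "norm (a - z) ^ Suc N * norm ((deriv ^^ N) G z) \<le> norm (a - z) ^ Suc N * K"
      unfolding norm_mult norm_divide norm_power by (simp add: divide_le_cancel mult.commute)
    then show ?thesis using z by (simp add: mult_le_cancel_left)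
  qed
  have "norm ((deriv ^^ N) G z) \<le> K" if z: "norm z < 1" for z
  proof (cases "z = a")
    case True
    have "isCont ((deriv ^^ N) G) a"
      using holomorphic_on_imp_continuous_on[OF holomorphic_higher_deriv[OF G open_ball]] a
      by (auto simp: continuous_on_eq_continuous_at)
    then have "((\<lambda>z. norm ((deriv ^^ N) G z)) \<longlongrightarrow> norm ((deriv ^^ N) G a)) (at a)"
      by (auto simp: isCont_def intro: tendsto_norm)
    moreover have "\<forall>\<^sub>F z in at a. norm ((deriv ^^ N) G z) \<le> K"
      unfolding eventually_at_topological
      by (intro exI[of _ disc]) (use a ne in auto)
    ultimately show ?thesis using True tendsto_upperbound by (metis at_neq_bot)
  qed (use ne z in auto)
  then show 1: "deriv_bounded N K G" using G by (simp add: deriv_bounded_def)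
  show "norm (z - a) * norm ((deriv ^^ Suc N) G z) \<le> (real N + 2) * K" if z: "norm z < 1" for z
  proof -
    have "(z - a) * (deriv ^^ Suc N) G z = (deriv ^^ Suc N) F' z - of_nat (Suc N) * (deriv ^^ N) G z"
      using der[OF z, of "Suc N"] by (simp del: funpow.simps of_nat_Suc)
    then have "norm ((z - a) * (deriv ^^ Suc N) G z) \<le> norm ((deriv ^^ Suc N) F' z) + norm (of_nat (Suc N) * (deriv ^^ N) G z)"
      by (metis norm_triangle_ineq4)
    also have "\<dots> \<le> K + real (Suc N) * K"
      unfolding norm_mult norm_of_nat
      using deriv_boundedD[OF F z] deriv_boundedD[OF 1 z] by (intro add_mono mult_left_mono) (auto simp: F'_def)
    finally show ?thesis unfolding norm_mult by (simp add: algebra_simps del: funpow.simps)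
  qed
qed

text \<open>No derivative is lost, because \<open>norm (z - a)\<close> and
  \<open>norm (1 - cnj a * z)\<close> agree on the circle: \<open>G\<close> is
  \<open>(1 - cnj a * z) * H\<close> up to a unimodular constant, and the weighted bound of
  \<open>linear_quotient\<close> controls its top derivative there. The constants
  \<open>N + 1\<close> and \<open>N\<close> of the two Leibniz terms add up to
  \<open>2 * N + 1\<close>.\<close>

lemma bfactor_division:
  assumes G: "G holomorphic_on disc" and a: "norm a < 1" and F: "deriv_bounded N K (\<lambda>z. G z * bfactor a z)"
  shows "deriv_bounded N ((2 * real N + 1) * K) G"
proof (cases N)
  case 0
  then have "norm (G z) \<le> K" if "norm z < 1" for z
    using inner_division_finite[of "{0}" "\<lambda>_. a" G K z] F a G that
    by (auto simp: deriv_bounded_def bprod_def)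
  then show ?thesis using 0 G by (auto simp: deriv_bounded_def)
next
  case (Suc M)
  define u where "u = (if a = 0 then -1 else cnj a / of_real (norm a))"
  have u: "norm u = 1" by (simp add: u_def norm_divide)
  define H where "H = (\<lambda>z. G z * (- u) / (1 - cnj a * z))"
  have H: "H holomorphic_on disc"
    unfolding H_def using one_minus_cnj_pos(3)[OF a] by (auto intro!: holomorphic_intros G)
  have FH: "G z * bfactor a z = (z - a) * H z" for z
    unfolding bfactor_def H_def u_def[symmetric] by (simp add: divide_inverse algebra_simps)
  have F': "deriv_bounded (Suc M) K (\<lambda>z. (z - a) * H z)"
    using F unfolding FH Suc .
  note q = linear_quotient[OF H F' a]
  have K: "K \<ge> 0" using deriv_bounded_nonneg[OF F] .
  have GH: "G z = (- 1 / u) * ((1 + (- cnj a) * z) * H z)" if "norm z < 1" for z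
  proof -
    define D where "D = 1 - cnj a * z"
    have "D \<noteq> 0" "u \<noteq> 0" using one_minus_cnj_pos(3)[OF a, of z] u that by (auto simp: D_def)
    moreover have "1 + (- cnj a) * z = D" "H z = G z * (- u) / D" by (simp_all add: H_def D_def)
    ultimately show ?thesis by simp
  qed
  have dG: "(deriv ^^ N) G z = (- 1 / u) * ((1 + (- cnj a) * z) * (deriv ^^ N) H z + of_nat N * (- cnj a) * (deriv ^^ M) H z)"
    if "norm z < 1" for z
  proof -
    have h: "(\<lambda>z. (1 + (- cnj a) * z) * H z) holomorphic_on disc"
      by (intro holomorphic_intros H)
    have "(deriv ^^ N) G z = (deriv ^^ N) (\<lambda>z. (- 1 / u) * ((1 + (- cnj a) * z) * H z)) z"
      by (rule higher_deriv_transform_within_open[of _ disc])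
        (use that GH G in \<open>auto intro!: holomorphic_intros H\<close>)
    also have "\<dots> = (- 1 / u) * (deriv ^^ N) (\<lambda>z. (1 + (- cnj a) * z) * H z) z"
      using that by (intro higher_deriv_cmult_open[OF h]) auto
    also have "(deriv ^^ N) (\<lambda>z. (1 + (- cnj a) * z) * H z) z = 
       (1 + (- cnj a) * z) * (deriv ^^ N) H z + of_nat N * (- cnj a) * (deriv ^^ (N - 1)) H z"
      using that by (intro higher_deriv_linear_mult[OF H]) auto
    finally show ?thesis using Suc by simp
  qed
  have "norm ((deriv ^^ N) G z) \<le> (2 * real N + 1) * K" if z: "norm z < 1" for z
  proof (rule max_principle[OF holomorphic_higher_deriv[OF G open_ball] _ z])
    fix e :: real assume e: "e > 0"
    define D where "D = (real M + 2) * K"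
    have D: "D \<ge> 0" using K by (simp add: D_def)
    define t where "t = e / (D + e)"
    have t: "0 < t" "t \<le> 1" "(D + e) * (1 - t) = D" using e D by (auto simp: t_def field_simps)
    obtain r where r: "r < 1" "\<And>w. r < norm w \<and> norm w < 1 \<Longrightarrow> 1 - t < norm (bprod (\<lambda>_. a) {0} w)"
      using bprod_boundary[of "{0}" "\<lambda>_. a" t] a t(1) by auto
    have "norm ((deriv ^^ N) G z) \<le> (2 * real N + 1) * K + e" if z: "r < norm z" "norm z < 1" for z
    proof -
      have b: "1 - t < norm (a - z) / norm (1 - cnj a * z)"
        using r(2)[of z] z by (simp add: bprod_def norm_bfactor)
      have p: "0 < norm (1 - cnj a * z)" using one_minus_cnj_pos(3)[OF a, of z] z by simp
      have "norm (1 - cnj a * z) * norm ((deriv ^^ N) H z) \<le> D + e"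
      proof (rule ccontr)
        assume "\<not> ?thesis"
        then have "(D + e) * (1 - t) < (norm (1 - cnj a * z) * norm ((deriv ^^ N) H z)) * (norm (a - z) / norm (1 - cnj a * z))"
          using b t e D by (intro mult_strict_mono') auto
        also have "\<dots> = norm (z - a) * norm ((deriv ^^ Suc M) H z)"
          using p Suc by (simp add: norm_minus_commute)
        finally show False using q(2)[OF z(2)] t(3) D_def by simp
      qed
      moreover have "norm (of_nat N * (- cnj a) * (deriv ^^ M) H z) \<le> real N * 1 * K"
        unfolding norm_mult norm_of_nat using a deriv_boundedD[OF q(1) z(2)] K
        by (intro mult_mono) auto
      moreover have "norm ((deriv ^^ N) G z) \<le> norm ((1 + (- cnj a) * z) * (deriv ^^ N) H z) + norm (of_nat N * (- cnj a) * (deriv ^^ M) H z)"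
      proof -
        have "norm (- 1 / u) = 1" using u by (simp add: norm_divide)
        then show ?thesis
          unfolding dG[OF z(2)] norm_mult[of "- 1 / u"] by (simp only: mult_1 norm_triangle_ineq)
      qed
      ultimately have "norm ((deriv ^^ N) G z) \<le> D + e + real N * K" by (simp add: norm_mult)
      then show ?thesis using Suc by (simp add: D_def algebra_simps)
    qed
    then show "\<exists>r<1. \<forall>z. r < norm z \<and> norm z < 1 \<longrightarrow> norm ((deriv ^^ N) G z) \<le> (2 * real N + 1) * K + e"
      using r(1) by blast
  qed
  then show ?thesis using G by (simp add: deriv_bounded_def)
qed

text \<open>Interpolation between the size of \<open>g\<close> and its \<open>N\<close>-th
  derivative at scale \<rho>. Near the circle no disc of radius comparable to \<rho> about
  \<open>z0\<close> need fit into the domain, so Cauchy's inequality is applied at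
  \<open>z1\<close>, pulled inwards by at most \<rho>/2, and Taylor's formula leads back to
  \<open>z0\<close>.\<close>

lemma local_derivative_bound:
  assumes g: "deriv_bounded N K g" and K: "K \<ge> 0" and \<rho>: "0 < \<rho>" "\<rho> \<le> 2" and z0: "norm z0 < 1"
    and b: "\<And>z. norm z < 1 \<Longrightarrow> norm (z - z0) < \<rho> \<Longrightarrow> norm (g z) \<le> K * \<rho> ^ N" and i: "i \<le> N"
  shows "norm ((deriv ^^ i) g z0) \<le> (fact N * 4 ^ N * exp 1 + 1) * K * \<rho> ^ (N - i)"
proof (cases "i = N")
  case True
  have "norm ((deriv ^^ N) g z0) \<le> 1 * K" using deriv_boundedD[OF g z0] by simp
  also have "\<dots> \<le> (fact N * 4 ^ N * exp 1 + 1) * K" using K by (intro mult_right_mono) auto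
  finally show ?thesis using True by simp
next
  case False
  define z1 where "z1 = (1 - of_real (\<rho>/2)) * z0"
  define M where "M = N - i - 1"
  have M: "N - i = Suc M" "Suc M + i = N" using False i by (auto simp: M_def)
  have hg: "g holomorphic_on disc" using g deriv_bounded_holo by blast
  have n1: "norm z1 \<le> 1 - \<rho>/2"
  proof -
    have "z1 = of_real (1 - \<rho>/2) * z0" by (simp add: z1_def)
    then have "norm z1 = (1 - \<rho>/2) * norm z0"
      using \<rho> by (simp add: norm_mult del: of_real_diff of_real_divide)
    then show ?thesis using \<rho> z0 by (simp add: mult_left_le)
  qed
  have d1: "norm (z0 - z1) \<le> \<rho>/2"
  proof -
    have "z0 - z1 = of_real (\<rho>/2) * z0" by (simp add: z1_def algebra_simps)
    then have "norm (z0 - z1) = (\<rho>/2) * norm z0"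
      using \<rho> by (simp add: norm_mult del: of_real_diff of_real_divide)
    then show ?thesis using \<rho> z0 by (simp add: mult_left_le)
  qed
  have sub: "cball z1 (\<rho>/4) \<subseteq> disc \<inter> ball z0 \<rho>"
  proof
    fix w assume "w \<in> cball z1 (\<rho>/4)"
    then have w: "norm (w - z1) \<le> \<rho>/4" by (simp add: dist_norm norm_minus_commute)
    have "norm w \<le> norm z1 + norm (w - z1)" by (rule norm_triangle_sub)
    moreover have "norm (w - z0) \<le> norm (w - z1) + norm (z0 - z1)" 
      using norm_triangle_ineq4[of "w - z1" "z0 - z1"] by simp
    ultimately show "w \<in> disc \<inter> ball z0 \<rho>" using w n1 d1 \<rho> by (auto simp: dist_norm norm_minus_commute)
  qed
  have cau: "norm ((deriv ^^ j) g z1) \<le> fact j * (K * \<rho> ^ N) / (\<rho>/4) ^ j" for j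
  proof (rule Cauchy_inequality)
    show "g holomorphic_on ball z1 (\<rho>/4)" "continuous_on (cball z1 (\<rho>/4)) g"
      using sub ball_subset_cball[of z1 "\<rho>/4"]
      by (auto intro!: holomorphic_on_subset[OF hg] continuous_on_subset[OF holomorphic_on_imp_continuous_on[OF hg]])
    show "norm (g x) \<le> K * \<rho> ^ N" if "norm (z1 - x) = \<rho>/4" for x
      using b[of x] subsetD[OF sub, of x] that by (auto simp: dist_norm norm_minus_commute)
  qed (use \<rho> in auto)
  have dbi: "deriv_bounded (Suc M) K ((deriv ^^ i) g)"
    unfolding deriv_bounded_def
  proof (intro conjI ballI holomorphic_higher_deriv[OF hg open_ball])
    fix z :: complex assume "z \<in> disc"
    then show "norm ((deriv ^^ Suc M) ((deriv ^^ i) g) z) \<le> K"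
      using deriv_boundedD[OF g, of z] M(2) funpow_add[of "Suc M" i deriv, unfolded o_def, THEN fun_cong, of g] by simp
  qed
  have tb: "norm ((deriv ^^ i) g z0 - (\<Sum>m\<le>M. (deriv ^^ m) ((deriv ^^ i) g) z1 * (z0 - z1) ^ m / fact m))
     \<le> K * norm (z0 - z1) ^ Suc M / fact M"
    by (rule taylor_bound[OF dbi]) (use n1 \<rho> z0 in auto)
  have r1: "K * norm (z0 - z1) ^ Suc M / fact M \<le> K * \<rho> ^ Suc M"
  proof -
    have "K * norm (z0 - z1) ^ Suc M / fact M \<le> K * norm (z0 - z1) ^ Suc M / 1"
      using K fact_ge_1[of M] by (intro divide_left_mono) auto
    also have "\<dots> \<le> K * \<rho> ^ Suc M"
      unfolding div_by_1 using d1 \<rho> K by (intro mult_left_mono power_mono) auto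
    finally show ?thesis .
  qed
  \<comment> \<open>The radius \<open>\<rho> / 4\<close> gives the power of 4; the factor
    \<open>1 / fact m\<close> is kept so that the sum over \<open>m\<close> is absorbed by
    \<open>exp 1\<close>.\<close>
  have tm: "norm ((deriv ^^ m) ((deriv ^^ i) g) z1 * (z0 - z1) ^ m / fact m) \<le> fact N * 4 ^ N * K * \<rho> ^ Suc M * (1 / fact m)" if m: "m \<le> M" for m
  proof -
    have eq: "(deriv ^^ m) ((deriv ^^ i) g) = (deriv ^^ (m + i)) g" by (simp add: funpow_add)
    have "norm ((deriv ^^ m) ((deriv ^^ i) g) z1) \<le> fact (m + i) * (K * \<rho> ^ N) / (\<rho>/4) ^ (m + i)"
      unfolding eq by (rule cau)
    also have "\<dots> = fact (m + i) * 4 ^ (m + i) * K * \<rho> ^ (N - (m + i))"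
      using \<rho> m M by (simp add: power_divide power_diff field_simps)
    also have "\<dots> \<le> fact N * 4 ^ N * K * \<rho> ^ (N - (m + i))"
      using m M K \<rho> by (intro mult_right_mono mult_mono fact_mono power_increasing) auto
    finally have "norm ((deriv ^^ m) ((deriv ^^ i) g) z1) * norm (z0 - z1) ^ m \<le> fact N * 4 ^ N * K * \<rho> ^ (N - (m + i)) * \<rho> ^ m"
      using d1 \<rho> K by (intro mult_mono power_mono mult_nonneg_nonneg) auto
    also have "\<dots> = fact N * 4 ^ N * K * \<rho> ^ Suc M"
    proof -
      have "N - (m + i) + m = Suc M" using m M by simp
      then show ?thesis by (metis (no_types, lifting) mult.assoc power_add)
    qed
    finally show ?thesis by (simp add: norm_mult norm_divide norm_power divide_right_mono)
  qed
  have "(\<Sum>m\<le>M. 1 / fact m :: real) \<le> exp 1"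
    using sum_le_suminf[OF summable_exp[of "1::real"], of "{..M}"] by (simp add: exp_def inverse_eq_divide)
  then have "(\<Sum>m\<le>M. fact N * 4 ^ N * K * \<rho> ^ Suc M * (1 / fact m)) \<le> fact N * 4 ^ N * K * \<rho> ^ Suc M * exp 1"
    unfolding sum_distrib_left[symmetric] using K \<rho> by (intro mult_left_mono) auto
  moreover have "norm (\<Sum>m\<le>M. (deriv ^^ m) ((deriv ^^ i) g) z1 * (z0 - z1) ^ m / fact m) \<le> (\<Sum>m\<le>M. fact N * 4 ^ N * K * \<rho> ^ Suc M * (1 / fact m))"
    by (rule sum_norm_le) (use tm in auto)
  ultimately have "norm ((deriv ^^ i) g z0) \<le> K * \<rho> ^ Suc M + fact N * 4 ^ N * K * \<rho> ^ Suc M * exp 1"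
    using tb r1 norm_triangle_ineq2[of "(deriv ^^ i) g z0" "\<Sum>m\<le>M. (deriv ^^ m) ((deriv ^^ i) g) z1 * (z0 - z1) ^ m / fact m"] by linarith
  then show ?thesis unfolding M(1) by (simp add: algebra_simps)
qed

section \<open>Infinite Blaschke products\<close>

lemma blaschke_seqD:
  assumes "blaschke_seq z"
  shows "norm (z j) < 1" "summable (\<lambda>j. 1 - norm (z j))" "blaschke_seq (\<lambda>j. z (j + n))"
proof -
  have "z j \<in> range z" by simp
  then have "z j \<in> ball 0 1" using assms unfolding blaschke_seq_def by blast
  then show "norm (z j) < 1" by simp
  show s: "summable (\<lambda>j. 1 - norm (z j))"
    using assms by (simp add: blaschke_seq_def)
  show "blaschke_seq (\<lambda>j. z (j + n))"
    using assms summable_ignore_initial_segment[OF s, of n] by (auto simp: blaschke_seq_def)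
qed

lemma norm_bfactor_minus_one:
  assumes a: "norm a < 1" and w: "norm w < 1"
  shows "norm (bfactor a w - 1) \<le> 2 / (1 - norm w) * (1 - norm a)"
proof (cases "a = 0")
  case True
  have "norm (w - 1) \<le> 2" using norm_triangle_ineq4[of w 1] w by simp
  also have "2 \<le> 2 / (1 - norm w)" using w by (simp add: field_simps)
  finally show ?thesis using True by (simp add: bfactor_def)
next
  case False
  have nz: "1 - cnj a * w \<noteq> 0" using one_minus_cnj_pos(3)[OF a, of w] w by simp
  define n where "n = (of_real (norm a) :: complex)"
  have n: "n \<noteq> 0" "cnj a * a = n * n"
    using False by (simp_all add: n_def mult.commute[of "cnj a"] complex_norm_square[symmetric] power2_eq_square[symmetric])
  have "1 - bfactor a w = (1 - n) * (1 + cnj a * w / n) / (1 - cnj a * w)"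
    using nz n False unfolding bfactor_def n_def[symmetric]
    by (simp add: field_simps)
  then have "norm (bfactor a w - 1) = norm (1 - n) * norm (1 + cnj a * w / n) / norm (1 - cnj a * w)"
    by (metis norm_minus_commute norm_mult norm_divide)
  also have "norm (1 - n) = 1 - norm a"
    using a unfolding n_def by (metis abs_of_nonneg diff_ge_0_iff_ge less_imp_le norm_of_real of_real_1 of_real_diff)
  also have "(1 - norm a) * norm (1 + cnj a * w / n) / norm (1 - cnj a * w) \<le> (1 - norm a) * 2 / (1 - norm w)"
  proof (intro frac_le mult_left_mono)
    have "norm (cnj a * w / n) = norm w" using False by (simp add: n_def norm_mult norm_divide)
    then show "norm (1 + cnj a * w / n) \<le> 2" using norm_triangle_ineq[of 1 "cnj a * w / n"] w by simp
    have "norm (cnj a * w) \<le> norm w" using a by (simp add: norm_mult mult_left_le_one_le)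
    then show "1 - norm w \<le> norm (1 - cnj a * w)" using norm_triangle_ineq2[of 1 "cnj a * w"] by simp
  qed (use a w in auto)
  finally show ?thesis by (simp add: mult.commute)
qed

lemma bprod_LIMSEQ:
  assumes z: "blaschke_seq z" and w: "norm w < 1"
  shows "(\<lambda>n. bprod z {..<n} w) \<longlonglongrightarrow> blaschke z w"
proof -
  have "summable (\<lambda>j. norm (bfactor (z j) w - 1))"
  proof (rule summable_comparison_test')
    show "summable (\<lambda>j. 2 / (1 - norm w) * (1 - norm (z j)))"
      by (intro summable_mult blaschke_seqD(2) z)
    show "norm (norm (bfactor (z j) w - 1)) \<le> 2 / (1 - norm w) * (1 - norm (z j))" for j
      using norm_bfactor_minus_one[OF blaschke_seqD(1)[OF z] w] by simp
  qed
  then have "convergent_prod (\<lambda>j. bfactor (z j) w)"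
    by (intro abs_convergent_prod_imp_convergent_prod) (simp add: abs_convergent_prod_conv_summable)
  then have "(\<lambda>n. \<Prod>j\<le>n. bfactor (z j) w) \<longlonglongrightarrow> blaschke z w"
    unfolding blaschke_eq by (rule convergent_prod_LIMSEQ)
  then have "(\<lambda>n. bprod z {..<Suc n} w) \<longlonglongrightarrow> blaschke z w"
    unfolding bprod_def lessThan_Suc_atMost .
  then show ?thesis by (rule LIMSEQ_imp_Suc)
qed

lemma blaschke_holo:
  assumes z: "blaschke_seq z"
  shows "blaschke z holomorphic_on disc"
proof -
  have "deriv_bounded 0 1 (blaschke z)"
  proof (rule deriv_bounded_pointwise_limit[where f = "\<lambda>n. bprod z {..<n}" and C = 1])
    show "deriv_bounded 0 1 (bprod z {..<n})" for n
      using blaschke_seqD(1)[OF z] by (auto simp: deriv_bounded_def bprod_holo intro!: norm_bprod_le_1)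
    show "norm (bprod z {..<n} w) \<le> 1" if "norm w < 1" for n w
      using blaschke_seqD(1)[OF z] that by (auto intro!: norm_bprod_le_1)
  qed (rule bprod_LIMSEQ[OF z])
  then show ?thesis by (rule deriv_bounded_holo)
qed

lemma norm_blaschke_le_1:
  assumes "blaschke_seq z" "norm w < 1"
  shows "norm (blaschke z w) \<le> 1"
  by (rule Lim_norm_ubound[OF _ bprod_LIMSEQ[OF assms]])
    (use blaschke_seqD(1)[OF assms(1)] assms(2) in \<open>auto intro!: always_eventually norm_bprod_le_1\<close>)

lemma blaschke_split:
  assumes z: "blaschke_seq z" and w: "norm w < 1"
  shows "blaschke z w = bprod z {..<n} w * blaschke (\<lambda>j. z (j + n)) w"
proof (rule LIMSEQ_unique)
  show "(\<lambda>m. bprod z {..<m + n} w) \<longlonglongrightarrow> blaschke z w"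
    using LIMSEQ_ignore_initial_segment[OF bprod_LIMSEQ[OF z w]] .
  have "bprod z {..<m + n} w = bprod z {..<n} w * bprod (\<lambda>j. z (j + n)) {..<m} w" for m
  proof -
    have "bprod z {..<m + n} w = bprod z {..<n} w * bprod z {n..<m + n} w"
      unfolding bprod_def by (subst prod.union_disjoint[symmetric]) (auto intro!: prod.cong)
    also have "bprod z {n..<m + n} w = bprod (\<lambda>j. z (j + n)) {..<m} w"
      unfolding bprod_def using prod.shift_bounds_nat_ivl[of "\<lambda>j. bfactor (z j) w" 0 n m]
      by (simp add: lessThan_atLeast0)
    finally show ?thesis .
  qed
  then show "(\<lambda>m. bprod z {..<m + n} w) \<longlonglongrightarrow> bprod z {..<n} w * blaschke (\<lambda>j. z (j + n)) w"
    by (simp add: tendsto_mult_left bprod_LIMSEQ blaschke_seqD(3)[OF z] w)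
qed

text \<open>Tails link finite products to \<open>B\<close>: \<open>f\<close> times a tail,
  multiplied by the complementary finite product, is \<open>f * blaschke z\<close>, while the tail
  itself disappears in the limit.\<close>

lemma blaschke_tail_LIMSEQ:
  assumes z: "blaschke_seq z" and w: "norm w < 1"
  shows "(\<lambda>n. blaschke (\<lambda>j. z (j + n)) w) \<longlonglongrightarrow> 1"
proof -
  define s where "s = (\<lambda>n. 2 / (1 - norm w) * (\<Sum>j. 1 - norm (z (j + n))))"
  have b: "norm (blaschke (\<lambda>j. z (j + n)) w - 1) \<le> exp (s n) - 1" for n
  proof (rule Lim_norm_ubound)
    show "(\<lambda>m. bprod (\<lambda>j. z (j + n)) {..<m} w - 1) \<longlonglongrightarrow> blaschke (\<lambda>j. z (j + n)) w - 1"
      by (intro tendsto_diff bprod_LIMSEQ blaschke_seqD(3) z w tendsto_const)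
    have "norm (bprod (\<lambda>j. z (j + n)) {..<m} w - 1) \<le> exp (s n) - 1" for m
    proof -
      have "norm (bprod (\<lambda>j. z (j + n)) {..<m} w - 1) \<le> (\<Prod>j<m. 1 + norm (bfactor (z (j + n)) w - 1)) - 1"
        unfolding bprod_def using norm_prod_minus1_le_prod_minus1[of "\<lambda>j. bfactor (z (j + n)) w - 1" "{..<m}"] by simp
      also have "(\<Prod>j<m. 1 + norm (bfactor (z (j + n)) w - 1)) \<le> (\<Prod>j<m. exp (2 / (1 - norm w) * (1 - norm (z (j + n)))))"
      proof (intro prod_mono conjI)
        fix j
        show "1 + norm (bfactor (z (j + n)) w - 1) \<le> exp (2 / (1 - norm w) * (1 - norm (z (j + n))))"
          using norm_bfactor_minus_one[OF blaschke_seqD(1)[OF z] w, of "j + n"] 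
            exp_ge_add_one_self[of "2 / (1 - norm w) * (1 - norm (z (j + n)))"] by linarith
      qed auto
      also have "\<dots> = exp (2 / (1 - norm w) * (\<Sum>j<m. 1 - norm (z (j + n))))"
        by (simp add: exp_sum sum_distrib_left)
      also have "\<dots> \<le> exp (s n)"
        unfolding s_def exp_le_cancel_iff using w blaschke_seqD(1)[OF z]
        by (intro mult_left_mono sum_le_suminf summable_ignore_initial_segment blaschke_seqD(2) z)
          (auto intro: less_imp_le)
      finally show ?thesis by simp
    qed
    then show "\<forall>\<^sub>F m in sequentially. norm (bprod (\<lambda>j. z (j + n)) {..<m} w - 1) \<le> exp (s n) - 1" by simp
  qed simp
  have "(\<lambda>n. exp (s n) - 1) \<longlonglongrightarrow> exp (2 / (1 - norm w) * 0) - 1"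
    unfolding s_def by (intro tendsto_intros suminf_exist_split2 blaschke_seqD(2) z)
  then have "(\<lambda>n. exp (s n) - 1) \<longlonglongrightarrow> 0" by simp
  with always_eventually[OF allI[OF b]] have "(\<lambda>n. blaschke (\<lambda>j. z (j + n)) w - 1) \<longlonglongrightarrow> 0"
    by (rule Lim_null_comparison)
  then show ?thesis by (rule LIM_zero_cancel)
qed

section \<open>Dividing out inner factors and zeros\<close>

lemma inner_division_blaschke:
  assumes z: "blaschke_seq z" and H: "H holomorphic_on disc"
    and b: "\<And>w. norm w < 1 \<Longrightarrow> norm (H w * blaschke z w ^ m) \<le> C" and w: "norm w < 1"
  shows "norm (H w) \<le> C"
  using H b w
proof (induction m arbitrary: H w)
  case (Suc m)
  have 1: "norm (H w * blaschke z w) \<le> C" if "norm w < 1" for w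
  proof (rule Suc.IH[of "\<lambda>w. H w * blaschke z w"])
    show "(\<lambda>w. H w * blaschke z w) holomorphic_on disc"
      by (intro holomorphic_intros Suc.prems blaschke_holo z)
    show "norm (H w * blaschke z w * blaschke z w ^ m) \<le> C" if "norm w < 1" for w
      using Suc.prems(2)[OF that] by (simp add: mult.assoc)
  qed (use that in auto)
  have 2: "norm (H w * blaschke (\<lambda>j. z (j + n)) w) \<le> C" for n
  proof (rule inner_division_finite[of "{..<n}" z "\<lambda>w. H w * blaschke (\<lambda>j. z (j + n)) w"])
    show "\<forall>j\<in>{..<n}. norm (z j) < 1" using blaschke_seqD(1)[OF z] by auto
    show "(\<lambda>w. H w * blaschke (\<lambda>j. z (j + n)) w) holomorphic_on disc"
      by (intro holomorphic_intros Suc.prems blaschke_holo blaschke_seqD(3) z)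
    show "norm (H w * blaschke (\<lambda>j. z (j + n)) w * bprod z {..<n} w) \<le> C" if "norm w < 1" for w
      using 1[OF that] blaschke_split[OF z that, of n] by (simp add: mult.assoc mult.commute[of "bprod z {..<n} w"])
  qed (rule Suc.prems)
  have "(\<lambda>n. H w * blaschke (\<lambda>j. z (j + n)) w) \<longlonglongrightarrow> H w * 1"
    by (intro tendsto_intros blaschke_tail_LIMSEQ z Suc.prems)
  then have "norm (H w * 1) \<le> C"
    by (rule Lim_norm_ubound[OF sequentially_bot]) (intro always_eventually allI 2)
  then show ?case by simp
qed auto

lemma zero_division:
  assumes "finite T" "f holomorphic_on disc" "\<forall>l\<in>T. norm (z l) < 1 \<and> f (z l) = 0" "inj_on z T"
  shows "\<exists>G. G holomorphic_on disc \<and> (\<forall>w\<in>disc. f w = G w * bprod z T w)"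
  using assms
proof (induction T arbitrary: f rule: finite_induct)
  case empty
  then show ?case by (auto simp: bprod_def)
next
  case (insert l T)
  define a where "a = z l"
  define u where "u = (if a = 0 then -1 else cnj a / of_real (norm a))"
  have u: "u \<noteq> 0" by (simp add: u_def)
  have a: "norm a < 1" "f a = 0" using insert.prems by (auto simp: a_def)
  define g where "g = (\<lambda>w. if w = a then deriv f a else (f w - f a) / (w - a))"
  have g: "g holomorphic_on disc" unfolding g_def by (intro pole_lemma_open insert.prems open_ball)
  define G where "G = (\<lambda>w. (- 1 / u) * (1 - cnj a * w) * g w)"
  have G: "G holomorphic_on disc" unfolding G_def by (intro holomorphic_intros g) (use u in auto)
  have eq: "f w = G w * bfactor a w" if "norm w < 1" for w
  proof -
    have nz: "1 - cnj a * w \<noteq> 0" using one_minus_cnj_pos(3)[OF a(1), of w] that by simp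
    have "G w * bfactor a w = ((- 1 / u) * u) * ((1 - cnj a * w) / (1 - cnj a * w)) * (g w * (a - w))"
      unfolding G_def bfactor_def u_def[symmetric] by (simp add: field_simps)
    also have "\<dots> = g w * (w - a)" using u nz by (simp add: algebra_simps)
    also have "\<dots> = f w" using a(2) by (simp add: g_def)
    finally show ?thesis by simp
  qed
  have "\<forall>k\<in>T. norm (z k) < 1 \<and> G (z k) = 0"
  proof
    fix k assume k: "k \<in> T"
    have zk: "norm (z k) < 1" "f (z k) = 0" "z k \<noteq> a"
      using insert k by (auto simp: a_def inj_on_def)
    have "bfactor a (z k) \<noteq> 0"
      using zk one_minus_cnj_pos(3)[OF a(1), of "z k"] by (auto simp: norm_bfactor simp flip: norm_eq_zero[of "bfactor a (z k)"])
    then show "norm (z k) < 1 \<and> G (z k) = 0" using zk eq[of "z k"] by simp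
  qed
  then obtain G' where G': "G' holomorphic_on disc" "\<forall>w\<in>disc. G w = G' w * bprod z T w"
    using insert.IH[OF G] insert.prems by auto
  have "\<forall>w\<in>disc. f w = G' w * bprod z (insert l T) w"
  proof
    fix w assume "w \<in> disc"
    then show "f w = G' w * bprod z (insert l T) w"
      using eq[of w] G'(2) insert.hyps by (simp add: bprod_def a_def)
  qed
  with G'(1) show ?case by blast
qed

text \<open>A Schwarz lemma: \<open>f / q\<close> lies in the unit ball and keeps that bound after
  its zeros are divided out. Read backwards, it bounds \<open>bprod z T w\<close> from below
  wherever \<open>f\<close> is comparable to \<open>q\<close>, which is how bumps yield a
  Carleson-type condition.\<close>

lemma vanishing_bound:
  assumes T: "finite T" "\<forall>l\<in>T. norm (z l) < 1 \<and> f (z l) = 0" "inj_on z T"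
    and f: "f holomorphic_on disc" and q: "q holomorphic_on disc" "\<And>w. norm w < 1 \<Longrightarrow> q w \<noteq> 0"
    and b: "\<And>w. norm w < 1 \<Longrightarrow> norm (f w) \<le> norm (q w)" and w: "norm w < 1"
  shows "norm (f w) \<le> norm (q w) * norm (bprod z T w)"
proof -
  obtain G where G: "G holomorphic_on disc" "\<forall>w\<in>disc. f w = G w * bprod z T w"
    using zero_division[OF T(1) f T(2,3)] by blast
  have "norm (G w / q w) \<le> 1"
  proof (rule inner_division_finite[of T z "\<lambda>w. G w / q w"])
    show "(\<lambda>w. G w / q w) holomorphic_on disc" using q by (intro holomorphic_intros G) auto
    show "norm (G w / q w * bprod z T w) \<le> 1" if "norm w < 1" for w
    proof -
      have "G w / q w * bprod z T w = f w / q w" using G(2) that by simp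
      then show ?thesis using b[OF that] q(2)[OF that] by (simp add: norm_divide)
    qed
  qed (use T w in auto)
  then have "norm (G w) \<le> norm (q w)" using q(2)[OF w] by (simp add: norm_divide)
  then show ?thesis using G(2) w by (simp add: norm_mult mult_right_mono)
qed

text \<open>Each squared factor is at most \<open>1 - x l \<le> exp (- x l)\<close>, so a lower
  bound for the product is an upper bound for the sum of the \<open>x l\<close>.\<close>

lemma bprod_lower_imp_sum:
  assumes T: "finite T" "\<forall>l\<in>T. norm (z l) < 1" and w: "norm w < 1" and \<delta>: "0 < \<delta>" "\<delta> \<le> norm (bprod z T w)"
  shows "(\<Sum>l\<in>T. (1 - norm (z l)) * (1 - norm w) / (norm (1 - cnj (z l) * w))\<^sup>2) \<le> 2 * ln (1 / \<delta>)"
proof -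
  define x where "x l = (1 - norm (z l)) * (1 - norm w) / (norm (1 - cnj (z l) * w))\<^sup>2" for l
  have "\<delta>\<^sup>2 \<le> (norm (bprod z T w))\<^sup>2" using \<delta> by (intro power_mono) auto
  also have "\<dots> = (\<Prod>l\<in>T. (norm (bfactor (z l) w))\<^sup>2)"
    by (simp add: bprod_def prod_norm[symmetric] prod_power_distrib)
  also have "\<dots> \<le> (\<Prod>l\<in>T. exp (- x l))"
  proof (intro prod_mono conjI)
    fix l assume l: "l \<in> T"
    then have zl: "norm (z l) < 1" using T by auto
    have "(norm (bfactor (z l) w))\<^sup>2 = 1 - (1 - (norm (z l))\<^sup>2) * (1 - (norm w)\<^sup>2) / (norm (1 - cnj (z l) * w))\<^sup>2"
      by (rule norm_bfactor_square) (use one_minus_cnj_pos(3)[OF zl, of w] w in auto)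
    also have "\<dots> \<le> 1 - x l"
    proof -
      have "1 - t \<le> 1 - t\<^sup>2" if "0 \<le> t" "t < 1" for t :: real
        using that by (simp add: power2_eq_square mult_left_le)
      then have "(1 - norm (z l)) * (1 - norm w) \<le> (1 - (norm (z l))\<^sup>2) * (1 - (norm w)\<^sup>2)"
        using zl w by (intro mult_mono) (auto simp: power_le_one)
      then show ?thesis unfolding x_def by (simp add: divide_right_mono)
    qed
    also have "\<dots> \<le> exp (- x l)" using exp_ge_add_one_self[of "- x l"] by simp
    finally show "(norm (bfactor (z l) w))\<^sup>2 \<le> exp (- x l)" .
  qed auto
  also have "\<dots> = exp (- (\<Sum>l\<in>T. x l))" using T(1) by (simp add: exp_sum flip: sum_negf)
  finally have "ln (\<delta>\<^sup>2) \<le> - (\<Sum>l\<in>T. x l)" using \<delta> by (subst ln_exp[symmetric], subst ln_le_cancel_iff) auto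
  then show ?thesis using \<delta> by (simp add: x_def ln_div ln_realpow)
qed

text \<open>
  A Baire category argument on sets of naturals: \<open>K C A\<close> reads ``the object built from the index
  set \<open>A\<close> has norm at most \<open>C\<close>''.
\<close>

lemma gliding_hump:
  fixes K :: "nat \<Rightarrow> nat set \<Rightarrow> bool"
  assumes total: "\<And>A. \<exists>C. K C A" 
    and mono: "\<And>A C C'. K C A \<Longrightarrow> C \<le> C' \<Longrightarrow> K C' A"
    and diff: "\<And>A C m. K C A \<Longrightarrow> K C (insert m A) \<Longrightarrow> m \<notin> A \<Longrightarrow> K (2 * C) {m}"
    and closed: "\<And>A C. (\<And>i. \<exists>A'. A' \<inter> {..<i} = A \<inter> {..<i} \<and> K C A') \<Longrightarrow> K C A"
  shows "\<exists>C. \<forall>m. K C {m}"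
proof (rule ccontr)
  assume no: "\<not> ?thesis"
  \<comment> \<open>Every prefix extends to a longer one all of whose extensions cost more than
    \<open>C\<close>. Otherwise two index sets that differ in one element \<open>m\<close> beyond
    \<open>k\<close> would bound the cost of \<open>{m}\<close> uniformly.\<close>
  have step: "\<exists>A' k'. k < k' \<and> A' \<inter> {..<k} = A \<inter> {..<k} \<and> (\<forall>A''. A'' \<inter> {..<k'} = A' \<inter> {..<k'} \<longrightarrow> \<not> K C A'')"
    for A k C
  proof -
    have "\<exists>A'. A' \<inter> {..<k} = A \<inter> {..<k} \<and> \<not> K C A'"
    proof (rule ccontr)
      assume "\<not> ?thesis"
      then have all: "K C A'" if "A' \<inter> {..<k} = A \<inter> {..<k}" for A' using that by metis
      have "\<forall>m. \<exists>c. K c {m}" by (intro allI total)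
      then obtain c where c: "\<And>m. K (c m) {m}" by metis
      \<comment> \<open>The sum accounts for the singletons below \<open>k\<close>, so an expensive
        \<open>{m}\<close> has \<open>k \<le> m\<close> and can be added without changing the
        prefix.\<close>
      define C' where "C' = C + (\<Sum>m<k. c m)"
      obtain m where m: "\<not> K (2 * C') {m}" using no by blast
      have "k \<le> m"
      proof (rule ccontr)
        assume "\<not> k \<le> m"
        then have "c m \<le> (\<Sum>m<k. c m)" by (intro member_le_sum) auto
        then have "K (2 * C') {m}" using mono[OF c[of m], of "2 * C'"] by (simp add: C'_def)
        with m show False by blast
      qed
      have "K C (A \<inter> {..<k})" "K C (insert m (A \<inter> {..<k}))"
        using \<open>k \<le> m\<close> by (auto intro!: all)
      then have "K C' (A \<inter> {..<k})" "K C' (insert m (A \<inter> {..<k}))"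
        using mono by (simp_all add: C'_def)
      then have "K (2 * C') {m}" by (rule diff) (use \<open>k \<le> m\<close> in auto)
      with m show False by blast
    qed
    then obtain A' where A': "A' \<inter> {..<k} = A \<inter> {..<k}" "\<not> K C A'" by metis
    then obtain i where i: "\<And>A''. A'' \<inter> {..<i} = A' \<inter> {..<i} \<Longrightarrow> \<not> K C A''"
      using closed[of A' C] by metis
    have "\<not> K C A''" if "A'' \<inter> {..<max (Suc k) i} = A' \<inter> {..<max (Suc k) i}" for A''
    proof (rule i)
      have "{..<i} = {..<max (Suc k) i} \<inter> {..<i}" by auto
      then show "A'' \<inter> {..<i} = A' \<inter> {..<i}" using that by (metis inf_assoc)
    qed
    then show ?thesis using A'(1) by (intro exI[of _ A'] exI[of _ "max (Suc k) i"]) auto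
  qed
  define P :: "nat \<Rightarrow> nat set \<times> nat \<Rightarrow> bool" where
    "P n x \<longleftrightarrow> (\<forall>A''. A'' \<inter> {..<snd x} = fst x \<inter> {..<snd x} \<longrightarrow> \<not> K n A'')" for n x
  define Q :: "nat set \<times> nat \<Rightarrow> nat set \<times> nat \<Rightarrow> bool" where
    "Q x y \<longleftrightarrow> snd x < snd y \<and> fst y \<inter> {..<snd x} = fst x \<inter> {..<snd x}" for x y
  have next_exists: "\<exists>y. P n y \<and> Q x y" for n x
  proof -
    obtain A' k' where *: "snd x < k'" "A' \<inter> {..<snd x} = fst x \<inter> {..<snd x}"
      "\<forall>A''. A'' \<inter> {..<k'} = A' \<inter> {..<k'} \<longrightarrow> \<not> K n A''"
      using step[of "snd x" "fst x" n] by (elim exE conjE)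
    show ?thesis
      unfolding P_def Q_def by (intro exI[of _ "(A', k')"] conjI; unfold fst_conv snd_conv; fact)
  qed
  have "\<exists>s. \<forall>n. P n (s n) \<and> Q (s n) (s (Suc n))"
  proof (rule dependent_nat_choice)
    show "\<exists>x. P 0 x" using next_exists[of 0 "({}, 0)"] by (elim exE conjE) (rule exI)
  qed (rule next_exists)
  then obtain s where "\<forall>n. P n (s n) \<and> Q (s n) (s (Suc n))" ..
  then have sP: "P n (s n)" and sQ: "Q (s n) (s (Suc n))" for n by auto
  note s = sP[unfolded P_def, rule_format] sQ[unfolded Q_def, THEN conjunct1] sQ[unfolded Q_def, THEN conjunct2]
  define A where "A n = fst (s n)" for n
  define k where "k n = snd (s n)" for n
  have k: "strict_mono k" using s(2) by (simp add: strict_mono_Suc_iff k_def)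
  have agree: "A j \<inter> {..<k i} = A i \<inter> {..<k i}" if "i \<le> j" for i j
    using that
  proof (induction j rule: dec_induct)
    case (step n)
    have "k i \<le> k n" using strict_mono_less_eq[OF k, of i n] step.hyps(1) by simp
    then have eq: "{..<k n} \<inter> {..<k i} = {..<k i}" by auto
    have "A (Suc n) \<inter> {..<k n} \<inter> {..<k i} = A n \<inter> {..<k n} \<inter> {..<k i}"
      using s(3)[of n] by (simp only: A_def k_def)
    then show ?case unfolding inf_assoc eq using step.IH by simp
  qed simp
  \<comment> \<open>Element \<open>m\<close> is settled in \<open>A (Suc m)\<close>, because
    \<open>m < k (Suc m)\<close> and later sets agree with it below that level.\<close>
  define B where "B = {m. m \<in> A (Suc m)}"
  have "B \<inter> {..<k n} = A n \<inter> {..<k n}" for n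
  proof -
    have "m \<in> A (Suc m) \<longleftrightarrow> m \<in> A n" if m: "m < k n" for m
    proof (cases "n \<le> Suc m")
      case True
      then show ?thesis using agree[of n "Suc m"] m by blast
    next
      case False
      have "m < k (Suc m)" using strict_mono_imp_increasing[OF k, of "Suc m"] by simp
      then show ?thesis using agree[of "Suc m" n] False by auto
    qed
    then show ?thesis by (auto simp: B_def)
  qed
  then have "\<not> K n B" for n using s(1)[of B n] by (simp add: A_def k_def)
  then show False using total by blast
qed

section \<open>Uniform interpolation constants\<close>

definition subset_sum :: "(nat \<Rightarrow> complex) \<Rightarrow> nat set \<Rightarrow> complex" where
  "subset_sum x A = (\<Sum>j. if j \<in> A then x j else 0)"

lemma summable_dyadic: "summable (\<lambda>j. M / 2 ^ j :: real)" "(\<Sum>j. M / 2 ^ j) = 2 * M"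
  using summable_mult[OF summable_geometric[of "1/2::real"], of M]
    suminf_mult[OF summable_geometric[of "1/2::real"], of M] suminf_geometric[of "1/2::real"]
  by (auto simp: power_divide)

lemma subset_sum_summable:
  fixes x :: "nat \<Rightarrow> complex"
  assumes "\<And>j. norm (x j) \<le> M / 2 ^ j"
  shows "summable (\<lambda>j. if j \<in> A then x j else 0)"
proof (rule summable_comparison_test')
  show "summable (\<lambda>j. M / 2 ^ j)" by (rule summable_dyadic)
  show "norm (if j \<in> A then x j else 0) \<le> M / 2 ^ j" for j
    using assms[of j] order_trans[OF norm_ge_zero assms[of j]] by auto
qed

lemma norm_subset_sum:
  assumes "\<And>j. norm (x j) \<le> M / 2 ^ j"
  shows "norm (subset_sum x A) \<le> 2 * M"
proof -
  have "norm (if j \<in> A then x j else 0) \<le> M / 2 ^ j" for j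
    using assms[of j] order_trans[OF norm_ge_zero assms[of j]] by auto
  then have "norm (subset_sum x A) \<le> (\<Sum>j. M / 2 ^ j)"
    unfolding subset_sum_def by (rule norm_suminf_le[OF _ summable_dyadic(1)])
  then show ?thesis by (simp add: summable_dyadic)
qed

lemma subset_sum_agree:
  assumes x: "\<And>j. norm (x j) \<le> M / 2 ^ j" and A: "A' \<inter> {..<i} = A \<inter> {..<i}"
  shows "norm (subset_sum x A' - subset_sum x A) \<le> 4 * M / 2 ^ i"
proof -
  define d where "d j = (if j \<in> A' then x j else 0) - (if j \<in> A then x j else 0)" for j
  have d: "summable d" "subset_sum x A' - subset_sum x A = suminf d"
    unfolding d_def subset_sum_def
    by (rule summable_diff suminf_diff; rule subset_sum_summable[OF x])+
  have d0: "d j = 0" if "j < i" for j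
  proof -
    have "j \<in> A' \<longleftrightarrow> j \<in> A" using A that by blast
    then show ?thesis by (simp add: d_def)
  qed
  have "suminf d = (\<Sum>j. d (j + i))"
    using suminf_split_initial_segment[OF d(1), of i] d0 by simp
  also have "norm \<dots> \<le> (\<Sum>j. (2 * M / 2 ^ i) / 2 ^ j)"
  proof (rule norm_suminf_le[OF _ summable_dyadic(1)])
    fix j
    have "0 \<le> M / 2 ^ (j + i)" using order_trans[OF norm_ge_zero x[of "j + i"]] .
    then have "norm (d (j + i)) \<le> M / 2 ^ (j + i) + M / 2 ^ (j + i)"
      unfolding d_def using x[of "j + i"] by auto
    then show "norm (d (j + i)) \<le> (2 * M / 2 ^ i) / 2 ^ j" by (simp add: power_add mult.commute)
  qed
  also have "\<dots> = 4 * M / 2 ^ i" unfolding summable_dyadic(2) by simp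
  finally show ?thesis unfolding d(2) .
qed

lemma subset_sum_insert:
  assumes x: "\<And>j. norm (x j) \<le> M / 2 ^ j" and m: "m \<notin> A"
  shows "subset_sum x (insert m A) - subset_sum x A = x m"
proof -
  have "subset_sum x (insert m A) - subset_sum x A
     = (\<Sum>j. (if j \<in> insert m A then x j else 0) - (if j \<in> A then x j else 0))"
    unfolding subset_sum_def by (rule suminf_diff; rule subset_sum_summable[OF x])
  also have "\<dots> = (\<Sum>j. if j = m then x j else 0)"
    using m by (intro suminf_cong) auto
  also have "\<dots> = x m"
    using suminf_finite[of "{m}" "\<lambda>j. if j = m then x j else 0"] by simp
  finally show ?thesis .
qed

lemma subset_sum_empty: "subset_sum x {} = 0"
  by (simp add: subset_sum_def)

lemma subset_sum_single:
  assumes x: "\<And>j. norm (x j) \<le> M / 2 ^ j"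
  shows "subset_sum x {m} = x m"
  using subset_sum_insert[OF x, of m "{}"] by (simp add: subset_sum_empty)

text \<open>Plays the part of an open mapping theorem. Sums of \<open>\<phi> i / 2 ^ i\<close> over
  arbitrary index sets are again Lipschitz, hence interpolable, and the gliding hump is applied to
  the cost of these sums.\<close>

lemma uniform_interpolation:
  fixes z :: "nat \<Rightarrow> complex"
  assumes z: "\<And>j. norm (z j) < 1" and E: "Hinf1_interpolating_set (closure (range z))"
  shows "\<exists>C\<ge>1. \<forall>\<phi>. 1-lipschitz_on UNIV \<phi> \<longrightarrow> (\<forall>x. norm (\<phi> x) \<le> 2) \<longrightarrow>
      (\<exists>\<psi>. deriv_bounded 0 C \<psi> \<and> deriv_bounded 1 C \<psi> \<and> (\<forall>l. \<psi> (z l) = \<phi> (z l)))"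
proof (rule ccontr)
  define ip where "ip C \<phi> \<longleftrightarrow> (\<exists>\<psi>. deriv_bounded 0 C \<psi> \<and> deriv_bounded 1 C \<psi> \<and> (\<forall>l. \<psi> (z l) = \<phi> (z l)))"
    for C and \<phi> :: "complex \<Rightarrow> complex"
  assume "\<not> ?thesis"
  \<comment> \<open>Data of constant at least \<open>4 ^ i\<close>, scaled by \<open>2 ^ i\<close>, still cost at least \<open>2 ^ i\<close>.\<close>
  then have "\<forall>i::nat. \<exists>\<phi>. 1-lipschitz_on UNIV \<phi> \<and> (\<forall>x. norm (\<phi> x) \<le> 2) \<and> \<not> ip (4 ^ i) \<phi>"
    unfolding ip_def by (metis one_le_numeral one_le_power)
  then obtain \<phi> where \<phi>: "\<forall>i. 1-lipschitz_on UNIV (\<phi> i) \<and> (\<forall>x. norm (\<phi> i x) \<le> 2) \<and> \<not> ip (4 ^ i) (\<phi> i)"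
    by (rule choice[THEN exE])
  define X where "X i x = \<phi> i x / 2 ^ i" for i :: nat and x
  have X: "norm (X i x) \<le> 2 / 2 ^ i" for i x
    using \<phi> by (simp add: X_def norm_divide norm_power divide_right_mono)
  define F where "F A x = subset_sum (\<lambda>i. X i x) A" for A x
  have "\<exists>C::nat. \<forall>m. ip (real C) (F {m})"
  proof (rule gliding_hump)
    fix A
    have lip: "2-lipschitz_on (closure (range z)) (F A)"
    proof (rule lipschitz_onI)
      fix x y :: complex
      have "F A x - F A y = (\<Sum>j. (if j \<in> A then X j x else 0) - (if j \<in> A then X j y else 0))"
        unfolding F_def subset_sum_def by (rule suminf_diff; rule subset_sum_summable[OF X])
      also have "norm \<dots> \<le> (\<Sum>j. dist x y / 2 ^ j)"
      proof (rule norm_suminf_le[OF _ summable_dyadic(1)])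
        fix j
        have "dist (\<phi> j x) (\<phi> j y) \<le> 1 * dist x y"
          by (rule lipschitz_onD[of 1 UNIV]) (use \<phi> in auto)
        then have "norm (X j x - X j y) \<le> dist x y / 2 ^ j"
          by (simp add: X_def dist_norm norm_divide norm_power divide_right_mono flip: diff_divide_distrib)
        then show "norm ((if j \<in> A then X j x else 0) - (if j \<in> A then X j y else 0)) \<le> dist x y / 2 ^ j"
          by auto
      qed
      finally show "dist (F A x) (F A y) \<le> 2 * dist x y" by (simp add: dist_norm summable_dyadic)
    qed simp
    then obtain f where f: "f \<in> HinfN 1" "\<forall>x\<in>closure (range z). f x = F A x"
      using E unfolding Hinf1_interpolating_set_def by blast
    obtain K where K: "deriv_bounded 0 K f" "deriv_bounded 1 K f" using f(1) HinfN_iff by blast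
    have "f (z l) = F A (z l)" for l using f(2) closure_subset[of "range z"] by blast
    moreover have "deriv_bounded 0 (real (nat \<lceil>K\<rceil>)) f" "deriv_bounded 1 (real (nat \<lceil>K\<rceil>)) f"
      using K by (auto elim!: deriv_bounded_mono simp: real_nat_ceiling_ge)
    ultimately show "\<exists>C::nat. ip (real C) (F A)" unfolding ip_def by blast
  next
    show "ip (real C') (F A)" if "ip (real C) (F A)" "C \<le> C'" for A and C C' :: nat
      using that deriv_bounded_mono[of _ "real C" _ "real C'"] unfolding ip_def by (metis of_nat_le_iff)
  next
    fix A and C m :: nat
    assume 1: "ip (real C) (F A)" and 2: "ip (real C) (F (insert m A))" and m: "m \<notin> A"
    obtain f where f: "deriv_bounded 0 C f" "deriv_bounded 1 C f" "\<forall>l. f (z l) = F A (z l)"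
      using 1 unfolding ip_def by blast
    obtain g where g: "deriv_bounded 0 C g" "deriv_bounded 1 C g" "\<forall>l. g (z l) = F (insert m A) (z l)"
      using 2 unfolding ip_def by blast
    have "g (z l) - f (z l) = F {m} (z l)" for l
      using f(3) g(3) subset_sum_insert[OF X m] subset_sum_single[OF X] by (simp add: F_def)
    moreover have "deriv_bounded 0 (real (2 * C)) (\<lambda>w. g w - f w)" "deriv_bounded 1 (real (2 * C)) (\<lambda>w. g w - f w)"
      using deriv_bounded_diff[OF g(1) f(1)] deriv_bounded_diff[OF g(2) f(2)] by simp_all
    ultimately show "ip (real (2 * C)) (F {m})" unfolding ip_def by (intro exI[of _ "\<lambda>w. g w - f w"]) simp
  next
    fix A and C :: nat
    assume "\<And>i. \<exists>A'. A' \<inter> {..<i} = A \<inter> {..<i} \<and> ip (real C) (F A')"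
    then have "\<forall>i. \<exists>A'. A' \<inter> {..<i} = A \<inter> {..<i} \<and> ip (real C) (F A')" by simp
    then obtain A' where A': "\<forall>i. A' i \<inter> {..<i} = A \<inter> {..<i} \<and> ip (real C) (F (A' i))"
      by (rule choice[THEN exE])
    then have "\<forall>i. \<exists>\<psi>. deriv_bounded 0 C \<psi> \<and> deriv_bounded 1 C \<psi> \<and> (\<forall>l. \<psi> (z l) = F (A' i) (z l))"
      unfolding ip_def by simp
    then obtain \<psi> where \<psi>: "\<forall>i. deriv_bounded 0 C (\<psi> i) \<and> deriv_bounded 1 C (\<psi> i) \<and> (\<forall>l. \<psi> i (z l) = F (A' i) (z l))"
      by (rule choice[THEN exE])
    have h: "\<psi> i holomorphic_on disc" for i using \<psi> deriv_bounded_holo by blast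
    have b: "norm (\<psi> i w) \<le> C" if "norm w < 1" for i w
      using \<psi> deriv_boundedD[of 0 C "\<psi> i" w] that by simp
    \<comment> \<open>Closedness of the cost: interpolating functions with a common bound have a
      convergent subsequence, whose values at the zeros are the limits of
      \<open>F (A' i)\<close>.\<close>
    obtain g r where g: "g holomorphic_on disc" "strict_mono (r :: nat \<Rightarrow> nat)"
      "\<And>w. norm w < 1 \<Longrightarrow> (\<lambda>i. \<psi> (r i) w) \<longlonglongrightarrow> g w"
      "\<And>N w. norm w < 1 \<Longrightarrow> (\<lambda>i. (deriv ^^ N) (\<psi> (r i)) w) \<longlonglongrightarrow> (deriv ^^ N) g w"
      using bounded_deriv_limit[OF h b, of "\<lambda>i. i"] by metis
    have "deriv_bounded N C g" if "\<forall>i. deriv_bounded N C (\<psi> i)" for N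
      unfolding deriv_bounded_def
    proof (intro conjI ballI g(1))
      fix w :: complex assume "w \<in> disc"
      then show "norm ((deriv ^^ N) g w) \<le> C"
        using that by (intro Lim_norm_ubound[OF sequentially_bot g(4)] always_eventually allI deriv_boundedD) auto
    qed
    moreover have "g (z l) = F A (z l)" for l
    proof (rule LIMSEQ_unique[OF g(3)[OF z]])
      have "(\<lambda>i. F (A' i) (z l)) \<longlonglongrightarrow> F A (z l)"
      proof (rule LIM_zero_cancel, rule Lim_null_comparison)
        show "\<forall>\<^sub>F i in sequentially. norm (F (A' i) (z l) - F A (z l)) \<le> 8 / 2 ^ i"
          using subset_sum_agree[OF X] A' unfolding F_def by (intro always_eventually allI) fastforce
        show "(\<lambda>i. 8 / 2 ^ i :: real) \<longlonglongrightarrow> 0"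
          by (rule summable_LIMSEQ_zero[OF summable_dyadic(1)])
      qed
      from LIMSEQ_subseq_LIMSEQ[OF this g(2)] show "(\<lambda>i. \<psi> (r i) (z l)) \<longlonglongrightarrow> F A (z l)"
        using \<psi> by (simp add: o_def)
    qed
    ultimately show "ip (real C) (F A)" unfolding ip_def using \<psi> by (intro exI[of _ g]) simp
  qed
  then obtain C :: nat where C: "\<And>m. ip (real C) (F {m})" by blast
  obtain m where m: "real C < 2 ^ m" using real_arch_pow[of 2 "real C"] by auto
  obtain \<psi> where \<psi>: "deriv_bounded 0 C \<psi>" "deriv_bounded 1 C \<psi>" "\<forall>l. \<psi> (z l) = F {m} (z l)"
    using C[of m] unfolding ip_def by blast
  have "(2 ^ m) * real C \<le> 2 ^ m * 2 ^ m" using m by simp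
  also have "\<dots> = 4 ^ m" by (simp flip: power_mult_distrib)
  finally have le: "norm ((2::complex) ^ m) * real C \<le> 4 ^ m" by (simp add: norm_power)
  have "2 ^ m * \<psi> (z l) = \<phi> m (z l)" for l
    using \<psi>(3) subset_sum_single[OF X] by (simp add: F_def X_def)
  moreover have "deriv_bounded 0 (4 ^ m) (\<lambda>w. 2 ^ m * \<psi> w)" "deriv_bounded 1 (4 ^ m) (\<lambda>w. 2 ^ m * \<psi> w)"
    using deriv_bounded_mono[OF deriv_bounded_cmult[OF \<psi>(1)] le] deriv_bounded_mono[OF deriv_bounded_cmult[OF \<psi>(2)] le] by simp_all
  ultimately have "ip (4 ^ m) (\<phi> m)" unfolding ip_def by (intro exI[of _ "\<lambda>w. 2 ^ m * \<psi> w"]) simp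
  with \<phi> show False by simp
qed

lemma bump_interpolation:
  fixes z :: "nat \<Rightarrow> complex"
  assumes z: "\<And>j. norm (z j) < 1" and E: "Hinf1_interpolating_set (closure (range z))"
  shows "\<exists>C\<ge>1. \<forall>j R. 0 \<le> R \<longrightarrow> R \<le> 2 \<longrightarrow> 
      (\<exists>\<psi>. deriv_bounded 0 C \<psi> \<and> deriv_bounded 1 C \<psi> \<and> \<psi> (z j) = of_real R \<and>
         (\<forall>l. R \<le> norm (z l - z j) \<longrightarrow> \<psi> (z l) = 0))"
proof -
  obtain C where C: "C \<ge> 1" "\<And>\<phi>. 1-lipschitz_on UNIV \<phi> \<Longrightarrow> (\<And>x. norm (\<phi> x) \<le> 2) \<Longrightarrow>
      (\<exists>\<psi>. deriv_bounded 0 C \<psi> \<and> deriv_bounded 1 C \<psi> \<and> (\<forall>l. \<psi> (z l) = \<phi> (z l)))"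
    using uniform_interpolation[OF z E] by metis
  have "\<exists>\<psi>. deriv_bounded 0 C \<psi> \<and> deriv_bounded 1 C \<psi> \<and> \<psi> (z j) = of_real R \<and>
         (\<forall>l. R \<le> norm (z l - z j) \<longrightarrow> \<psi> (z l) = 0)" if R: "0 \<le> R" "R \<le> 2" for j R
  proof -
    \<comment> \<open>A cone of height \<open>R\<close> over the disc of radius \<open>R\<close>
      about \<open>z j\<close>; its slope 1 makes the constant independent of
      \<open>R\<close>.\<close>
    define \<phi> where "\<phi> x = (of_real (max 0 (R - norm (x - z j))) :: complex)" for x
    have "1-lipschitz_on UNIV \<phi>"
    proof (rule lipschitz_onI)
      fix x y :: complex
      have "dist (\<phi> x) (\<phi> y) = \<bar>max 0 (R - norm (x - z j)) - max 0 (R - norm (y - z j))\<bar>"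
        unfolding \<phi>_def dist_norm by (metis norm_of_real of_real_diff)
      also have "\<dots> \<le> \<bar>norm (x - z j) - norm (y - z j)\<bar>" by (simp add: max_def abs_if)
      also have "\<dots> \<le> dist x y" using norm_triangle_ineq3[of "x - z j" "y - z j"] by (simp add: dist_norm)
      finally show "dist (\<phi> x) (\<phi> y) \<le> 1 * dist x y" by simp
    qed simp
    moreover have "norm (\<phi> x) \<le> 2" for x
      unfolding \<phi>_def norm_of_real using R norm_ge_zero[of "x - z j"] by linarith
    ultimately obtain \<psi> where \<psi>: "deriv_bounded 0 C \<psi>" "deriv_bounded 1 C \<psi>" "\<forall>l. \<psi> (z l) = \<phi> (z l)"
      using C(2)[of \<phi>] by blast
    then show ?thesis using R by (intro exI[of _ \<psi>]) (auto simp: \<phi>_def)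
  qed
  with C(1) show ?thesis by blast
qed

lemma deriv_bounded_lipschitz:
  assumes "deriv_bounded 1 C f" "norm w < 1" "norm w' < 1"
  shows "norm (f w - f w') \<le> C * norm (w - w')"
proof (rule field_differentiable_bound[where S = disc and f' = "deriv f"])
  fix w :: complex assume w: "w \<in> disc"
  show "(f has_field_derivative deriv f w) (at w within disc)"
    using holomorphic_derivI[OF deriv_bounded_holo[OF assms(1)] open_ball w] by simp
  show "norm (deriv f w) \<le> C"
    using deriv_boundedD[OF assms(1), of w] w by simp
qed (use assms in auto)

section \<open>The Carleson condition\<close>

text \<open>Height and radius of the bump are both \<open>R\<close>, the order of height that a
  fixed Lipschitz constant allows, so one \<open>C\<close> serves all scales up to the diameter 2 of
  the disc.\<close>

definition bump_const :: "(nat \<Rightarrow> complex) \<Rightarrow> real \<Rightarrow> bool" where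
  "bump_const z C \<longleftrightarrow> 1 \<le> C \<and> (\<forall>j R. 0 \<le> R \<longrightarrow> R \<le> 2 \<longrightarrow> 
      (\<exists>\<psi>. deriv_bounded 0 C \<psi> \<and> deriv_bounded 1 C \<psi> \<and> \<psi> (z j) = of_real R \<and>
         (\<forall>l. R \<le> norm (z l - z j) \<longrightarrow> \<psi> (z l) = 0)))"

lemma bump_growth:
  assumes "deriv_bounded 1 C \<psi>" "\<psi> a = of_real R" "norm a < 1" "norm w < 1" "0 \<le> R"
  shows "norm (\<psi> w) \<le> R + C * norm (w - a)" "R - C * norm (w - a) \<le> norm (\<psi> w)"
proof -
  have "norm (\<psi> w - \<psi> a) \<le> C * norm (w - a)"
    by (rule deriv_bounded_lipschitz) (use assms in auto)
  moreover have "norm (\<psi> a) = R" using assms by simp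
  ultimately show "norm (\<psi> w) \<le> R + C * norm (w - a)" "R - C * norm (w - a) \<le> norm (\<psi> w)"
    using norm_triangle_ineq2[of "\<psi> w" "\<psi> a"] norm_triangle_ineq2[of "\<psi> a" "\<psi> w"] norm_minus_commute[of "\<psi> w" "\<psi> a"]
    by linarith+
qed

text \<open>The real part of \<open>1 - cnj a * w\<close> is positive, so adding \<open>R\<close>
  only enlarges the modulus. The sum is the zero-free comparison function for a bump of size
  \<open>R > 0\<close>; when \<open>1 - norm a \<le> R\<close> it is comparable to
  \<open>R + norm (w - a)\<close>.\<close>

lemma shifted_cnj_lower:
  assumes "norm a < 1" "norm w \<le> 1" "0 \<le> R"
  shows "R \<le> norm (1 - cnj a * w + of_real R)" "norm (w - a) \<le> norm (1 - cnj a * w + of_real R)"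
    "norm (1 - cnj a * w) \<le> norm (1 - cnj a * w + of_real R)"
proof -
  have re: "0 < Re (1 - cnj a * w)" by (rule one_minus_cnj_pos) fact+
  have "R \<le> Re (1 - cnj a * w + of_real R)" using re by simp
  also have "\<dots> \<le> norm (1 - cnj a * w + of_real R)" by (rule complex_Re_le_cmod)
  finally show "R \<le> norm (1 - cnj a * w + of_real R)" .
  show *: "norm (1 - cnj a * w) \<le> norm (1 - cnj a * w + of_real R)"
  proof (rule power2_le_imp_le)
    define x where "x = Re (1 - cnj a * w)"
    have "x\<^sup>2 \<le> (x + R)\<^sup>2" using re assms(3) by (intro power_mono) (auto simp: x_def)
    then show "(norm (1 - cnj a * w))\<^sup>2 \<le> (norm (1 - cnj a * w + of_real R))\<^sup>2"
      unfolding cmod_power2 x_def by simp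
  qed simp
  show "norm (w - a) \<le> norm (1 - cnj a * w + of_real R)"
    using dist_le_cnj[of a w] assms * by (simp add: norm_minus_commute)
qed

text \<open>A bump of height \<open>R\<close> at \<open>z j\<close> vanishes at the zeros in
  \<open>T\<close> and is dominated by \<open>q\<close>. Near \<open>z j\<close> it is at least
  \<open>R / 2\<close> while \<open>q\<close> is at most \<open>8 * C * R\<close>;
  \<open>vanishing_bound\<close> turns the quotient into the lower bound.\<close>

lemma bprod_far_lower:
  assumes C: "bump_const z C" and z: "\<And>l. norm (z l) < 1" and inj: "inj z"
    and R: "1 - norm (z j) \<le> R" "R \<le> 2" and T: "finite T" "\<And>l. l \<in> T \<Longrightarrow> R \<le> norm (z l - z j)"
    and w: "norm w < 1" "norm (w - z j) \<le> R / (2 * C)"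
  shows "1 / (16 * C) \<le> norm (bprod z T w)"
proof -
  have R0: "0 < R" using R z[of j] by linarith
  have C1: "1 \<le> C" using C by (simp add: bump_const_def)
  obtain \<psi> where \<psi>: "deriv_bounded 0 C \<psi>" "deriv_bounded 1 C \<psi>" "\<psi> (z j) = of_real R"
     "\<And>l. R \<le> norm (z l - z j) \<Longrightarrow> \<psi> (z l) = 0"
    using C R(2) R0 unfolding bump_const_def by (metis less_imp_le)
  define q where "q = (\<lambda>w. of_real (2 * C) * (1 - cnj (z j) * w + of_real R))"
  have nq: "norm (q w) = 2 * C * norm (1 - cnj (z j) * w + of_real R)" for w
    unfolding q_def norm_mult norm_of_real using C1 by simp
  have bound: "norm (\<psi> w) \<le> norm (q w) * norm (bprod z T w)"
  proof (rule vanishing_bound[OF T(1)])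
    show "\<forall>l\<in>T. norm (z l) < 1 \<and> \<psi> (z l) = 0" using z T(2) \<psi>(4) by simp
    show "inj_on z T" using inj by (rule inj_on_subset) simp
    show "\<psi> holomorphic_on disc" by (rule deriv_bounded_holo[OF \<psi>(1)])
    show "q holomorphic_on disc" unfolding q_def by (intro holomorphic_intros)
    show "q w \<noteq> 0" if "norm w < 1" for w
      using shifted_cnj_lower(1)[OF z, of w R j] that R0 C1 nq[of w] by (auto simp flip: zero_less_norm_iff)
    show "norm (\<psi> w) \<le> norm (q w)" if w: "norm w < 1" for w
    proof -
      have "norm (\<psi> w) \<le> R + C * norm (w - z j)"
        by (rule bump_growth(1)) (use \<psi> z w R0 in auto)
      also have "\<dots> \<le> C * norm (1 - cnj (z j) * w + of_real R) + C * norm (1 - cnj (z j) * w + of_real R)"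
      proof (rule add_mono)
        have "R \<le> 1 * norm (1 - cnj (z j) * w + of_real R)" using shifted_cnj_lower(1)[OF z, of w R j] w R0 by simp
        also have "\<dots> \<le> C * norm (1 - cnj (z j) * w + of_real R)" using C1 by (intro mult_right_mono) auto
        finally show "R \<le> C * norm (1 - cnj (z j) * w + of_real R)" .
        show "C * norm (w - z j) \<le> C * norm (1 - cnj (z j) * w + of_real R)"
          using shifted_cnj_lower(2)[OF z, of w R j] w R0 C1 by (intro mult_left_mono) auto
      qed
      finally show ?thesis unfolding nq by simp
    qed
  qed fact
  have "C * norm (w - z j) \<le> R / 2"
    using w(2) C1 by (simp add: field_simps)
  then have low: "R / 2 \<le> norm (\<psi> w)"
    using bump_growth(2)[OF \<psi>(2,3) z w(1)] R0 by linarith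
  have "R / (2 * C) \<le> R / 2" using C1 R0 by (simp add: field_simps)
  then have "norm (1 - cnj (z j) * w) \<le> 2 * R + R / 2"
    using cnj_le_dist[OF less_imp_le[OF z], of j w] w(2) R by argo
  then have "norm (1 - cnj (z j) * w + of_real R) \<le> 4 * R"
    using norm_triangle_ineq[of "1 - cnj (z j) * w" "of_real R"] R0 by simp
  then have "norm (q w) \<le> 8 * C * R" unfolding nq using C1 by simp
  then have "norm (q w) * norm (bprod z T w) \<le> 8 * C * R * norm (bprod z T w)"
    by (rule mult_right_mono) simp
  then have "R * 1 \<le> R * (16 * C * norm (bprod z T w))"
    using low bound by (simp add: algebra_simps)
  then have "1 \<le> 16 * C * norm (bprod z T w)" using R0 by (simp only: mult_le_cancel_left_pos)
  then show ?thesis using C1 by (simp add: field_simps)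
qed

lemma retracted_point:
  fixes a :: complex
  assumes "norm a < 1" "0 \<le> t" "t \<le> 1"
  shows "norm ((1 - of_real t) * a - a) \<le> t" "t \<le> 1 - norm ((1 - of_real t) * a)"
    "1 - norm a \<le> 1 - norm ((1 - of_real t) * a)"
proof -
  have "(1 - of_real t) * a - a = - (of_real t * a)" by (simp add: algebra_simps)
  then have "norm ((1 - of_real t) * a - a) = t * norm a"
    using assms by (simp add: norm_mult)
  then show "norm ((1 - of_real t) * a - a) \<le> t" using assms by (simp add: mult_left_le)
  have "norm (1 - of_real t :: complex) = 1 - t"
    using assms norm_of_real[of "1 - t", where 'a = complex] by simp
  then have n: "norm ((1 - of_real t) * a) = (1 - t) * norm a" by (simp add: norm_mult)
  show "t \<le> 1 - norm ((1 - of_real t) * a)"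
    unfolding n using assms mult_left_le[of "norm a" "1 - t"] by simp
  show "1 - norm a \<le> 1 - norm ((1 - of_real t) * a)"
    unfolding n using assms by (simp add: mult_left_le_one_le)
qed

text \<open>The point \<open>w\<close> has depth at least \<open>R / (2 * C)\<close> and is still
  within reach of \<open>bprod_far_lower\<close>. The point \<open>z j\<close> itself would offer
  only the depth \<open>1 - norm (z j)\<close>, which may be far smaller than
  \<open>R\<close>.\<close>

lemma sum_at_retracted:
  assumes C: "bump_const z C" and z: "\<And>l. norm (z l) < 1" and inj: "inj z"
    and R: "1 - norm (z j) \<le> R" "R \<le> 2" and T: "finite T" "\<And>l. l \<in> T \<Longrightarrow> R \<le> norm (z l - z j)"
    and w: "w = (1 - of_real (R / (2 * C))) * z j"
  shows "(\<Sum>l\<in>T. (1 - norm (z l)) / (norm (1 - cnj (z l) * w))\<^sup>2) \<le> 4 * C * ln (16 * C) / R"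
proof -
  have C1: "1 \<le> C" using C by (simp add: bump_const_def)
  have R0: "0 < R" using R z[of j] by linarith
  have t: "0 \<le> R / (2 * C)" "R / (2 * C) \<le> 1" using C1 R0 R(2) by (auto simp: field_simps)
  note rp = retracted_point[OF z t, of j, folded w]
  have w1: "norm w < 1" using rp(3) z[of j] by linarith
  have "(\<Sum>l\<in>T. (1 - norm (z l)) * (R / (2 * C)) / (norm (1 - cnj (z l) * w))\<^sup>2)
     \<le> (\<Sum>l\<in>T. (1 - norm (z l)) * (1 - norm w) / (norm (1 - cnj (z l) * w))\<^sup>2)"
    using z rp(2) by (intro sum_mono divide_right_mono mult_left_mono) (auto intro: less_imp_le)
  also have "\<dots> \<le> 2 * ln (1 / (1 / (16 * C)))"
    by (rule bprod_lower_imp_sum[OF T(1) _ w1])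
      (use z C1 bprod_far_lower[OF C z inj R T w1 rp(1)] in auto)
  also have "(\<Sum>l\<in>T. (1 - norm (z l)) * t / (norm (1 - cnj (z l) * w))\<^sup>2)
      = (\<Sum>l\<in>T. (1 - norm (z l)) / (norm (1 - cnj (z l) * w))\<^sup>2) * t" for t
    by (simp add: sum_distrib_right)
  finally have "(\<Sum>l\<in>T. (1 - norm (z l)) / (norm (1 - cnj (z l) * w))\<^sup>2) * (R / (2 * C)) \<le> 2 * ln (16 * C)"
    by simp
  then show ?thesis using C1 R0 by (simp add: field_simps)
qed

lemma divide_square_le:
  fixes c k x y :: real
  assumes "0 \<le> c" "0 < x" "0 < y" "x\<^sup>2 \<le> k * y\<^sup>2"
  shows "c / y\<^sup>2 \<le> k * (c / x\<^sup>2)"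
proof -
  have "c / y\<^sup>2 = c * x\<^sup>2 / (x\<^sup>2 * y\<^sup>2)" using assms by simp
  also have "\<dots> \<le> c * (k * y\<^sup>2) / (x\<^sup>2 * y\<^sup>2)"
    using assms by (intro divide_right_mono mult_left_mono) auto
  also have "\<dots> = k * (c / x\<^sup>2)" using assms by simp
  finally show ?thesis .
qed

lemma far_sum:
  assumes C: "bump_const z C" and z: "\<And>l. norm (z l) < 1" and inj: "inj z"
    and R: "1 - norm (z j) \<le> R" "R \<le> 2" and T: "finite T" "\<And>l. l \<in> T \<Longrightarrow> R \<le> norm (z l - z j)"
  shows "(\<Sum>l\<in>T. (1 - norm (z l)) / (norm (z l - z j))\<^sup>2) \<le> 64 * C * ln (16 * C) / R"
proof -
  have C1: "1 \<le> C" using C by (simp add: bump_const_def)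
  have R0: "0 < R" using R z[of j] by linarith
  define w where "w = (1 - of_real (R / (2 * C))) * z j"
  have t: "0 \<le> R / (2 * C)" "R / (2 * C) \<le> 1" using C1 R0 R(2) by (auto simp: field_simps)
  note rp = retracted_point[OF z t, of j, folded w_def]
  have w1: "norm w < 1" using rp(3) z[of j] by linarith
  have "(1 - norm (z l)) / (norm (z l - z j))\<^sup>2 \<le> 16 * ((1 - norm (z l)) / (norm (1 - cnj (z l) * w))\<^sup>2)" if l: "l \<in> T" for l
  proof -
    have "1 - cnj (z l) * w = (1 - cnj (z l) * z j) - cnj (z l) * (w - z j)" by (simp add: algebra_simps)
    then have 1: "norm (1 - cnj (z l) * w) \<le> norm (1 - cnj (z l) * z j) + norm (cnj (z l) * (w - z j))"
      by (metis norm_triangle_ineq4)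
    have "R / (2 * C) \<le> R / 1" using C1 R0 by (intro divide_left_mono) auto
    then have "norm (w - z j) \<le> R" using rp(1) by simp
    moreover have "norm (cnj (z l) * (w - z j)) \<le> norm (w - z j)"
      using z[of l] by (simp add: norm_mult mult_left_le_one_le)
    ultimately have 2: "norm (cnj (z l) * (w - z j)) \<le> R" by linarith
    have "norm (1 - cnj (z l) * z j) = norm (1 - cnj (z j) * z l)"
      by (metis complex_cnj_cnj complex_cnj_diff complex_cnj_mult complex_cnj_one complex_mod_cnj mult.commute)
    then have 3: "norm (1 - cnj (z l) * z j) \<le> 2 * (1 - norm (z j)) + norm (z l - z j)"
      using cnj_le_dist[of "z j" "z l"] z[of j] by simp
    have "norm (1 - cnj (z l) * w) \<le> (2 * (1 - norm (z j)) + norm (z l - z j)) + R"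
      using order_trans[OF 1 add_mono[OF 3 2]] .
    then have "norm (1 - cnj (z l) * w) \<le> 4 * norm (z l - z j)"
      using R(1) T(2)[OF l] by argo
    then have "(norm (1 - cnj (z l) * w))\<^sup>2 \<le> 16 * (norm (z l - z j))\<^sup>2"
      using power_mono[of "norm (1 - cnj (z l) * w)" "4 * norm (z l - z j)" 2] by (simp add: power_mult_distrib)
    moreover have "0 < norm (1 - cnj (z l) * w)" using one_minus_cnj_pos(3)[OF z, of w l] w1 by simp
    moreover have "0 < norm (z l - z j)" using T(2)[OF l] R0 by linarith
    ultimately show ?thesis using z[of l] by (intro divide_square_le) auto
  qed
  then have "(\<Sum>l\<in>T. (1 - norm (z l)) / (norm (z l - z j))\<^sup>2) \<le> 16 * (\<Sum>l\<in>T. (1 - norm (z l)) / (norm (1 - cnj (z l) * w))\<^sup>2)"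
    unfolding sum_distrib_left by (rule sum_mono)
  also have "\<dots> \<le> 16 * (4 * C * ln (16 * C) / R)"
    by (intro mult_left_mono sum_at_retracted[OF C z inj R T w_def]) auto
  finally show ?thesis by simp
qed

text \<open>
  Zeros may lie much closer to \<open>z j\<close> than \<open>1 - norm (z j)\<close>, so that a bump vanishing at the other
  zeros is small at \<open>z j\<close>. The nearest zero \<open>z k\<close>, at distance \<open>s\<close>, is therefore split off, which
  gains the missing factor comparable to \<open>s\<close>.
\<close>

lemma near_mass:
  assumes C: "bump_const z C" and z: "\<And>l. norm (z l) < 1" and inj: "inj z"
    and T: "finite T" "\<And>l. l \<in> T \<Longrightarrow> norm (z l - z j) < 2 * (1 - norm (z j))"
  shows "(\<Sum>l\<in>T. 1 - norm (z l)) \<le> (32 * ln (6 * C) + 4) * (1 - norm (z j))"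
proof -
  define c where "c l = 1 - norm (z l)" for l
  have c: "0 < c l" for l using z[of l] by (simp add: c_def)
  have C1: "1 \<le> C" using C by (simp add: bump_const_def)
  have ln0: "0 \<le> ln (6 * C)" using C1 by (intro ln_ge_zero) auto
  have sj: "sum c T \<le> sum c (T - {j}) + c j"
  proof (cases "j \<in> T")
    case True
    then show ?thesis using T(1) by (simp add: sum.remove)
  next
    case False
    then have "T - {j} = T" by auto
    then show ?thesis using c[of j] by simp
  qed
  have main: "sum c (T - {j}) \<le> (32 * ln (6 * C) + 3) * c j"
  proof (cases "T - {j} = {}")
    case True
    then have "sum c (T - {j}) = 0" by (simp only: sum.empty)
    then show ?thesis using ln0 c[of j] by simp
  next
    case False
    define T' where "T' = T - {j}"
    have fT': "finite T'" "T' \<noteq> {}" using T(1) False by (auto simp: T'_def)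
    obtain k where k: "k \<in> T'" "\<And>l. l \<in> T' \<Longrightarrow> norm (z k - z j) \<le> norm (z l - z j)"
      using ex_min_if_finite[of "(\<lambda>l. norm (z l - z j)) ` T'"] fT' by (auto simp: not_less)
    define s where "s = norm (z k - z j)"
    have "z k \<noteq> z j" using inj k(1) by (auto simp: T'_def inj_def)
    then have s0: "0 < s" by (simp add: s_def)
    have "s < 2 * c j" using T(2)[of k] k(1) by (simp add: s_def T'_def c_def)
    moreover have "c j \<le> 1" by (simp add: c_def)
    ultimately have s2: "s \<le> 2 * c j" "s \<le> 2" by linarith+
    obtain \<psi> where \<psi>: "deriv_bounded 0 C \<psi>" "deriv_bounded 1 C \<psi>" "\<psi> (z j) = of_real s"
     "\<And>l. s \<le> norm (z l - z j) \<Longrightarrow> \<psi> (z l) = 0"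
      using C s0 s2(2) unfolding bump_const_def by (metis less_imp_le)
    \<comment> \<open>Since \<open>s \<le> 2 * c j\<close>, the growth bound
      \<open>s + C * norm (w - z j)\<close> of the bump is at most \<open>3 * C\<close> times
      \<open>norm (1 - cnj (z j) * w)\<close>.\<close>
    define q where "q = (\<lambda>w. of_real (3 * C) * (1 - cnj (z j) * w))"
    have nq: "norm (q w) = 3 * C * norm (1 - cnj (z j) * w)" for w
      unfolding q_def norm_mult norm_of_real using C1 by simp
    have "norm (\<psi> (z j)) \<le> norm (q (z j)) * norm (bprod z T' (z j))"
    proof (rule vanishing_bound[OF fT'(1)])
      show "\<forall>l\<in>T'. norm (z l) < 1 \<and> \<psi> (z l) = 0" using z k(2) \<psi>(4) by (simp add: s_def)
      show "inj_on z T'" using inj by (rule inj_on_subset) simp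
      show "\<psi> holomorphic_on disc" by (rule deriv_bounded_holo[OF \<psi>(1)])
      show "q holomorphic_on disc" unfolding q_def by (intro holomorphic_intros)
      show "q w \<noteq> 0" if "norm w < 1" for w
        unfolding q_def using one_minus_cnj_pos(3)[OF z, of w j] that C1 by simp
      show "norm (\<psi> w) \<le> norm (q w)" if w: "norm w < 1" for w
      proof -
        define y where "y = norm (1 - cnj (z j) * w)"
        have y: "c j \<le> y" "norm (w - z j) \<le> y"
          using one_minus_cnj_pos(2)[OF z, of w j] dist_le_cnj[of "z j" w] z[of j] w
          by (auto simp: y_def c_def norm_minus_commute)
        have "norm (\<psi> w) \<le> s + C * norm (w - z j)"
          by (rule bump_growth(1)) (use \<psi> z w s0 in auto)
        also have "\<dots> \<le> 2 * y + C * y" using s2 y C1 by (intro add_mono mult_left_mono) auto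
        also have "\<dots> \<le> 3 * C * y" using C1 y c[of j] by (simp add: algebra_simps)
        finally show ?thesis unfolding nq y_def .
      qed
    qed (rule z)
    then have 1: "s \<le> 3 * C * norm (1 - cnj (z j) * z j) * norm (bprod z T' (z j))"
      unfolding nq \<psi>(3) using s0 by simp
    have 2: "norm (1 - cnj (z j) * z j) \<le> 2 * c j"
      using cnj_le_dist[of "z j" "z j"] z[of j] by (simp add: c_def)
    have 3: "norm (bprod z T' (z j)) = norm (bfactor (z k) (z j)) * norm (bprod z (T' - {k}) (z j))"
      unfolding bprod_def using k(1) fT'(1) by (simp add: prod.remove norm_mult)
    have comm: "norm (1 - cnj (z l) * z j) = norm (1 - cnj (z j) * z l)" for l
      by (metis complex_cnj_cnj complex_cnj_diff complex_cnj_mult complex_cnj_one complex_mod_cnj mult.commute)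
    \<comment> \<open>The \<open>s\<close> of the split-off factor cancels against the height of the
      bump and leaves the lower bound \<open>1 / (6 * C)\<close> for the remaining product.\<close>
    have 4: "norm (bfactor (z k) (z j)) \<le> s / c j"
      unfolding norm_bfactor s_def[symmetric] comm
    proof (rule divide_left_mono)
      show "c j \<le> norm (1 - cnj (z j) * z k)"
        using one_minus_cnj_pos(2)[OF z, of "z k" j] z[of k] by (simp add: c_def)
      then show "0 < norm (1 - cnj (z j) * z k) * c j"
        using c[of j] by (intro mult_pos_pos) linarith+
    qed (use s0 in simp)
    define b where "b = norm (bprod z (T' - {k}) (z j))"
    have b0: "0 \<le> b" by (simp add: b_def)
    have "3 * C * norm (1 - cnj (z j) * z j) * (norm (bfactor (z k) (z j)) * b) \<le> 3 * C * (2 * c j) * ((s / c j) * b)"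
      using C1 c[of j] s0 b0 by (intro mult_mono[OF mult_left_mono[OF 2] mult_right_mono[OF 4]]) auto
    then have "s \<le> 3 * C * (2 * c j) * ((s / c j) * b)" using 1 3 b_def by simp
    then have "s * 1 \<le> s * (6 * C * b)" using c[of j] by (simp add: field_simps)
    then have "1 \<le> 6 * C * b" using s0 by (simp only: mult_le_cancel_left_pos)
    then have "1 / (6 * C) \<le> b" using C1 by (simp add: field_simps)
    then have "(\<Sum>l\<in>T' - {k}. (1 - norm (z l)) * (1 - norm (z j)) / (norm (1 - cnj (z l) * z j))\<^sup>2) \<le> 2 * ln (1 / (1 / (6 * C)))"
      unfolding b_def using C1 z fT'(1) by (intro bprod_lower_imp_sum) auto
    then have 5: "(\<Sum>l\<in>T' - {k}. c l * c j / (norm (1 - cnj (z l) * z j))\<^sup>2) \<le> 2 * ln (6 * C)"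
      by (simp add: c_def)
    have "c l / (16 * c j) \<le> c l * c j / (norm (1 - cnj (z l) * z j))\<^sup>2" if l: "l \<in> T' - {k}" for l
    proof -
      have "norm (z l - z j) \<le> 2 * c j" using T(2)[of l] l by (simp add: T'_def c_def)
      then have "norm (1 - cnj (z l) * z j) \<le> 4 * c j"
        unfolding comm using cnj_le_dist[of "z j" "z l"] z[of j] by (simp add: c_def)
      then have "(norm (1 - cnj (z l) * z j))\<^sup>2 \<le> 16 * c j * c j"
        using power_mono[of "norm (1 - cnj (z l) * z j)" "4 * c j" 2] by (simp add: power2_eq_square)
      moreover have "0 < norm (1 - cnj (z l) * z j)" using one_minus_cnj_pos(3)[OF z, of "z j" l] z[of j] by simp
      ultimately show ?thesis using c[of l] c[of j] by (simp add: field_simps)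
    qed
    then have "(\<Sum>l\<in>T' - {k}. c l / (16 * c j)) \<le> 2 * ln (6 * C)"
      using 5 by (meson order_trans sum_mono)
    then have "sum c (T' - {k}) / (16 * c j) \<le> 2 * ln (6 * C)" by (simp add: sum_divide_distrib)
    then have "sum c (T' - {k}) \<le> 32 * ln (6 * C) * c j" using c[of j] by (simp add: field_simps)
    moreover have "c k \<le> 3 * c j"
      using s2(1) norm_triangle_ineq2[of "z j" "z k"] norm_minus_commute[of "z j" "z k"] by (simp add: s_def c_def)
    moreover have "sum c T' = c k + sum c (T' - {k})" using k(1) fT'(1) by (simp add: sum.remove)
    ultimately show ?thesis by (simp add: T'_def algebra_simps)
  qed
  have "sum c T \<le> (32 * ln (6 * C) + 3) * c j + c j" using sj main by linarith
  then show ?thesis by (simp add: c_def algebra_simps)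
qed

text \<open>A Carleson-type condition centred at an arbitrary point \<open>z0\<close>. The zero
  \<open>z j\<close> within \<rho> is an anchor: its depth is at most \<open>2 * \<rho>\<close>, so
  estimates centred at \<open>z j\<close> carry over to \<open>z0\<close>. The depth condition holds
  once \<open>z0\<close> is close enough to the circle.\<close>

definition mass_const :: "(nat \<Rightarrow> complex) \<Rightarrow> real \<Rightarrow> bool" where
  "mass_const z A \<longleftrightarrow> 0 \<le> A \<and> (\<forall>z0 \<rho> j T. norm z0 < 1 \<longrightarrow> finite T \<longrightarrow> \<rho> \<le> 2 \<longrightarrow>
     1 - norm (z j) \<le> 2 * norm (z j - z0) \<longrightarrow> norm (z j - z0) \<le> \<rho> \<longrightarrow> (\<forall>l\<in>T. \<rho> \<le> norm (z l - z0)) \<longrightarrow>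
     (\<Sum>l\<in>T. (1 - norm (z l)) / (norm (z l - z0))\<^sup>2) \<le> A / \<rho>)"

lemma mass_const_exists:
  assumes C: "bump_const z C" and z: "\<And>l. norm (z l) < 1" and inj: "inj z"
  shows "\<exists>A. mass_const z A"
proof -
  define c where "c l = 1 - norm (z l)" for l
  have c: "0 < c l" for l using z[of l] by (simp add: c_def)
  have C1: "1 \<le> C" using C by (simp add: bump_const_def)
  define A1 where "A1 = 64 * C * ln (16 * C)"
  have A1: "0 \<le> A1" unfolding A1_def using C1 by (intro mult_nonneg_nonneg ln_ge_zero) auto
  \<comment> \<open>The term \<open>8 * A1\<close> pays for one dyadic annulus: it is
    \<open>(2 * R)\<^sup>2 * (A1 / R)\<close> with \<open>R = 2 ^ m * (2 * c j)\<close>, divided by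
    \<open>2 ^ m * c j\<close>.\<close>
  define A3 where "A3 = (32 * ln (6 * C) + 4) + 8 * A1"
  have A30: "0 \<le> 32 * ln (6 * C) + 4" using C1 by (intro add_nonneg_nonneg mult_nonneg_nonneg ln_ge_zero) auto
  have far: "(\<Sum>l\<in>T. c l / (norm (z l - z j))\<^sup>2) \<le> A1 / R"
    if "c j \<le> R" "finite T" "\<And>l. l \<in> T \<Longrightarrow> R \<le> norm (z l - z j)" for j R T
  proof (cases "R \<le> 2")
    case True
    then show ?thesis using far_sum[OF C z inj, of j R T] that by (simp add: c_def A1_def)
  next
    case False
    have "T = {}"
    proof (rule ccontr)
      assume "T \<noteq> {}"
      then obtain l where "l \<in> T" by blast
      then have "R \<le> norm (z l - z j)" using that(3) by simp
      with False z[of l] z[of j] norm_triangle_ineq4[of "z l" "z j"] show False by linarith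
    qed
    then show ?thesis using A1 False by simp
  qed
  have mass1: "sum c T \<le> A3 * (2 ^ m * c j)" 
    if "finite T" "\<And>l. l \<in> T \<Longrightarrow> norm (z l - z j) < 2 ^ m * (2 * c j)" for m j T
    using that
  proof (induction m arbitrary: T)
    case 0
    have "sum c T \<le> (32 * ln (6 * C) + 4) * c j"
      using near_mass[OF C z inj, of T j] 0 by (simp add: c_def)
    also have "\<dots> \<le> A3 * c j" using A1 c[of j] by (intro mult_right_mono) (auto simp: A3_def)
    finally show ?case by simp
  next
    case (Suc m)
    define R where "R = 2 ^ m * (2 * c j)"
    have R: "0 < R" using c[of j] by (simp add: R_def)
    have cR: "c j \<le> R"
    proof -
      have "1 * c j \<le> 2 ^ m * c j" using c[of j] by (intro mult_right_mono) auto
      moreover have "R = 2 * (2 ^ m * c j)" by (simp add: R_def)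
      ultimately show ?thesis using c[of j] by linarith
    qed
    define T1 where "T1 = {l \<in> T. norm (z l - z j) < R}"
    define T2 where "T2 = {l \<in> T. R \<le> norm (z l - z j)}"
    have T12: "T = T1 \<union> T2" "T1 \<inter> T2 = {}" "finite T1" "finite T2" using Suc.prems(1) by (auto simp: T1_def T2_def)
    have "sum c T1 \<le> A3 * (2 ^ m * c j)" by (rule Suc.IH) (auto simp: T1_def R_def Suc.prems)
    moreover have "sum c T2 \<le> (2 * R)\<^sup>2 * (\<Sum>l\<in>T2. c l / (norm (z l - z j))\<^sup>2)"
      unfolding sum_distrib_left
    proof (rule sum_mono)
      fix l assume l: "l \<in> T2"
      then have "norm (z l - z j) < 2 * R" using Suc.prems(2)[of l] by (simp add: T2_def R_def)
      moreover have p: "0 < norm (z l - z j)" using l R by (auto simp: T2_def)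
      ultimately have "(norm (z l - z j))\<^sup>2 \<le> (2 * R)\<^sup>2" by (intro power_mono) auto
      then have "1 \<le> (2 * R)\<^sup>2 / (norm (z l - z j))\<^sup>2" using p by simp
      then have "c l * 1 \<le> c l * ((2 * R)\<^sup>2 / (norm (z l - z j))\<^sup>2)" using c[of l] by (intro mult_left_mono) auto
      then show "c l \<le> (2 * R)\<^sup>2 * (c l / (norm (z l - z j))\<^sup>2)" by (simp add: mult.commute)
    qed
    moreover have "(2 * R)\<^sup>2 * (\<Sum>l\<in>T2. c l / (norm (z l - z j))\<^sup>2) \<le> (2 * R)\<^sup>2 * (A1 / R)"
      using cR T12 by (intro mult_left_mono far) (auto simp: T2_def)
    moreover have "(2 * R)\<^sup>2 * (A1 / R) = 8 * A1 * (2 ^ m * c j)" using R by (simp add: power2_eq_square field_simps R_def)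
    moreover have "8 * A1 * (2 ^ m * c j) \<le> A3 * (2 ^ m * c j)"
      using A30 c[of j] by (intro mult_right_mono) (auto simp: A3_def)
    moreover have "sum c T = sum c T1 + sum c T2" using T12 by (metis sum.union_disjoint)
    ultimately have "sum c T \<le> A3 * (2 ^ m * c j) + A3 * (2 ^ m * c j)" by linarith
    then show ?case by (simp add: algebra_simps)
  qed
  have A3: "0 \<le> A3" using A30 A1 by (simp add: A3_def)
  have mass: "sum c T \<le> A3 * R" if R: "c j \<le> R" and T: "finite T" "\<And>l. l \<in> T \<Longrightarrow> norm (z l - z j) < R" for j R T
  proof -
    have "\<exists>m. R \<le> 2 ^ m * (2 * c j)"
    proof -
      obtain m where "R / (2 * c j) < 2 ^ m" using real_arch_pow[of 2 "R / (2 * c j)"] by auto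
      then show ?thesis using c[of j] by (intro exI[of _ m]) (simp add: field_simps)
    qed
    then obtain m where m: "R \<le> 2 ^ m * (2 * c j)" "\<And>k. k < m \<Longrightarrow> \<not> R \<le> 2 ^ k * (2 * c j)"
      using exists_least_iff[of "\<lambda>m. R \<le> 2 ^ m * (2 * c j)"] by auto
    have le: "2 ^ m * c j \<le> R"
    proof (cases m)
      case 0
      then show ?thesis using R by simp
    next
      case (Suc k)
      then show ?thesis using m(2)[of k] by simp
    qed
    have "sum c T \<le> A3 * (2 ^ m * c j)"
      by (rule mass1[OF T(1)]) (use T(2) m(1) in force)
    also have "\<dots> \<le> A3 * R" using le A3 by (rule mult_left_mono)
    finally show ?thesis .
  qed
  have "mass_const z (3 * A3 + A1)"
    unfolding mass_const_def
  proof (intro conjI allI impI)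
    show "0 \<le> 3 * A3 + A1" using A1 A3 by simp
    fix z0 :: complex and \<rho> j T
    assume z0: "norm z0 < 1" and T: "finite T" "\<forall>l\<in>T. \<rho> \<le> norm (z l - z0)"
      and cj: "1 - norm (z j) \<le> 2 * norm (z j - z0)" and \<rho>: "norm (z j - z0) \<le> \<rho>"
    have cj': "c j \<le> 3 * \<rho>" and \<rho>0: "0 < \<rho>" using cj \<rho> c[of j] by (auto simp: c_def)
    \<comment> \<open>Zeros within \<open>3 * \<rho>\<close> of \<open>z j\<close> are counted by
      mass, each with weight at most \<open>c l / \<rho>\<^sup>2\<close>; for the others the
      distances to \<open>z0\<close> and to \<open>z j\<close> are comparable and \<open>far\<close>
      applies.\<close>
    define T1 where "T1 = {l \<in> T. norm (z l - z j) < 3 * \<rho>}"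
    define T2 where "T2 = {l \<in> T. 3 * \<rho> \<le> norm (z l - z j)}"
    have T12: "T = T1 \<union> T2" "T1 \<inter> T2 = {}" "finite T1" "finite T2" using T(1) by (auto simp: T1_def T2_def)
    have "(\<Sum>l\<in>T1. c l / (norm (z l - z0))\<^sup>2) \<le> (\<Sum>l\<in>T1. c l / \<rho>\<^sup>2)"
    proof (rule sum_mono)
      fix l assume "l \<in> T1"
      then have "\<rho> \<le> norm (z l - z0)" using T(2) by (auto simp: T1_def)
      then show "c l / (norm (z l - z0))\<^sup>2 \<le> c l / \<rho>\<^sup>2"
        using \<rho>0 c[of l] by (intro divide_left_mono power_mono mult_pos_pos zero_less_power) auto
    qed
    also have "\<dots> = sum c T1 / \<rho>\<^sup>2" by (simp add: sum_divide_distrib)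
    also have "\<dots> \<le> (A3 * (3 * \<rho>)) / \<rho>\<^sup>2"
      by (intro divide_right_mono mass[OF cj' T12(3)]) (auto simp: T1_def)
    also have "\<dots> = 3 * A3 / \<rho>" using \<rho>0 by (simp add: power2_eq_square)
    finally have 1: "(\<Sum>l\<in>T1. c l / (norm (z l - z0))\<^sup>2) \<le> 3 * A3 / \<rho>" .
    have "(\<Sum>l\<in>T2. c l / (norm (z l - z0))\<^sup>2) \<le> (\<Sum>l\<in>T2. (9/4) * (c l / (norm (z l - z j))\<^sup>2))"
    proof (rule sum_mono)
      fix l assume l: "l \<in> T2"
      have "norm (z l - z j) \<le> norm (z l - z0) + norm (z j - z0)"
        using norm_triangle_ineq4[of "z l - z0" "z j - z0"] by simp
      then have "(2/3) * norm (z l - z j) \<le> norm (z l - z0)" using l \<rho> by (auto simp: T2_def)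
      then have "((2/3) * norm (z l - z j))\<^sup>2 \<le> (norm (z l - z0))\<^sup>2" by (rule power_mono) simp
      moreover have p: "0 < norm (z l - z j)" using l \<rho>0 by (auto simp: T2_def)
      ultimately have "c l / (norm (z l - z0))\<^sup>2 \<le> c l / ((2/3) * norm (z l - z j))\<^sup>2"
        using c[of l] by (intro divide_left_mono) (auto intro!: mult_pos_pos zero_less_power less_le_trans[OF _ \<open>(2/3) * norm (z l - z j) \<le> norm (z l - z0)\<close>])
      then show "c l / (norm (z l - z0))\<^sup>2 \<le> (9/4) * (c l / (norm (z l - z j))\<^sup>2)"
        by (simp add: power_mult_distrib power2_eq_square)
    qed
    also have "\<dots> = (9/4) * (\<Sum>l\<in>T2. c l / (norm (z l - z j))\<^sup>2)" by (simp add: sum_distrib_left)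
    also have "\<dots> \<le> (9/4) * (A1 / (3 * \<rho>))"
      by (intro mult_left_mono far[OF cj' T12(4)]) (auto simp: T2_def)
    also have "\<dots> \<le> A1 / \<rho>" using A1 \<rho>0 by (simp add: field_simps)
    finally have 2: "(\<Sum>l\<in>T2. c l / (norm (z l - z0))\<^sup>2) \<le> A1 / \<rho>" .
    have "(\<Sum>l\<in>T. c l / (norm (z l - z0))\<^sup>2) \<le> 3 * A3 / \<rho> + A1 / \<rho>"
      using 1 2 T12 by (metis (no_types, lifting) add_mono sum.union_disjoint)
    then show "(\<Sum>l\<in>T. (1 - norm (z l)) / (norm (z l - z0))\<^sup>2) \<le> (3 * A3 + A1) / \<rho>"
      by (simp add: c_def add_divide_distrib)
  qed
  then show ?thesis by blast
qed

section \<open>Simplicity of the zeros and local bounds\<close>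

text \<open>A repeated value would give \<open>B\<close> a factor \<open>(w - a)\<^sup>2\<close>;
  after division by the single power that order 1 allows, the quotient would still vanish at
  \<open>a\<close>.\<close>

lemma blaschke_simple_zeros_inj:
  assumes z: "blaschke_seq z" and ord: "\<forall>w\<in>ball 0 1. blaschke z w = 0 \<longrightarrow> zorder (blaschke z) w = 1"
  shows "inj z"
proof (rule linorder_injI, rule notI)
  fix i j :: nat assume ij: "i < j" "z i = z j"
  define B where "B = blaschke z"
  define a where "a = z i"
  have a: "norm a < 1" using blaschke_seqD(1)[OF z] by (simp add: a_def)
  define u where "u = (if a = 0 then -1 else cnj a / of_real (norm a))"
  define T where "T = {..<Suc j} - {i} - {j}"
  define G where "G = (\<lambda>w. (u / (1 - cnj a * w))\<^sup>2 * bprod z T w * blaschke (\<lambda>k. z (k + Suc j)) w)"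
  have zd: "\<forall>k\<in>S. norm (z k) < 1" for S using blaschke_seqD(1)[OF z] by simp
  have G: "G holomorphic_on disc"
    unfolding G_def using one_minus_cnj_pos(3)[OF a]
    by (intro holomorphic_intros bprod_holo(1)[OF zd] blaschke_holo blaschke_seqD(3) z) auto
  have BG: "B w = (w - a)\<^sup>2 * G w" if w: "norm w < 1" for w
  proof -
    have "bprod z {..<Suc j} w = bfactor (z i) w * (bfactor (z j) w * bprod z T w)"
      unfolding bprod_def T_def using ij(1)
      by (subst prod.remove[of "{..<Suc j}" i], simp, simp, subst prod.remove[of "{..<Suc j} - {i}" j]) auto
    also have "\<dots> = (w - a)\<^sup>2 * ((u / (1 - cnj a * w))\<^sup>2 * bprod z T w)"
      unfolding ij(2)[symmetric] a_def[symmetric] bfactor_def u_def[symmetric]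
      by (simp add: power2_eq_square divide_inverse algebra_simps)
    finally show ?thesis
      unfolding B_def blaschke_split[OF z w, of "Suc j"] G_def by (simp add: mult.assoc)
  qed
  have hB: "B holomorphic_on disc" unfolding B_def by (rule blaschke_holo[OF z])
  have "B a = 0" using BG[OF a] by simp
  then have ord1: "zorder B a = 1" using ord a by (simp add: B_def)
  \<comment> \<open>\<open>zorder\<close> is informative only if \<open>B\<close> does not vanish
    identically near \<open>a\<close>. The zeros are countable, and at a point \<open>w0\<close> off
    them a tail close to 1 shows \<open>B w0 \<noteq> 0\<close>.\<close>
  have "uncountable (disc - range z)"
    by (rule uncountable_minus_countable) (auto simp: uncountable_ball)
  then obtain w0 where w0: "norm w0 < 1" "w0 \<notin> range z"
    by (metis DiffE ball_eq_empty countable_empty equals0I mem_ball_0)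
  have "B w0 \<noteq> 0"
  proof -
    have "\<forall>\<^sub>F n in sequentially. dist (blaschke (\<lambda>j. z (j + n)) w0) 1 < 1"
      using tendstoD[OF blaschke_tail_LIMSEQ[OF z w0(1)], of 1] by simp
    then obtain n where n: "dist (blaschke (\<lambda>j. z (j + n)) w0) 1 < 1"
      by (auto simp: eventually_sequentially)
    have "bfactor (z k) w0 \<noteq> 0" for k
    proof -
      have "norm (z k - w0) / norm (1 - cnj (z k) * w0) \<noteq> 0"
        using w0 one_minus_cnj_pos(3)[OF blaschke_seqD(1)[OF z], of w0 k] by auto
      then show ?thesis by (metis norm_bfactor norm_zero)
    qed
    then have "bprod z {..<n} w0 \<noteq> 0" by (simp add: bprod_def)
    moreover have "blaschke (\<lambda>j. z (j + n)) w0 \<noteq> 0" using n by (auto simp: dist_norm)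
    ultimately show ?thesis unfolding B_def blaschke_split[OF z w0(1), of n] by simp
  qed
  have freq: "\<exists>\<^sub>F w in at a. B w \<noteq> 0"
  proof (rule ccontr)
    assume "\<not> ?thesis"
    then have "\<forall>\<^sub>F w in at a. B w = 0" by (simp add: not_frequently)
    then obtain r where r: "r > 0" "\<And>w. w \<noteq> a \<Longrightarrow> dist w a < r \<Longrightarrow> B w = 0"
      by (auto simp: eventually_at)
    have "B w0 = 0"
    proof (rule analytic_continuation[OF hB open_ball connected_ball])
      show "disc \<inter> ball a r \<subseteq> disc" by simp
      show "a islimpt disc \<inter> ball a r"
        using a r(1) by (intro open_imp_islimpt) auto
      show "B w = 0" if "w \<in> disc \<inter> ball a r" for w
        using that r(2)[of w] \<open>B a = 0\<close> by (cases "w = a") (auto simp: dist_commute)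
    qed (use a w0 in auto)
    with \<open>B w0 \<noteq> 0\<close> show False by simp
  qed
  have an: "B analytic_on {a}"
    using hB a by (auto simp: analytic_on_open intro: analytic_on_subset[of B disc])
  obtain r where r: "r > 0" "zor_poly B a holomorphic_on cball a r" "zor_poly B a a \<noteq> 0"
     "\<And>w. w \<in> cball a r - {a} \<Longrightarrow> B w = zor_poly B a w * (w - a) powi zorder B a"
    using zorder_exist[OF isolated_singularity_at_analytic[OF an] not_essential_analytic[OF an] freq] by auto
  define h where "h = zor_poly B a"
  have eqh: "h w = (w - a) * G w" if "w \<in> cball a r - {a}" "norm w < 1" for w
    using r(4)[OF that(1)] BG[OF that(2)] that unfolding ord1 h_def by (simp add: power2_eq_square)
  have ch: "(h \<longlongrightarrow> h a) (at a)"
  proof -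
    have "h holomorphic_on ball a r" unfolding h_def by (rule holomorphic_on_subset[OF r(2)]) auto
    then have "isCont h a"
      using r(1) by (intro continuous_on_interior[OF holomorphic_on_imp_continuous_on]) auto
    then show ?thesis by (simp add: isCont_def)
  qed
  have cG: "((\<lambda>w. (w - a) * G w) \<longlongrightarrow> (a - a) * G a) (at a)"
  proof -
    have "isCont G a" using G a by (intro continuous_on_interior[OF holomorphic_on_imp_continuous_on[OF G]]) auto
    then have "(G \<longlongrightarrow> G a) (at a)" by (simp add: isCont_def)
    then show ?thesis by (intro tendsto_intros) 
  qed
  have "\<forall>\<^sub>F w in at a. h w = (w - a) * G w"
  proof -
    have "\<forall>\<^sub>F w in at a. w \<in> (ball a r \<inter> disc) - {a}"
      using r(1) a by (intro eventually_at_in_open) auto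
    then show ?thesis by eventually_elim (use eqh in auto)
  qed
  then have "(h \<longlongrightarrow> (a - a) * G a) (at a)" using cG by (simp add: tendsto_cong)
  then have "h a = 0" using ch tendsto_unique[OF at_neq_bot] by fastforce
  with r(3) show False by (simp add: h_def)
qed

text \<open>The point \<open>w\<close> may lie outside the disc. Both relevant distances stay above
  \<open>3/4 * norm (a - z0)\<close>, and \<open>norm w\<close> differs from 1 by a multiple of
  \<rho> at most, so neither the squared factor nor its inverse can exceed 1 by much;
  \<open>9\<close> rounds up \<open>2 * (5/2) * (16/9)\<close>.\<close>

lemma bfactor_local:
  assumes a: "norm a < 1" and z0: "norm z0 < 1" and \<rho>: "0 < \<rho>" "\<rho> \<le> 2" "1 - norm z0 \<le> \<rho>" "\<rho> \<le> norm (a - z0)"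
    and w: "norm (w - z0) \<le> \<rho> / 4"
  shows "1 - cnj a * w \<noteq> 0" "w \<noteq> a" 
    "(norm (bfactor a w))\<^sup>2 \<le> exp (9 * \<rho> * ((1 - norm a) / (norm (a - z0))\<^sup>2))"
    "(norm (inverse (bfactor a w)))\<^sup>2 \<le> exp (9 * \<rho> * ((1 - norm a) / (norm (a - z0))\<^sup>2))"
proof -
  define s where "s = norm (a - z0)"
  define x where "x = norm (1 - cnj a * w)"
  define y where "y = norm (a - w)"
  define c where "c = 1 - norm a"
  have s: "0 < s" "\<rho> \<le> s" using \<rho> by (auto simp: s_def)
  have c: "0 < c" "c \<le> 1" "1 - (norm a)\<^sup>2 \<le> 2 * c" "0 \<le> 1 - (norm a)\<^sup>2"
  proof -
    show "0 < c" "c \<le> 1" using a by (auto simp: c_def)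
    have "0 \<le> (1 - norm a)\<^sup>2" by simp
    then show "1 - (norm a)\<^sup>2 \<le> 2 * c" by (simp add: c_def power2_eq_square algebra_simps)
    show "0 \<le> 1 - (norm a)\<^sup>2" using a by (simp add: power_le_one)
  qed
  have y: "3/4 * s \<le> y"
    using norm_triangle_ineq[of "a - w" "w - z0"] w s(2) by (simp add: y_def s_def)
  have x: "3/4 * s \<le> x"
  proof -
    have "s \<le> norm (1 - cnj a * z0)" using dist_le_cnj[of a z0] a z0 by (simp add: s_def)
    moreover have "1 - cnj a * z0 = (1 - cnj a * w) + cnj a * (w - z0)" by (simp add: algebra_simps)
    then have "norm (1 - cnj a * z0) \<le> x + norm (cnj a * (w - z0))"
      unfolding x_def by (metis norm_triangle_ineq)
    moreover have "norm (cnj a * (w - z0)) \<le> norm (w - z0)"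
      using a by (simp add: norm_mult mult_left_le_one_le)
    ultimately show ?thesis using w s(2) by linarith
  qed
  have xy: "0 < x" "0 < y" using x y s by linarith+
  then show nz: "1 - cnj a * w \<noteq> 0" "w \<noteq> a" by (auto simp: x_def y_def)
  have nw: "norm w \<le> 1 + \<rho>/4" "1 - norm w \<le> 5/4 * \<rho>"
    using norm_triangle_ineq2[of w z0] norm_triangle_ineq2[of z0 w] w z0 \<rho> norm_minus_commute[of z0 w] by linarith+
  have sq: "c / t\<^sup>2 \<le> 16/9 * (c / s\<^sup>2)" if "3/4 * s \<le> t" for t
  proof -
    have "(3/4 * s)\<^sup>2 \<le> t\<^sup>2" using that s by (intro power_mono) auto
    then have "s\<^sup>2 \<le> 16/9 * t\<^sup>2" by (simp add: power2_eq_square)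
    then show ?thesis using that s c by (intro divide_square_le) auto
  qed
  have w1: "(norm w)\<^sup>2 - 1 \<le> \<rho>"
  proof -
    have "(norm w)\<^sup>2 \<le> (1 + \<rho>/4)\<^sup>2" using nw by (intro power_mono) auto
    also have "\<dots> = 1 + \<rho>/2 + \<rho> * \<rho> / 16" by (simp add: power2_eq_square algebra_simps)
    also have "\<rho> * \<rho> \<le> 2 * \<rho>" using \<rho> by (intro mult_right_mono) auto
    finally show ?thesis using \<rho>(1) by linarith
  qed
  have w2: "1 - (norm w)\<^sup>2 \<le> 5/2 * \<rho>"
  proof -
    have "0 \<le> (1 - norm w)\<^sup>2" by simp
    then have "1 - (norm w)\<^sup>2 \<le> 2 * (1 - norm w)" by (simp add: power2_eq_square algebra_simps)
    then show ?thesis using nw(2) by argo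
  qed
  have bound: "1 + (1 - (norm a)\<^sup>2) * v / t\<^sup>2 \<le> exp (9 * \<rho> * (c / s\<^sup>2))" if v: "v \<le> 5/2 * \<rho>" and t: "3/4 * s \<le> t" for v t
  proof -
    have "(1 - (norm a)\<^sup>2) * v \<le> (1 - (norm a)\<^sup>2) * (5/2 * \<rho>)" using v c by (intro mult_left_mono) auto
    also have "\<dots> \<le> (2 * c) * (5/2 * \<rho>)" using c \<rho> by (intro mult_right_mono) auto
    finally have "(1 - (norm a)\<^sup>2) * v / t\<^sup>2 \<le> (2 * c) * (5/2 * \<rho>) / t\<^sup>2" by (rule divide_right_mono) simp
    also have "\<dots> = 5 * \<rho> * (c / t\<^sup>2)" by simp
    also have "\<dots> \<le> 5 * \<rho> * (16/9 * (c / s\<^sup>2))" using sq[OF t] \<rho> by (intro mult_left_mono) auto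
    also have "\<dots> \<le> 9 * \<rho> * (c / s\<^sup>2)" using \<rho> c s by (simp add: field_simps)
    finally show ?thesis using exp_ge_add_one_self[of "9 * \<rho> * (c / s\<^sup>2)"] by linarith
  qed
  have "(norm (bfactor a w))\<^sup>2 = 1 + (1 - (norm a)\<^sup>2) * ((norm w)\<^sup>2 - 1) / x\<^sup>2"
    unfolding norm_bfactor_square[OF nz(1)] x_def by (simp add: algebra_simps diff_divide_distrib)
  also have "\<dots> \<le> exp (9 * \<rho> * (c / s\<^sup>2))" using w1 \<rho>(1) x by (intro bound) auto
  finally show "(norm (bfactor a w))\<^sup>2 \<le> exp (9 * \<rho> * ((1 - norm a) / (norm (a - z0))\<^sup>2))"
    by (simp add: c_def s_def)
  have "(norm (inverse (bfactor a w)))\<^sup>2 = x\<^sup>2 / y\<^sup>2"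
    by (simp add: norm_inverse norm_bfactor x_def y_def power_divide power_inverse)
  also have "x\<^sup>2 = y\<^sup>2 + (1 - (norm a)\<^sup>2) * (1 - (norm w)\<^sup>2)"
    unfolding x_def y_def by (rule cnj_dist_identity)
  also have "(y\<^sup>2 + (1 - (norm a)\<^sup>2) * (1 - (norm w)\<^sup>2)) / y\<^sup>2 = 1 + (1 - (norm a)\<^sup>2) * (1 - (norm w)\<^sup>2) / y\<^sup>2"
    using xy by (simp add: add_divide_distrib)
  also have "\<dots> \<le> exp (9 * \<rho> * (c / s\<^sup>2))" using w2 y by (intro bound) auto
  finally show "(norm (inverse (bfactor a w)))\<^sup>2 \<le> exp (9 * \<rho> * ((1 - norm a) / (norm (a - z0))\<^sup>2))"
    by (simp add: c_def s_def)
qed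

lemma cauchy_ball_bound:
  fixes f :: "complex \<Rightarrow> complex"
  assumes hol: "\<And>w. norm (w - z0) \<le> r \<Longrightarrow> f field_differentiable at w" and r: "0 < r" and M: "0 \<le> M"
    and b: "\<And>w. norm (w - z0) \<le> r \<Longrightarrow> norm (f w) \<le> M"
  shows "norm ((deriv ^^ i) f z0) \<le> fact i * M / r ^ i"
proof (rule Cauchy_inequality[OF _ _ r])
  show "f holomorphic_on ball z0 r"
    unfolding holomorphic_on_def
  proof
    fix x assume "x \<in> ball z0 r"
    then have "norm (x - z0) \<le> r" by (simp add: dist_norm norm_minus_commute)
    from field_differentiable_at_within[OF hol[OF this]]
    show "f field_differentiable at x within ball z0 r" .
  qed
  have "f field_differentiable at w" if "w \<in> cball z0 r" for w
    using hol[of w] that by (simp add: dist_norm norm_minus_commute)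
  then show "continuous_on (cball z0 r) f"
    by (intro continuous_at_imp_continuous_on ballI field_differentiable_imp_continuous_at)
  show "norm (f x) \<le> M" if "norm (z0 - x) = r" for x
    using b[of x] that by (simp add: norm_minus_commute)
qed

text \<open>The exponents of \<open>bfactor_local\<close> add up to at most \<open>9 * A\<close>,
  whatever the number of zeros. The disc of radius \<open>\<rho> / 4\<close> may cross the circle,
  which makes Cauchy's inequality usable at \<open>z0\<close>, at the price
  \<open>1 / \<rho>\<close> per derivative.\<close>

lemma bprod_local:
  assumes T: "finite T" "\<forall>l\<in>T. norm (z l) < 1" and z0: "norm z0 < 1" and \<rho>: "0 < \<rho>" "\<rho> \<le> 2" "1 - norm z0 \<le> \<rho>"
    and far: "\<forall>l\<in>T. \<rho> \<le> norm (z l - z0)" and A: "(\<Sum>l\<in>T. (1 - norm (z l)) / (norm (z l - z0))\<^sup>2) \<le> A / \<rho>"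
    and w: "norm (w - z0) \<le> \<rho> / 4"
  shows "bprod z T field_differentiable at w" "bprod z T w \<noteq> 0" 
    "norm (bprod z T w) \<le> exp (9/2 * A)" "norm (inverse (bprod z T w)) \<le> exp (9/2 * A)"
proof -
  note loc = bfactor_local[OF _ z0 \<rho> _ w]
  have fd: "bfactor a field_differentiable at w" if "1 - cnj a * w \<noteq> 0" for a
    unfolding bfactor_def[abs_def] using that by (auto intro!: derivative_intros)
  have "(\<lambda>w. \<Prod>l\<in>S. bfactor (z l) w) field_differentiable at w" if "S \<subseteq> T" for S
    using finite_subset[OF that T(1)] that
  proof (induction rule: finite_induct)
    case (insert l S)
    then have "bfactor (z l) field_differentiable at w" using loc(1) T(2) far by (intro fd) auto
    with insert show ?case by (auto intro: derivative_intros)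
  qed simp
  then show "bprod z T field_differentiable at w"
    unfolding bprod_def[abs_def] by blast
  have "bfactor (z l) w \<noteq> 0" if "l \<in> T" for l
    using loc(1,2)[of "z l"] T(2) far that by (auto simp: bfactor_def)
  then show "bprod z T w \<noteq> 0" using T(1) by (simp add: bprod_def)
  have e: "(\<Prod>l\<in>T. exp (9 * \<rho> * ((1 - norm (z l)) / (norm (z l - z0))\<^sup>2))) \<le> (exp (9/2 * A))\<^sup>2"
  proof -
    have "(\<Prod>l\<in>T. exp (9 * \<rho> * ((1 - norm (z l)) / (norm (z l - z0))\<^sup>2)))
       = exp (9 * \<rho> * (\<Sum>l\<in>T. (1 - norm (z l)) / (norm (z l - z0))\<^sup>2))"
      using T(1) by (simp add: exp_sum sum_distrib_left)
    also have "\<dots> \<le> exp (9 * \<rho> * (A / \<rho>))"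
      unfolding exp_le_cancel_iff by (rule mult_left_mono[OF A]) (use \<rho> in simp)
    also have "\<dots> = (exp (9/2 * A))\<^sup>2" using \<rho>(1) by (simp add: exp_double[symmetric])
    finally show ?thesis .
  qed
  have "(norm (bprod z T w))\<^sup>2 = (\<Prod>l\<in>T. (norm (bfactor (z l) w))\<^sup>2)"
    by (simp add: bprod_def prod_norm[symmetric] prod_power_distrib)
  also have "\<dots> \<le> (\<Prod>l\<in>T. exp (9 * \<rho> * ((1 - norm (z l)) / (norm (z l - z0))\<^sup>2)))"
    using loc(3) T(2) far by (intro prod_mono) auto
  also note e
  finally show "norm (bprod z T w) \<le> exp (9/2 * A)" by (rule power2_le_imp_le) simp
  have "(norm (inverse (bprod z T w)))\<^sup>2 = (\<Prod>l\<in>T. (norm (inverse (bfactor (z l) w)))\<^sup>2)"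
    by (simp add: bprod_def prod_inversef[symmetric] prod_norm[symmetric] prod_power_distrib o_def norm_inverse power_inverse)
  also have "\<dots> \<le> (\<Prod>l\<in>T. exp (9 * \<rho> * ((1 - norm (z l)) / (norm (z l - z0))\<^sup>2)))"
    using loc(4) T(2) far by (intro prod_mono) auto
  also note e
  finally show "norm (inverse (bprod z T w)) \<le> exp (9/2 * A)" by (rule power2_le_imp_le) simp
qed

lemma power_deriv_bound:
  fixes M \<rho> :: real
  assumes "i \<le> N" "0 \<le> M" "0 < \<rho>"
  shows "fact i * M / (\<rho> / 4) ^ i \<le> fact N * 4 ^ N * M / \<rho> ^ i"
proof -
  have "fact i * M / (\<rho> / 4) ^ i = fact i * 4 ^ i * M / \<rho> ^ i" using assms by (simp add: power_divide)
  also have "\<dots> \<le> fact N * 4 ^ N * M / \<rho> ^ i"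
    using assms by (intro divide_right_mono mult_right_mono mult_mono fact_mono power_increasing) auto
  finally show ?thesis .
qed

lemma bprod_deriv_bounds:
  assumes "finite T" "\<forall>l\<in>T. norm (z l) < 1" "norm z0 < 1" "0 < \<rho>" "\<rho> \<le> 2" "1 - norm z0 \<le> \<rho>"
    "\<forall>l\<in>T. \<rho> \<le> norm (z l - z0)" "(\<Sum>l\<in>T. (1 - norm (z l)) / (norm (z l - z0))\<^sup>2) \<le> A / \<rho>" and i: "i \<le> N"
  shows "norm ((deriv ^^ i) (\<lambda>w. bprod z T w ^ m) z0) \<le> fact N * 4 ^ N * exp (9/2 * A) ^ m / \<rho> ^ i"
    "norm ((deriv ^^ i) (\<lambda>w. inverse (bprod z T w)) z0) \<le> fact N * 4 ^ N * exp (9/2 * A) / \<rho> ^ i"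
proof -
  note loc = bprod_local[OF assms(1-8)]
  have "norm ((deriv ^^ i) (\<lambda>w. bprod z T w ^ m) z0) \<le> fact i * exp (9/2 * A) ^ m / (\<rho>/4) ^ i"
    by (rule cauchy_ball_bound)
      (use loc assms(4) in \<open>auto intro!: derivative_intros power_mono simp: norm_power\<close>)
  also have "\<dots> \<le> fact N * 4 ^ N * exp (9/2 * A) ^ m / \<rho> ^ i"
    by (rule power_deriv_bound) (use assms in auto)
  finally show "norm ((deriv ^^ i) (\<lambda>w. bprod z T w ^ m) z0) \<le> fact N * 4 ^ N * exp (9/2 * A) ^ m / \<rho> ^ i" .
  have "norm ((deriv ^^ i) (\<lambda>w. inverse (bprod z T w)) z0) \<le> fact i * exp (9/2 * A) / (\<rho>/4) ^ i"
    by (rule cauchy_ball_bound)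
      (use loc assms(4) in \<open>auto intro!: derivative_intros\<close>)
  also have "\<dots> \<le> fact N * 4 ^ N * exp (9/2 * A) / \<rho> ^ i"
    by (rule power_deriv_bound) (use assms in auto)
  finally show "norm ((deriv ^^ i) (\<lambda>w. inverse (bprod z T w)) z0) \<le> fact N * 4 ^ N * exp (9/2 * A) / \<rho> ^ i" .
qed

section \<open>Division by a Blaschke product\<close>

lemma nearest_subset:
  fixes f :: "'a \<Rightarrow> real"
  assumes "finite S" "N \<le> card S"
  shows "\<exists>A\<subseteq>S. card A = N \<and> (\<forall>a\<in>A. \<forall>l\<in>S - A. f a \<le> f l)"
  using assms(2)
proof (induction N)
  case (Suc N)
  then obtain A where A: "A \<subseteq> S" "card A = N" "\<forall>a\<in>A. \<forall>l\<in>S - A. f a \<le> f l" by auto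
  have fin: "finite A" "finite (S - A)" using A(1) assms(1) by (auto intro: finite_subset)
  have ne: "S - A \<noteq> {}"
  proof
    assume "S - A = {}"
    then have "S = A" using A(1) by auto
    then show False using Suc.prems A(2) by simp
  qed
  define k where "k = arg_min_on f (S - A)"
  have k: "k \<in> S - A" "\<And>l. l \<in> S - A \<Longrightarrow> f k \<le> f l"
    using arg_min_if_finite(1)[OF fin(2) ne, of f] arg_min_least[OF fin(2) ne, of _ f] by (auto simp: k_def)
  show ?case
    using A k fin by (intro exI[of _ "insert k A"]) auto
qed auto

lemma bfactor_linear:
  "bfactor a w = (w - a) * (- (if a = 0 then -1 else cnj a / of_real (norm a)) / (1 - cnj a * w))"
  by (simp add: bfactor_def divide_inverse algebra_simps)

text \<open>Used only for at most \<open>N\<close> factors, or for \<open>N = 0\<close>, where the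
  base of the power is 1.\<close>

lemma bprod_division_crude:
  assumes "finite S" "\<forall>l\<in>S. norm (z l) < 1" "g holomorphic_on disc" "deriv_bounded N K (\<lambda>w. g w * bprod z S w)"
  shows "deriv_bounded N ((2 * real N + 1) ^ card S * K) g"
  using assms
proof (induction S arbitrary: g rule: finite_induct)
  case (insert l S)
  have "deriv_bounded N K (\<lambda>w. (g w * bfactor (z l) w) * bprod z S w)"
    using insert.prems(3) insert.hyps by (simp add: bprod_def mult.assoc)
  moreover have "(\<lambda>w. g w * bfactor (z l) w) holomorphic_on disc"
    using insert.prems by (intro holomorphic_intros bfactor_holo) auto
  ultimately have "deriv_bounded N ((2 * real N + 1) ^ card S * K) (\<lambda>w. g w * bfactor (z l) w)"
    using insert.IH[of "\<lambda>w. g w * bfactor (z l) w"] insert.prems by simp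
  then have "deriv_bounded N ((2 * real N + 1) * ((2 * real N + 1) ^ card S * K)) g"
    using insert.prems by (intro bfactor_division) auto
  then show ?case using insert.hyps by (simp add: mult.assoc)
qed (simp add: bprod_def)

lemma linear_quotient_prod:
  assumes "finite A" "card A \<le> N" "\<forall>a\<in>A. norm (z a) < 1" "\<Phi> holomorphic_on disc"
    "deriv_bounded N K (\<lambda>w. (\<Prod>a\<in>A. w - z a) * \<Phi> w)"
  shows "deriv_bounded (N - card A) K \<Phi>"
  using assms
proof (induction A arbitrary: \<Phi> rule: finite_induct)
  case (insert l A)
  have h: "(\<lambda>w. (w - z l) * \<Phi> w) holomorphic_on disc"
    using insert.prems by (intro holomorphic_intros) auto
  have "deriv_bounded N K (\<lambda>w. (\<Prod>a\<in>A. w - z a) * ((w - z l) * \<Phi> w))"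
    using insert.prems(4) insert.hyps by (simp add: mult.assoc mult.left_commute)
  then have "deriv_bounded (N - card A) K (\<lambda>w. (w - z l) * \<Phi> w)"
    using insert.IH[OF _ _ h] insert.prems insert.hyps by simp
  moreover have "N - card A = Suc (N - card (insert l A))"
    using insert.prems(1) insert.hyps by simp
  ultimately have "deriv_bounded (Suc (N - card (insert l A))) K (\<lambda>w. (w - z l) * \<Phi> w)"
    by simp
  then show ?case by (rule linear_quotient(1)[OF insert.prems(3)]) (use insert.prems in simp)
qed simp

lemma leibniz_scaled:
  assumes "f holomorphic_on X" "g holomorphic_on X" "open X" "w \<in> X" "0 < \<rho>"
    and "\<And>i. i \<le> N \<Longrightarrow> norm ((deriv ^^ i) f w) \<le> F * \<rho> ^ (N - i)"
    and "\<And>i. i \<le> N \<Longrightarrow> norm ((deriv ^^ i) g w) \<le> G / \<rho> ^ i"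
  shows "norm ((deriv ^^ N) (\<lambda>w. f w * g w) w) \<le> 2 ^ N * (F * G)"
proof -
  have "norm ((deriv ^^ N) (\<lambda>w. f w * g w) w) \<le> (\<Sum>i=0..N. real (N choose i) * ((F * \<rho> ^ (N - i)) * (G / \<rho> ^ (N - i))))"
    by (rule leibniz_bound[OF assms(1-4,6,7)])
  also have "\<dots> = (\<Sum>i\<le>N. real (N choose i) * (F * G))"
    using assms(5) by (intro sum.cong) auto
  also have "\<dots> = 2 ^ N * (F * G)"
    by (simp add: sum_distrib_right[symmetric] choose_row_sum flip: of_nat_sum)
  finally show ?thesis .
qed

lemma cnj_le_near:
  assumes "norm a < 1" "norm (a - z0) \<le> \<rho>" "1 - norm a \<le> 2 * \<rho>" "norm (w - z0) < \<rho>"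
  shows "norm (1 - cnj a * w) \<le> 6 * \<rho>"
proof -
  have "norm (w - a) \<le> norm (w - z0) + norm (a - z0)"
    using norm_triangle_ineq4[of "w - z0" "a - z0"] by simp
  then have "norm (w - a) \<le> 2 * \<rho>" using assms by linarith
  moreover have "norm (1 - cnj a * w) \<le> 2 * (1 - norm a) + norm (w - a)"
    using cnj_le_dist[of a w] assms(1) by simp
  ultimately show ?thesis using assms(3) by argo
qed

text \<open>The point is a constant independent of \<open>S\<close>. The \<open>N\<close> zeros
  nearest to \<open>z0\<close> make \<open>g * bprod z T\<close>, with \<open>T\<close> the other
  zeros, of size \<open>\<rho> ^ N\<close> at scale \<rho>, the distance of the farthest of them.
  The inverse of \<open>bprod z T\<close> costs \<open>1 / \<rho>\<close> per derivative, and
  Leibniz' rule balances the two.\<close>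

lemma blaschke_division:
  assumes mass: "mass_const z A" and z: "\<And>l. norm (z l) < 1"
  shows "\<exists>C\<ge>0. \<forall>S g K. finite S \<longrightarrow> g holomorphic_on disc \<longrightarrow> deriv_bounded N K (\<lambda>w. g w * bprod z S w) \<longrightarrow> 
    deriv_bounded N (C * K) g"
proof -
  define M where "M = 6 ^ N * (2 * real N + 1) ^ N"
  define C1 where "C1 = fact N * 4 ^ N * exp 1 + (1::real)"
  define C2 where "C2 = fact N * 4 ^ N * exp (9/2 * A)"
  define C where "C = max ((2 * real N + 1) ^ N) (2 ^ N * (C1 * M * C2))"
  have A0: "0 \<le> A" using mass by (simp add: mass_const_def)
  have C0: "0 \<le> C" unfolding C_def by (simp add: le_max_iff_disj)
  have M1: "(2 * real N + 1) ^ N \<le> M" "6 ^ N \<le> M" "0 \<le> M"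
    unfolding M_def by (auto simp: mult_le_cancel_left1 mult_le_cancel_right1 one_le_power)
  have "deriv_bounded N (C * K) g"
    if S: "finite S" and g: "g holomorphic_on disc" and F: "deriv_bounded N K (\<lambda>w. g w * bprod z S w)" for S g K
  proof (cases "card S \<le> N \<or> N = 0")
    case True
    have K: "0 \<le> K" by (rule deriv_bounded_nonneg[OF F])
    have "deriv_bounded N ((2 * real N + 1) ^ card S * K) g"
      by (rule bprod_division_crude[OF S _ g F]) (use z in auto)
    moreover have "(2 * real N + 1) ^ card S \<le> (2 * real N + 1) ^ N"
      using True by (auto intro: power_increasing)
    then have "(2 * real N + 1) ^ card S \<le> C" unfolding C_def by simp
    ultimately show ?thesis using K by (auto elim!: deriv_bounded_mono intro: mult_right_mono)
  next
    case False
    then have N: "N \<le> card S" "0 < N" by auto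
    have K: "0 \<le> K" by (rule deriv_bounded_nonneg[OF F])
    have Sne: "S \<noteq> {}" using False by auto
    \<comment> \<open>Half the least depth: closer to the circle than this, every zero in
      \<open>S\<close> has depth at most twice its distance to \<open>z0\<close>, as
      \<open>mass_const\<close> demands.\<close>
    define \<eta> where "\<eta> = Min ((\<lambda>l. (1 - norm (z l)) / 2) ` S)"
    have \<eta>: "0 < \<eta>" "\<And>l. l \<in> S \<Longrightarrow> 2 * \<eta> \<le> 1 - norm (z l)"
    proof -
      show "0 < \<eta>" unfolding \<eta>_def using S Sne z by (subst Min_gr_iff) auto
      show "2 * \<eta> \<le> 1 - norm (z l)" if "l \<in> S" for l
        using Min_le[of "(\<lambda>l. (1 - norm (z l)) / 2) ` S" "(1 - norm (z l)) / 2"] S that by (simp add: \<eta>_def)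
    qed
    have near: "norm ((deriv ^^ N) g z0) \<le> C * K" if z0: "1 - \<eta> < norm z0" "norm z0 < 1" for z0
    proof -
      obtain D where D: "D \<subseteq> S" "card D = N" "\<forall>a\<in>D. \<forall>l\<in>S - D. norm (z a - z0) \<le> norm (z l - z0)"
        using nearest_subset[OF S N(1), of "\<lambda>l. norm (z l - z0)"] by blast
      have fD: "finite D" "D \<noteq> {}" using D S N by (auto intro: finite_subset)
      define \<rho> where "\<rho> = Max ((\<lambda>l. norm (z l - z0)) ` D)"
      have \<rho>D: "norm (z a - z0) \<le> \<rho>" if "a \<in> D" for a unfolding \<rho>_def using fD that by auto
      have "\<rho> \<in> (\<lambda>l. norm (z l - z0)) ` D" unfolding \<rho>_def using fD by (intro Max_in) auto
      then obtain b where b: "b \<in> D" "\<rho> = norm (z b - z0)" by auto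
      have \<rho>T: "\<rho> \<le> norm (z l - z0)" if "l \<in> S - D" for l using D(3) b that by auto
      have ca: "1 - norm (z a) \<le> 2 * norm (z a - z0)" "\<eta> \<le> norm (z a - z0)" if "a \<in> D" for a
        using \<eta>(2)[of a] D(1) that norm_triangle_ineq2[of z0 "z a"] norm_minus_commute[of z0 "z a"] z0 by (auto simp: subset_iff)
      have \<rho>: "0 < \<rho>" "\<rho> \<le> 2" "1 - norm z0 \<le> \<rho>"
        using ca(2)[OF b(1)] b(2) \<eta>(1) z0 norm_triangle_ineq4[of "z b" z0] z[of b] by linarith+
      define T where "T = S - D"
      have T: "finite T" "\<forall>l\<in>T. norm (z l) < 1" "\<forall>l\<in>T. \<rho> \<le> norm (z l - z0)"
        using S z \<rho>T by (auto simp: T_def)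
      have sum: "(\<Sum>l\<in>T. (1 - norm (z l)) / (norm (z l - z0))\<^sup>2) \<le> A / \<rho>"
        using mass ca(1)[OF b(1)] b(2) T \<rho>(2) z0(2) unfolding mass_const_def by blast
      define G where "G = (\<lambda>w. g w * bprod z T w)"
      have G: "G holomorphic_on disc" unfolding G_def by (intro holomorphic_intros g bprod_holo T)
      have split: "bprod z S w = bprod z D w * bprod z T w" for w
        unfolding bprod_def T_def using prod.subset_diff[OF D(1) S] by (simp add: mult.commute)
      have FG: "deriv_bounded N K (\<lambda>w. G w * bprod z D w)"
        using F unfolding split G_def by (simp add: mult.assoc mult.left_commute mult.commute)
      have GK: "deriv_bounded N (M * K) G"
        using bprod_division_crude[OF fD(1) _ G FG] z D(2) M1(1) K
        by (auto elim!: deriv_bounded_mono intro: mult_right_mono)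
      define v where "v a = - (if z a = 0 then -1 else cnj (z a) / of_real (norm (z a)))" for a
      have v: "norm (v a) = 1" for a by (simp add: v_def norm_divide)
      define \<Phi> where "\<Phi> = (\<lambda>w. G w * (\<Prod>a\<in>D. v a / (1 - cnj (z a) * w)))"
      have nz: "1 - cnj (z a) * w \<noteq> 0" if "norm w < 1" for a w
        using one_minus_cnj_pos(3)[OF z, of w a] that by simp
      have \<Phi>: "\<Phi> holomorphic_on disc"
        unfolding \<Phi>_def using nz by (intro holomorphic_intros G holomorphic_on_prod) auto
      have "(\<Prod>a\<in>D. w - z a) * \<Phi> w = G w * bprod z D w" for w
        unfolding \<Phi>_def bprod_def bfactor_linear v_def prod.distrib by (simp add: mult.left_commute)
      then have "deriv_bounded (N - card D) K \<Phi>"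
        using FG by (intro linear_quotient_prod[OF fD(1) _ _ \<Phi>, of N z]) (use D z in auto)
      then have \<Phi>K: "norm (\<Phi> w) \<le> K" if "norm w < 1" for w
        using deriv_boundedD that D(2) by fastforce
      \<comment> \<open>Removing \<open>N\<close> linear factors uses up all \<open>N\<close>
        derivatives and leaves \<open>\<Phi>\<close> bounded by \<open>K\<close>; what remains are
        \<open>N\<close> denominators, each at most \<open>6 * \<rho>\<close>.\<close>
      have Gs: "norm (G w) \<le> M * K * \<rho> ^ N" if w: "norm w < 1" "norm (w - z0) < \<rho>" for w
      proof -
        have e: "norm (\<Phi> w) = norm (G w) * (\<Prod>a\<in>D. 1 / norm (1 - cnj (z a) * w))"
          unfolding \<Phi>_def by (simp add: norm_mult prod_norm[symmetric] norm_divide v)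
        have "(\<Prod>a\<in>D. norm (1 - cnj (z a) * w)) \<le> (\<Prod>a\<in>D. 6 * \<rho>)"
        proof (intro prod_mono conjI)
          fix a assume a: "a \<in> D"
          show "norm (1 - cnj (z a) * w) \<le> 6 * \<rho>"
            using ca(1)[OF a] \<rho>D[OF a] w(2) by (intro cnj_le_near[OF z]) auto
        qed auto
        also have "\<dots> = 6 ^ N * \<rho> ^ N" using D(2) by (simp add: power_mult_distrib)
        finally have p: "(\<Prod>a\<in>D. norm (1 - cnj (z a) * w)) \<le> 6 ^ N * \<rho> ^ N" .
        have "norm (G w) = norm (\<Phi> w) * (\<Prod>a\<in>D. norm (1 - cnj (z a) * w))"
          unfolding e mult.assoc prod.distrib[symmetric] using nz[OF w(1)] by simp
        also have "\<dots> \<le> K * (6 ^ N * \<rho> ^ N)"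
          using \<Phi>K[OF w(1)] p K by (intro mult_mono prod_nonneg) auto
        also have "\<dots> \<le> K * (M * \<rho> ^ N)"
          using M1 K \<rho>(1) by (intro mult_left_mono mult_right_mono) auto
        finally show ?thesis by (simp add: mult.commute mult.left_commute)
      qed
      define U where "U = ball z0 (\<rho>/4) \<inter> disc"
      have U: "open U" "z0 \<in> U" using \<rho> z0 by (auto simp: U_def)
      have loc: "bprod z T field_differentiable at w" "bprod z T w \<noteq> 0" if "w \<in> U" for w
        using bprod_local(1,2)[OF T(1,2) z0(2) \<rho> T(3) sum, of w] that by (auto simp: U_def dist_norm norm_minus_commute)
      have hi: "(\<lambda>w. inverse (bprod z T w)) holomorphic_on U"
        unfolding holomorphic_on_def
        by (rule ballI, rule field_differentiable_at_within, rule field_differentiable_inverse) (rule loc, assumption)+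
      have hG: "G holomorphic_on U" by (rule holomorphic_on_subset[OF G]) (auto simp: U_def)
      have "(deriv ^^ N) g z0 = (deriv ^^ N) (\<lambda>w. G w * inverse (bprod z T w)) z0"
      proof (rule higher_deriv_transform_within_open[of _ U])
        show "g holomorphic_on U" by (rule holomorphic_on_subset[OF g]) (auto simp: U_def)
        show "(\<lambda>w. G w * inverse (bprod z T w)) holomorphic_on U" by (intro holomorphic_intros hG hi)
        show "g w = G w * inverse (bprod z T w)" if "w \<in> U" for w using loc(2)[OF that] by (simp add: G_def)
      qed (use U in auto)
      also have "norm \<dots> \<le> 2 ^ N * ((C1 * (M * K)) * C2)"
      proof (rule leibniz_scaled[OF hG hi U \<rho>(1)])
        show "norm ((deriv ^^ i) G z0) \<le> C1 * (M * K) * \<rho> ^ (N - i)" if "i \<le> N" for i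
          unfolding C1_def mult.assoc[symmetric]
          using local_derivative_bound[OF GK _ \<rho>(1,2) z0(2) Gs that] K M1 by (simp add: mult.assoc)
        show "norm ((deriv ^^ i) (\<lambda>w. inverse (bprod z T w)) z0) \<le> C2 / \<rho> ^ i" if "i \<le> N" for i
          unfolding C2_def by (rule bprod_deriv_bounds(2)[OF T(1,2) z0(2) \<rho> T(3) sum that])
      qed
      also have "\<dots> = (2 ^ N * (C1 * M * C2)) * K" by simp
      also have "\<dots> \<le> C * K" using K by (intro mult_right_mono) (auto simp: C_def)
      finally show ?thesis .
    qed
    show ?thesis
      unfolding deriv_bounded_def
    proof (intro conjI ballI g)
      fix w :: complex assume "w \<in> disc"
      then show "norm ((deriv ^^ N) g w) \<le> C * K"
      proof (intro max_principle[OF holomorphic_higher_deriv[OF g open_ball]])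
        fix e :: real assume "0 < e"
        then show "\<exists>r<1. \<forall>z. r < norm z \<and> norm z < 1 \<longrightarrow> norm ((deriv ^^ N) g z) \<le> C * K + e"
          using near \<eta>(1) by (intro exI[of _ "1 - \<eta>"]) (auto intro: order_trans[OF near])
      qed auto
    qed
  qed
  with C0 show ?thesis by blast
qed

lemma HinfN_blaschke_divide:
  assumes mass: "mass_const z A" and z: "blaschke_seq z" and f: "f holomorphic_on disc"
    and F: "(\<lambda>w. f w * blaschke z w) \<in> HinfN N"
  shows "f \<in> HinfN N"
proof -
  obtain K where K: "deriv_bounded 0 K (\<lambda>w. f w * blaschke z w)" "deriv_bounded N K (\<lambda>w. f w * blaschke z w)"
    using F HinfN_iff by blast
  obtain C where C: "\<And>S g K. finite S \<Longrightarrow> g holomorphic_on disc \<Longrightarrow> deriv_bounded N K (\<lambda>w. g w * bprod z S w) \<Longrightarrow> 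
    deriv_bounded N (C * K) g"
    using blaschke_division[OF mass blaschke_seqD(1)[OF z], of N] by metis
  have fK: "norm (f w) \<le> K" if "norm w < 1" for w
    by (rule inner_division_blaschke[OF z f _ that, of 1]) (use deriv_boundedD[OF K(1)] in simp)
  have "deriv_bounded N (C * K) f"
  proof (rule deriv_bounded_pointwise_limit[where f = "\<lambda>n w. f w * blaschke (\<lambda>j. z (j + n)) w" and C = K])
    fix n
    show "deriv_bounded N (C * K) (\<lambda>w. f w * blaschke (\<lambda>j. z (j + n)) w)"
    proof (rule C[of "{..<n}"])
      show "(\<lambda>w. f w * blaschke (\<lambda>j. z (j + n)) w) holomorphic_on disc"
        by (intro holomorphic_intros f blaschke_holo blaschke_seqD(3) z)
      have "f w * blaschke (\<lambda>j. z (j + n)) w * bprod z {..<n} w = f w * blaschke z w" if "norm w < 1" for w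
        by (simp add: blaschke_split[OF z that, of n])
      then show "deriv_bounded N K (\<lambda>w. f w * blaschke (\<lambda>j. z (j + n)) w * bprod z {..<n} w)"
        using K(2) by (subst deriv_bounded_cong) auto
    qed simp
    fix w :: complex assume w: "norm w < 1"
    have "norm (f w) * norm (blaschke (\<lambda>j. z (j + n)) w) \<le> norm (f w) * 1"
      by (intro mult_left_mono norm_blaschke_le_1 blaschke_seqD(3) z w) auto
    with fK[OF w] show "norm (f w * blaschke (\<lambda>j. z (j + n)) w) \<le> K" by (simp add: norm_mult)
  next
    fix w :: complex assume w: "norm w < 1"
    have "(\<lambda>n. f w * blaschke (\<lambda>j. z (j + n)) w) \<longlonglongrightarrow> f w * 1"
      by (intro tendsto_intros blaschke_tail_LIMSEQ z w)
    then show "(\<lambda>n. f w * blaschke (\<lambda>j. z (j + n)) w) \<longlonglongrightarrow> f w" by simp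
  qed
  then show ?thesis by (rule HinfN_from)
qed

text \<open>The counterpart of \<open>blaschke_division\<close> for multiplication. Only the nearest
  zero is singled out: the size condition at it makes \<open>f\<close> of order
  \<open>\<rho> ^ N\<close> at scale \<rho>, which compensates the derivatives of the whole
  product.\<close>

lemma HinfN_small_mult:
  assumes mass: "mass_const z A" and z: "blaschke_seq z" and f: "deriv_bounded N K f"
    and small: "\<And>j w. norm w < 1 \<Longrightarrow> norm (f w) \<le> K * norm (1 - cnj (z j) * w) ^ N"
  shows "(\<lambda>w. f w * blaschke z w ^ m) \<in> HinfN N"
proof -
  note z1 = blaschke_seqD(1)[OF z]
  have K: "0 \<le> K" by (rule deriv_bounded_nonneg[OF f])
  have hf: "f holomorphic_on disc" by (rule deriv_bounded_holo[OF f])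
  define C1 where "C1 = fact N * 4 ^ N * exp 1 + (1::real)"
  define C2 where "C2 = fact N * 4 ^ N * exp (9/2 * A) ^ m"
  define C where "C = 2 ^ N * ((C1 * (6 ^ N * K)) * C2)"
  \<comment> \<open>\<open>Suc L\<close> keeps the index set nonempty, so that a nearest zero
    exists.\<close>
  have L: "deriv_bounded N C (\<lambda>w. f w * bprod z {..<Suc L} w ^ m)" for L
  proof -
    define S where "S = {..<Suc L}"
    have S: "finite S" "S \<noteq> {}" "\<forall>l\<in>S. norm (z l) < 1" using z1 by (auto simp: S_def)
    define \<eta> where "\<eta> = Min ((\<lambda>l. (1 - norm (z l)) / 2) ` S)"
    have \<eta>: "0 < \<eta>" "\<And>l. l \<in> S \<Longrightarrow> 2 * \<eta> \<le> 1 - norm (z l)"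
    proof -
      show "0 < \<eta>" unfolding \<eta>_def using S z1 by (subst Min_gr_iff) auto
      show "2 * \<eta> \<le> 1 - norm (z l)" if "l \<in> S" for l
        using Min_le[of "(\<lambda>l. (1 - norm (z l)) / 2) ` S" "(1 - norm (z l)) / 2"] S that by (simp add: \<eta>_def)
    qed
    have h: "(\<lambda>w. f w * bprod z S w ^ m) holomorphic_on disc"
      by (intro holomorphic_intros hf bprod_holo S)
    have near: "norm ((deriv ^^ N) (\<lambda>w. f w * bprod z S w ^ m) z0) \<le> C" if z0: "1 - \<eta> < norm z0" "norm z0 < 1" for z0
    proof -
      obtain D where D: "D \<subseteq> S" "card D = 1" "\<forall>a\<in>D. \<forall>l\<in>S - D. norm (z a - z0) \<le> norm (z l - z0)"
        using nearest_subset[OF S(1), of 1 "\<lambda>l. norm (z l - z0)"] S by (auto simp: Suc_le_eq card_gt_0_iff)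
      then obtain j where j: "D = {j}" using card_1_singletonE by blast
      define \<rho> where "\<rho> = norm (z j - z0)"
      have jS: "j \<in> S" using D j by auto
      have far: "\<forall>l\<in>S. \<rho> \<le> norm (z l - z0)" using D(3) j by (auto simp: \<rho>_def)
      have cj: "1 - norm (z j) \<le> 2 * \<rho>" "\<eta> \<le> \<rho>"
        using \<eta>(2)[OF jS] norm_triangle_ineq2[of z0 "z j"] norm_minus_commute[of z0 "z j"] z0 by (auto simp: \<rho>_def)
      have \<rho>: "0 < \<rho>" "\<rho> \<le> 2" "1 - norm z0 \<le> \<rho>"
        using cj(2) \<eta>(1) z0 norm_triangle_ineq4[of "z j" z0] z1[of j] unfolding \<rho>_def by linarith+
      have sum: "(\<Sum>l\<in>S. (1 - norm (z l)) / (norm (z l - z0))\<^sup>2) \<le> A / \<rho>"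
        using mass cj(1) S far \<rho>(2) z0(2) \<rho>_def unfolding mass_const_def by blast
      have fs: "norm (f w) \<le> 6 ^ N * K * \<rho> ^ N" if w: "norm w < 1" "norm (w - z0) < \<rho>" for w
      proof -
        have "norm (1 - cnj (z j) * w) ^ N \<le> (6 * \<rho>) ^ N"
          using cj(1) w(2) by (intro power_mono cnj_le_near[OF z1]) (auto simp: \<rho>_def)
        then have "K * norm (1 - cnj (z j) * w) ^ N \<le> K * (6 * \<rho>) ^ N" using K by (rule mult_left_mono)
        then show ?thesis using small[OF w(1), of j] by (simp add: power_mult_distrib mult.commute mult.left_commute)
      qed
      have K6: "0 \<le> 6 ^ N * K" using K by simp
      have "1 * K \<le> 6 ^ N * K" using K by (intro mult_right_mono) auto
      then have f6: "deriv_bounded N (6 ^ N * K) f" using deriv_bounded_mono[OF f] by simp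
      define U where "U = ball z0 (\<rho>/4) \<inter> disc"
      have U: "open U" "z0 \<in> U" using \<rho> z0 by (auto simp: U_def)
      have hU: "f holomorphic_on U" "(\<lambda>w. bprod z S w ^ m) holomorphic_on U"
      proof -
        show "f holomorphic_on U" by (rule holomorphic_on_subset[OF hf]) (auto simp: U_def)
        have "bprod z S holomorphic_on U" by (rule holomorphic_on_subset[OF bprod_holo(1)[OF S(3)]]) (auto simp: U_def)
        then show "(\<lambda>w. bprod z S w ^ m) holomorphic_on U" by (intro holomorphic_intros)
      qed
      show ?thesis
        unfolding C_def
      proof (rule leibniz_scaled[OF hU U \<rho>(1)])
        show "norm ((deriv ^^ i) f z0) \<le> C1 * (6 ^ N * K) * \<rho> ^ (N - i)" if "i \<le> N" for i
          unfolding C1_def by (rule local_derivative_bound[OF f6 K6 \<rho>(1,2) z0(2) fs that])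
        show "norm ((deriv ^^ i) (\<lambda>w. bprod z S w ^ m) z0) \<le> C2 / \<rho> ^ i" if "i \<le> N" for i
          unfolding C2_def by (rule bprod_deriv_bounds(1)[OF S(1,3) z0(2) \<rho> far sum that])
      qed
    qed
    show ?thesis
      unfolding deriv_bounded_def S_def[symmetric]
    proof (intro conjI ballI h)
      fix w :: complex assume "w \<in> disc"
      then show "norm ((deriv ^^ N) (\<lambda>w. f w * bprod z S w ^ m) w) \<le> C"
      proof (intro max_principle[OF holomorphic_higher_deriv[OF h open_ball]])
        fix e :: real assume "0 < e"
        then show "\<exists>r<1. \<forall>z'. r < norm z' \<and> norm z' < 1 \<longrightarrow> norm ((deriv ^^ N) (\<lambda>w. f w * bprod z S w ^ m) z') \<le> C + e"
          using near \<eta>(1) by (intro exI[of _ "1 - \<eta>"]) (auto intro: order_trans[OF near])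
      qed auto
    qed
  qed
  obtain K0 where K0: "deriv_bounded 0 K0 f"
    using f HinfN_iff' HinfN_iff by blast
  have "deriv_bounded N C (\<lambda>w. f w * blaschke z w ^ m)"
  proof (rule deriv_bounded_pointwise_limit[OF L, where C = K0])
    fix n and w :: complex assume w: "norm w < 1"
    have "norm (bprod z {..<Suc n} w) \<le> 1" using z1 w by (intro norm_bprod_le_1) auto
    then have "norm (f w) * norm (bprod z {..<Suc n} w) ^ m \<le> norm (f w) * 1"
      by (intro mult_left_mono power_le_one) auto
    then show "norm (f w * bprod z {..<Suc n} w ^ m) \<le> K0"
      using deriv_boundedD[OF K0 w] by (simp add: norm_mult norm_power)
  next
    fix w :: complex assume w: "norm w < 1"
    show "(\<lambda>n. f w * bprod z {..<Suc n} w ^ m) \<longlonglongrightarrow> f w * blaschke z w ^ m"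
      by (intro tendsto_intros LIMSEQ_Suc[OF bprod_LIMSEQ[OF z w]])
  qed
  then show ?thesis by (rule HinfN_from)
qed

section \<open>Decay of a function forced by the zeros of its product with a power of B\<close>

lemma blaschke_zero_factor:
  assumes z: "blaschke_seq z"
  obtains H where "H holomorphic_on disc" "\<And>w. norm w < 1 \<Longrightarrow> blaschke z w = (w - z j) * H w"
proof
  define H where "H = (\<lambda>w. (- (if z j = 0 then -1 else cnj (z j) / of_real (norm (z j))) / (1 - cnj (z j) * w))
     * bprod z {..<j} w * blaschke (\<lambda>k. z (k + Suc j)) w)"
  show "H holomorphic_on disc"
    unfolding H_def using blaschke_seqD(1)[OF z] one_minus_cnj_pos(3)[OF blaschke_seqD(1)[OF z], of _ j]
    by (intro holomorphic_intros bprod_holo blaschke_holo blaschke_seqD(3) z) auto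
  show "blaschke z w = (w - z j) * H w" if "norm w < 1" for w
    unfolding blaschke_split[OF z that, of "Suc j"] H_def
    by (simp add: bprod_def bfactor_linear[of "z j"])
qed

lemma blaschke_two_zeros_factor:
  assumes z: "blaschke_seq z" and jl: "j < l"
  obtains H where "H holomorphic_on disc" "\<And>w. norm w < 1 \<Longrightarrow> blaschke z w = (w - z j) * (w - z l) * H w"
proof -
  obtain H where H: "H holomorphic_on disc" 
    "\<And>w. norm w < 1 \<Longrightarrow> blaschke (\<lambda>k. z (k + Suc j)) w = (w - z l) * H w"
    using blaschke_zero_factor[OF blaschke_seqD(3)[OF z, of "Suc j"], of "l - Suc j"] jl by auto
  define G where "G = (\<lambda>w. (- (if z j = 0 then -1 else cnj (z j) / of_real (norm (z j))) / (1 - cnj (z j) * w))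
     * bprod z {..<j} w * H w)"
  show thesis
  proof (rule that[of G])
    show "G holomorphic_on disc"
      unfolding G_def using blaschke_seqD(1)[OF z] one_minus_cnj_pos(3)[OF blaschke_seqD(1)[OF z], of _ j]
      by (intro holomorphic_intros bprod_holo H) auto
    show "blaschke z w = (w - z j) * (w - z l) * G w" if "norm w < 1" for w
      unfolding blaschke_split[OF z that, of "Suc j"] G_def
      by (simp add: bprod_def bfactor_linear[of "z j"] H(2)[OF that] del: add_Suc_right)
  qed
qed

text \<open>The zeros \<open>x i\<close> are indexed by numbers so as to count multiplicity.
  Removing \<open>N\<close> of them leaves a bounded \<open>\<Phi>\<close>. The power of
  \<open>B\<close> is then divided out of \<open>f / (1 - cnj a * w) ^ N\<close>, whose denominator
  is zero-free, so that the decay survives.\<close>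

lemma zeros_bound:
  assumes z: "blaschke_seq z" and f: "f holomorphic_on disc"
    and F: "deriv_bounded N K (\<lambda>w. f w * blaschke z w ^ m)"
    and a: "norm a < 1" "\<And>i. norm (x i) < 1"
    and \<Phi>: "\<Phi> holomorphic_on disc" "\<And>w. norm w < 1 \<Longrightarrow> f w * blaschke z w ^ m = (\<Prod>i<N. w - x i) * \<Phi> w"
    and c: "\<And>i w. norm w < 1 \<Longrightarrow> norm (w - x i) \<le> C * norm (1 - cnj a * w)" "0 \<le> C"
    and w: "norm w < 1"
  shows "norm (f w) \<le> K * C ^ N * norm (1 - cnj a * w) ^ N"
proof -
  have K: "0 \<le> K" by (rule deriv_bounded_nonneg[OF F])
  have "deriv_bounded N K (\<lambda>w. (\<Prod>i<N. w - x i) * \<Phi> w)"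
    using F \<Phi>(2) by (subst deriv_bounded_cong[of _ "\<lambda>w. f w * blaschke z w ^ m"]) auto
  then have "deriv_bounded (N - card {..<N}) K \<Phi>"
    by (intro linear_quotient_prod[OF _ _ _ \<Phi>(1), of "{..<N}" N x]) (use a in auto)
  then have \<Phi>K: "norm (\<Phi> w) \<le> K" if "norm w < 1" for w
    using deriv_boundedD[of 0 K \<Phi> w] that by simp
  have nz: "1 - cnj a * w \<noteq> 0" if "norm w < 1" for w using one_minus_cnj_pos(3)[OF a(1), of w] that by simp
  have "norm (f w / (1 - cnj a * w) ^ N) \<le> K * C ^ N"
  proof (rule inner_division_blaschke[OF z _ _ w, of _ m])
    show "(\<lambda>w. f w / (1 - cnj a * w) ^ N) holomorphic_on disc"
      using nz by (intro holomorphic_intros f) auto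
    show "norm (f w / (1 - cnj a * w) ^ N * blaschke z w ^ m) \<le> K * C ^ N" if w: "norm w < 1" for w
    proof -
      have "norm (f w * blaschke z w ^ m) = norm (\<Phi> w) * (\<Prod>i<N. norm (w - x i))"
        unfolding \<Phi>(2)[OF w] by (simp add: norm_mult prod_norm)
      also have "\<dots> \<le> K * (\<Prod>i<N. C * norm (1 - cnj a * w))"
        using \<Phi>K[OF w] c(1)[OF w] K by (intro mult_mono prod_mono prod_nonneg) auto
      also have "\<dots> = K * C ^ N * norm (1 - cnj a * w) ^ N" by (simp add: power_mult_distrib)
      finally have "norm (f w * blaschke z w ^ m) \<le> K * C ^ N * norm (1 - cnj a * w) ^ N" .
      moreover have "norm (f w / (1 - cnj a * w) ^ N * blaschke z w ^ m) = norm (f w * blaschke z w ^ m) / norm (1 - cnj a * w) ^ N"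
        by (simp add: norm_mult norm_divide norm_power)
      ultimately show ?thesis using nz[OF w] by (simp add: divide_le_eq)
    qed
  qed
  then show ?thesis using nz[OF w] by (simp add: norm_divide norm_power divide_le_eq)
qed

text \<open>Evaluated at \<open>w = z j\<close>, this replaces a computation of the
  \<open>N\<close>-th derivative there: a value of \<open>f\<close> much larger than
  \<open>(1 - norm (z j)) ^ N\<close> forces a large constant \<open>K\<close>.\<close>

lemma one_zero_bound:
  assumes z: "blaschke_seq z" and f: "f holomorphic_on disc"
    and F: "deriv_bounded N K (\<lambda>w. f w * blaschke z w ^ N)" and w: "norm w < 1"
  shows "norm (f w) \<le> K * norm (1 - cnj (z j) * w) ^ N"
proof -
  obtain H where H: "H holomorphic_on disc" "\<And>w. norm w < 1 \<Longrightarrow> blaschke z w = (w - z j) * H w"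
    using blaschke_zero_factor[OF z] by blast
  note z1 = blaschke_seqD(1)[OF z]
  have "norm (f w) \<le> K * 1 ^ N * norm (1 - cnj (z j) * w) ^ N"
  proof (rule zeros_bound[OF z f F z1, where x = "\<lambda>_. z j" and \<Phi> = "\<lambda>w. f w * H w ^ N"])
    show "(\<lambda>w. f w * H w ^ N) holomorphic_on disc" by (intro holomorphic_intros f H)
    show "norm (w - z j) \<le> 1 * norm (1 - cnj (z j) * w)" if "norm w < 1" for w
      using dist_le_cnj[of "z j" w] z1[of j] that by (simp add: norm_minus_commute)
  qed (use z1 w H(2) in \<open>auto simp: power_mult_distrib\<close>)
  then show ?thesis by simp
qed

lemma two_zeros_bound:
  assumes z: "blaschke_seq z" and f: "f holomorphic_on disc" and n: "1 \<le> n"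
    and F: "deriv_bounded (n + 1) K (\<lambda>w. f w * blaschke z w ^ n)" and w: "norm w < 1"
    and l: "l \<noteq> j" "norm (z l - z j) \<le> A * (1 - norm (z j))" and A: "0 \<le> A"
  shows "norm (f w) \<le> K * (1 + A) ^ (n + 1) * norm (1 - cnj (z j) * w) ^ (n + 1)"
proof -
  obtain H where H: "H holomorphic_on disc" "\<And>w. norm w < 1 \<Longrightarrow> blaschke z w = (w - z j) * (w - z l) * H w"
  proof (cases "j < l")
    case True
    show ?thesis by (rule blaschke_two_zeros_factor[OF z True]) (rule that)
  next
    case False
    then have "l < j" using l by simp
    then obtain H where H: "H holomorphic_on disc" "\<And>w. norm w < 1 \<Longrightarrow> blaschke z w = (w - z l) * (w - z j) * H w"
      using blaschke_two_zeros_factor[OF z, of l j] by metis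
    show ?thesis by (rule that[OF H(1)]) (simp add: H(2))
  qed
  note z1 = blaschke_seqD(1)[OF z]
  \<comment> \<open>The \<open>n + 1\<close> factors are \<open>n\<close> copies of
    \<open>z j\<close> and one of \<open>z l\<close>; the other \<open>n - 1\<close> copies of
    \<open>z l\<close> go into \<open>\<Phi>\<close>, which is where \<open>1 \<le> n\<close>
    enters.\<close>
  define x where "x i = (if i = n then z l else z j)" for i :: nat
  define \<Phi> where "\<Phi> = (\<lambda>w. f w * (w - z l) ^ (n - 1) * H w ^ n)"
  show ?thesis
  proof (rule zeros_bound[OF z f F z1, where x = x and \<Phi> = \<Phi>])
    show "\<Phi> holomorphic_on disc" unfolding \<Phi>_def by (intro holomorphic_intros f H)
    show "f w * blaschke z w ^ n = (\<Prod>i<n + 1. w - x i) * \<Phi> w" if "norm w < 1" for w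
    proof -
      have "(\<Prod>i<n + 1. w - x i) = (w - z j) ^ n * (w - z l)" by (simp add: x_def)
      moreover have "(w - z l) ^ n = (w - z l) * (w - z l) ^ (n - 1)"
        using n by (metis Suc_diff_le diff_Suc_1 le_add_diff_inverse plus_1_eq_Suc power_Suc)
      ultimately show ?thesis by (simp add: \<Phi>_def H(2)[OF that] power_mult_distrib)
    qed
    show "norm (w - x i) \<le> (1 + A) * norm (1 - cnj (z j) * w)" if w: "norm w < 1" for i w
    proof -
      define y where "y = norm (1 - cnj (z j) * w)"
      have y: "1 - norm (z j) \<le> y" "norm (w - z j) \<le> y"
        using dist_le_cnj[of "z j" w] one_minus_cnj_pos(2)[OF z1, of w j] z1[of j] w
        by (auto simp: y_def norm_minus_commute)
      have "A * (1 - norm (z j)) \<le> A * y" using y A by (intro mult_left_mono) auto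
      then have "norm (w - z l) \<le> y + A * y"
        using y(2) l(2) norm_triangle_ineq4[of "w - z j" "z l - z j"] by simp
      moreover have "norm (w - z j) \<le> y + A * y"
        using y(2) mult_nonneg_nonneg[OF A order_trans[OF norm_ge_zero y(2)]] by linarith
      ultimately have "norm (w - x i) \<le> y + A * y" by (simp add: x_def)
      also have "\<dots> = (1 + A) * y" by (simp add: algebra_simps)
      finally show ?thesis by (simp only: y_def)
    qed
  qed (use z1 w A in \<open>auto simp: x_def\<close>)
qed

section \<open>Poisson-type kernels with dyadic poles\<close>

text \<open>Herglotz kernel; for a pole outside the closed disc its real part is a positive,
  Poisson-type kernel on the disc.\<close>

definition kern :: "complex \<Rightarrow> complex \<Rightarrow> complex" where
  "kern \<xi> z = (\<xi> + z) / (\<xi> - z)"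

definition dyadic_root :: "nat \<Rightarrow> nat \<Rightarrow> complex" where
  "dyadic_root s k = cis (2 * pi * real k / 2 ^ s)"

text \<open>The poles of scale \<open>s\<close> lie \<open>1 / 2 ^ s\<close> outside the circle, so
  finite sums of kernels are holomorphic on a neighbourhood of the closed disc.\<close>

definition pole :: "nat \<Rightarrow> nat \<Rightarrow> complex" where
  "pole s k = of_real (1 + 1 / 2 ^ s) * dyadic_root s k"

text \<open>With the weight \<open>1 / 2 ^ s\<close> each scale contributes a bounded amount. For
  the index sets \<open>J\<close> used below, the contribution is also bounded below at circle
  points within \<open>1 / 2 ^ s\<close> of the target set.\<close>

definition barrier :: "nat set \<Rightarrow> (nat \<Rightarrow> nat set) \<Rightarrow> complex \<Rightarrow> complex" where
  "barrier S J z = (\<Sum>s\<in>S. \<Sum>k\<in>J s. of_real (1 / 2 ^ s) * kern (pole s k) z)"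

lemma Re_kern: 
  assumes "\<xi> \<noteq> z"
  shows "Re (kern \<xi> z) = ((norm \<xi>)\<^sup>2 - (norm z)\<^sup>2) / (norm (\<xi> - z))\<^sup>2"
proof -
  have "kern \<xi> z = (\<xi> + z) * cnj (\<xi> - z) / of_real ((norm (\<xi> - z))\<^sup>2)"
    unfolding kern_def by (simp add: complex_div_cnj[of _ "\<xi> - z"])
  moreover have "Re ((\<xi> + z) * cnj (\<xi> - z)) = (norm \<xi>)\<^sup>2 - (norm z)\<^sup>2"
    unfolding cmod_power2 by (simp add: algebra_simps power2_eq_square)
  ultimately show ?thesis by (simp only: Re_divide_of_real)
qed

lemma norm_dyadic_root [simp]: "norm (dyadic_root s k) = 1"
  by (simp add: dyadic_root_def)

lemma norm_pole: "norm (pole s k) = 1 + 1 / 2 ^ s"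
proof -
  have "norm (pole s k) = \<bar>1 + 1 / 2 ^ s\<bar>"
    unfolding pole_def norm_mult norm_of_real by simp
  then show ?thesis by simp
qed

lemma pole_minus_root: "norm (pole s k - dyadic_root s k) = 1 / 2 ^ s"
proof -
  have "pole s k - dyadic_root s k = of_real (1 / 2 ^ s) * dyadic_root s k"
    by (simp add: pole_def algebra_simps)
  then show ?thesis by (simp add: norm_mult norm_divide norm_power)
qed

lemma pole_distance:
  assumes "norm z \<le> 1"
  shows "1 / 2 ^ s \<le> norm (pole s k - z)" "pole s k \<noteq> z"
proof -
  show "1 / 2 ^ s \<le> norm (pole s k - z)"
    using norm_triangle_ineq2[of "pole s k" z] assms norm_pole[of s k] by linarith
  then have "0 < norm (pole s k - z)" by (rule less_le_trans[rotated]) simp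
  then show "pole s k \<noteq> z" by simp
qed

lemma Re_kern_pole_pos:
  assumes "norm z \<le> 1"
  shows "0 < Re (kern (pole s k) z)"
proof -
  have "norm z < norm (pole s k)"
    unfolding norm_pole using assms by (simp add: add.commute less_add_same_cancel2 le_less_trans)
  then have "(norm z)\<^sup>2 < (norm (pole s k))\<^sup>2" by (intro power_strict_mono) auto
  then show ?thesis
    unfolding Re_kern[OF pole_distance(2)[OF assms]] using pole_distance(2)[OF assms, of s k] by simp
qed

lemma dyadic_root_Suc:
  "dyadic_root (Suc s) (k + 2 ^ s) = - dyadic_root (Suc s) k" "(dyadic_root (Suc s) k)\<^sup>2 = dyadic_root s k"
proof -
  have "2 * pi * real (k + 2 ^ s) / 2 ^ Suc s = 2 * pi * real k / 2 ^ Suc s + pi"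
    by (simp add: field_simps)
  then show "dyadic_root (Suc s) (k + 2 ^ s) = - dyadic_root (Suc s) k"
    unfolding dyadic_root_def by (metis cis_mult cis_pi mult_minus1_right)
  have "(dyadic_root (Suc s) k)\<^sup>2 = cis (real 2 * (2 * pi * real k / 2 ^ Suc s))"
    unfolding dyadic_root_def by (rule Complex.DeMoivre)
  also have "real 2 * (2 * pi * real k / 2 ^ Suc s) = 2 * pi * real k / 2 ^ s" by simp
  finally show "(dyadic_root (Suc s) k)\<^sup>2 = dyadic_root s k" by (simp add: dyadic_root_def)
qed

lemma kern_pair:
  assumes "\<xi> \<noteq> z" "\<xi> \<noteq> - z"
  shows "kern \<xi> z + kern (- \<xi>) z = 2 * kern (\<xi>\<^sup>2) (z\<^sup>2)"
proof -
  have nz: "\<xi> - z \<noteq> 0" "\<xi> + z \<noteq> 0" using assms by (auto simp: eq_neg_iff_add_eq_0)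
  have "- \<xi> - z = - (\<xi> + z)" "- \<xi> + z = - (\<xi> - z)" by simp_all
  then have "kern (- \<xi>) z = (\<xi> - z) / (\<xi> + z)" unfolding kern_def by (metis minus_divide_divide)
  then have "kern \<xi> z + kern (- \<xi>) z = ((\<xi> + z) * (\<xi> + z) + (\<xi> - z) * (\<xi> - z)) / ((\<xi> - z) * (\<xi> + z))"
    unfolding kern_def using nz by (simp add: add_frac_eq)
  also have "(\<xi> + z) * (\<xi> + z) + (\<xi> - z) * (\<xi> - z) = 2 * (\<xi>\<^sup>2 + z\<^sup>2)"
    by (simp add: power2_eq_square algebra_simps)
  also have "(\<xi> - z) * (\<xi> + z) = \<xi>\<^sup>2 - z\<^sup>2" by (simp add: power2_eq_square algebra_simps)
  finally show ?thesis by (simp add: kern_def)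
qed

text \<open>Induction by pairing a root with its antipode: the two kernels add up to twice the
  kernel of the squares, and squaring sends roots of scale \<open>Suc s\<close> to roots of scale
  \<open>s\<close>.\<close>

lemma kern_root_sum:
  assumes "1 < R" "norm z \<le> 1"
  shows "(\<Sum>k<2 ^ s. kern (of_real R * dyadic_root s k) z) = 2 ^ s * kern (of_real R ^ 2 ^ s) (z ^ 2 ^ s)"
  using assms
proof (induction s arbitrary: R z)
  case 0
  then show ?case by (simp add: dyadic_root_def)
next
  case (Suc s)
  define f where "f k = kern (of_real R * dyadic_root (Suc s) k) z" for k
  have "{..<2 ^ Suc s} = {..<2 ^ s + 2 ^ s :: nat}" by (simp add: mult_2)
  then have "(\<Sum>k<2 ^ Suc s. f k) = (\<Sum>k<2 ^ s. f k) + (\<Sum>k=2 ^ s..<2 ^ s + 2 ^ s. f k)"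
    by (simp only: lessThan_atLeast0) (rule sum.atLeastLessThan_concat[symmetric], auto)
  also have "(\<Sum>k=2 ^ s..<2 ^ s + 2 ^ s. f k) = (\<Sum>k<2 ^ s. f (k + 2 ^ s))"
    using sum.shift_bounds_nat_ivl[of f 0 "2 ^ s" "2 ^ s"] by (simp add: lessThan_atLeast0)
  also have "(\<Sum>k<2 ^ s. f k) + (\<Sum>k<2 ^ s. f (k + 2 ^ s)) = (\<Sum>k<2 ^ s. 2 * kern (of_real (R\<^sup>2) * dyadic_root s k) (z\<^sup>2))"
    unfolding sum.distrib[symmetric]
  proof (rule sum.cong[OF refl])
    fix k
    define \<xi> where "\<xi> = of_real R * dyadic_root (Suc s) k"
    have n: "norm \<xi> = R" using Suc.prems(1) by (simp add: \<xi>_def norm_mult)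
    have "f k + f (k + 2 ^ s) = kern \<xi> z + kern (- \<xi>) z"
      by (simp add: f_def \<xi>_def dyadic_root_Suc)
    also have "\<dots> = 2 * kern (\<xi>\<^sup>2) (z\<^sup>2)"
      by (rule kern_pair) (use n Suc.prems in auto)
    also have "\<xi>\<^sup>2 = of_real (R\<^sup>2) * dyadic_root s k"
      by (simp add: \<xi>_def power_mult_distrib dyadic_root_Suc)
    finally show "f k + f (k + 2 ^ s) = 2 * kern (of_real (R\<^sup>2) * dyadic_root s k) (z\<^sup>2)" .
  qed
  also have "\<dots> = 2 * (2 ^ s * kern (of_real (R\<^sup>2) ^ 2 ^ s) ((z\<^sup>2) ^ 2 ^ s))"
    unfolding sum_distrib_left[symmetric]
    by (subst Suc.IH) (use Suc.prems in \<open>auto simp: norm_power power_le_one one_less_power\<close>)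
  finally show ?case by (simp add: f_def power_mult[symmetric])
qed

lemma kern_scale_sum:
  assumes "norm z \<le> 1"
  shows "(\<Sum>k<2 ^ s. Re (kern (pole s k) z)) \<le> 3 * 2 ^ s"
proof -
  define R :: real where "R = 1 + 1 / 2 ^ s"
  have R: "1 < R" by (simp add: R_def)
  define X where "X = R ^ 2 ^ s"
  \<comment> \<open>By Bernoulli, \<open>(1 + 1 / 2 ^ s) ^ 2 ^ s\<close> is at least 2; hence
    \<open>(X + 1) / (X - 1)\<close> is at most 3.\<close>
  have X: "2 \<le> X"
    using Bernoulli_inequality[of "1 / 2 ^ s :: real" "2 ^ s"] order_trans[of "-1" 0 "1 / 2 ^ s :: real"]
    by (simp add: X_def R_def)
  define y where "y = z ^ 2 ^ s"
  have y: "norm y \<le> 1" unfolding y_def norm_power using assms by (intro power_le_one) auto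
  have "(\<Sum>k<2 ^ s. Re (kern (pole s k) z)) = Re (\<Sum>k<2 ^ s. kern (of_real R * dyadic_root s k) z)"
    by (simp add: pole_def R_def)
  also have "\<dots> = Re (2 ^ s * kern (of_real X) y)"
    unfolding kern_root_sum[OF R assms] by (simp add: X_def y_def)
  also have "\<dots> \<le> norm (2 ^ s * kern (of_real X) y)" by (rule complex_Re_le_cmod)
  also have "\<dots> = 2 ^ s * (norm (of_real X + y) / norm (of_real X - y))"
    by (simp add: kern_def norm_mult norm_divide norm_power)
  also have "\<dots> \<le> 2 ^ s * ((X + 1) / (X - 1))"
  proof (intro mult_left_mono frac_le)
    show "norm (of_real X + y) \<le> X + 1" using norm_triangle_ineq[of "of_real X" y] X y by simp
    show "X - 1 \<le> norm (of_real X - y)" using norm_triangle_ineq2[of "of_real X" y] X y by simp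
  qed (use X in auto)
  also have "\<dots> \<le> 2 ^ s * 3" using X by (intro mult_left_mono) (auto simp: field_simps)
  finally show ?thesis by simp
qed

lemma norm_cis_diff: "norm (cis a - cis b) \<le> \<bar>a - b\<bar>"
proof -
  have "norm (exp (\<i> * of_real a) - exp (\<i> * of_real b)) \<le> 1 * norm (complex_of_real a - of_real b)"
  proof (rule field_differentiable_bound[where S = "\<real>" and f' = "\<lambda>z. \<i> * exp (\<i> * z)" and f = "\<lambda>z. exp (\<i> * z)"])
    show "((\<lambda>z. exp (\<i> * z)) has_field_derivative \<i> * exp (\<i> * z)) (at z within \<real>)" for z
      by (auto intro!: derivative_eq_intros)
    show "norm (\<i> * exp (\<i> * z)) \<le> 1" if "z \<in> \<real>" for z
      using that by (auto simp: norm_mult Reals_def)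
  qed (auto intro: convex_Reals)
  also have "norm (complex_of_real a - of_real b) = \<bar>a - b\<bar>" by (metis norm_of_real of_real_diff)
  finally show ?thesis by (simp add: cis_conv_exp)
qed

lemma near_dyadic_root:
  assumes "norm z = 1"
  shows "\<exists>k<2 ^ s. norm (dyadic_root s k - z) \<le> 7 / 2 ^ s"
proof -
  define \<theta> where "\<theta> = Arg2pi z"
  have \<theta>: "0 \<le> \<theta>" "\<theta> < 2 * pi" "z = cis \<theta>"
    using Arg2pi[of z] assms by (auto simp: \<theta>_def cis_conv_exp is_Arg_def)
  define x where "x = \<theta> * 2 ^ s / (2 * pi)"
  have x: "0 \<le> x" "x < 2 ^ s" using \<theta> by (auto simp: x_def field_simps)
  define k where "k = nat \<lfloor>x\<rfloor>"
  have k: "real k \<le> x" "x < real k + 1" using x by (auto simp: k_def of_nat_nat)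
  have "real k < 2 ^ s" using k(1) x(2) by linarith
  then have "k < 2 ^ s" by simp
  moreover have "norm (dyadic_root s k - z) \<le> 7 / 2 ^ s"
  proof -
    have "norm (dyadic_root s k - z) \<le> \<bar>2 * pi * real k / 2 ^ s - \<theta>\<bar>"
      unfolding dyadic_root_def \<theta>(3) by (rule norm_cis_diff)
    also have "2 * pi * real k / 2 ^ s - \<theta> = (2 * pi / 2 ^ s) * (real k - x)"
      by (simp add: x_def field_simps)
    also have "\<bar>(2 * pi / 2 ^ s) * (real k - x)\<bar> \<le> (2 * pi / 2 ^ s) * 1"
      unfolding abs_mult using k by (intro mult_mono) auto
    also have "\<dots> \<le> 7 / 2 ^ s" using pi_approx by (simp add: divide_right_mono)
    finally show ?thesis .
  qed
  ultimately show ?thesis by blast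
qed

text \<open>The radius 8 is \<open>7 + 1\<close>: a circle point within \<open>1 / 2 ^ s\<close> of
  \<open>E\<close> has a dyadic root within \<open>7 / 2 ^ s\<close>, and that root must belong to
  \<open>J s\<close>. The 7 rounds up \<open>2 * pi\<close>.\<close>

context
  fixes E :: "complex set" and J :: "nat \<Rightarrow> nat set"
  assumes J_def: "\<And>s. J s = {k. k < 2 ^ s \<and> infdist (dyadic_root s k) E \<le> 8 / 2 ^ s}"
begin

lemma J_finite: "finite (J s)" unfolding J_def by simp

lemma scale_lower:
  assumes "norm z0 = 1" "infdist z0 E \<le> 1 / 2 ^ s"
  shows "1 / 32 \<le> (\<Sum>k\<in>J s. 1 / 2 ^ s * Re (kern (pole s k) z0))"
proof -
  define e :: real where "e = 1 / 2 ^ s"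
  have e: "0 < e" by (simp add: e_def)
  obtain k where k: "k < 2 ^ s" "norm (dyadic_root s k - z0) \<le> 7 * e"
    using near_dyadic_root[OF assms(1), of s] by (auto simp: e_def)
  have "infdist (dyadic_root s k) E \<le> infdist z0 E + dist (dyadic_root s k) z0" by (rule infdist_triangle)
  then have "k \<in> J s" unfolding J_def using k assms(2) by (simp add: e_def dist_norm)
  have ne: "pole s k \<noteq> z0" by (rule pole_distance) (use assms in simp)
  have "norm (pole s k - z0) \<le> norm (pole s k - dyadic_root s k) + norm (dyadic_root s k - z0)"
    using norm_triangle_ineq[of "pole s k - dyadic_root s k" "dyadic_root s k - z0"] by simp
  then have "norm (pole s k - z0) \<le> 8 * e" using k(2) by (simp add: pole_minus_root e_def)
  then have d: "(norm (pole s k - z0))\<^sup>2 \<le> (8 * e)\<^sup>2" by (intro power_mono) auto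
  have "1 / 32 = e * ((2 * e) / (8 * e)\<^sup>2)" using e by (simp add: power2_eq_square)
  also have "\<dots> \<le> e * (((norm (pole s k))\<^sup>2 - (norm z0)\<^sup>2) / (norm (pole s k - z0))\<^sup>2)"
  proof (intro mult_left_mono frac_le)
    show "2 * e \<le> (norm (pole s k))\<^sup>2 - (norm z0)\<^sup>2"
      unfolding norm_pole assms(1) e_def[symmetric] using e by (simp add: power2_eq_square algebra_simps)
    then show "0 \<le> (norm (pole s k))\<^sup>2 - (norm z0)\<^sup>2" using e by linarith
  qed (use d ne e in auto)
  also have "\<dots> = 1 / 2 ^ s * Re (kern (pole s k) z0)" unfolding Re_kern[OF ne] e_def ..
  also have "\<dots> \<le> (\<Sum>k\<in>J s. 1 / 2 ^ s * Re (kern (pole s k) z0))"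
    using Re_kern_pole_pos[of z0 s] assms(1)
    by (intro member_le_sum[OF \<open>k \<in> J s\<close>] J_finite mult_nonneg_nonneg) (auto intro: less_imp_le)
  finally show ?thesis .
qed

lemma scale_upper:
  assumes "norm z0 \<le> 1"
  shows "(\<Sum>k\<in>J s. 1 / 2 ^ s * Re (kern (pole s k) z0)) \<le> 3"
proof -
  have "(\<Sum>k\<in>J s. Re (kern (pole s k) z0)) \<le> (\<Sum>k<2 ^ s. Re (kern (pole s k) z0))"
    by (rule sum_mono2) (use Re_kern_pole_pos[OF assms] in \<open>auto simp: J_def intro: less_imp_le\<close>)
  also have "\<dots> \<le> 3 * 2 ^ s" by (rule kern_scale_sum[OF assms])
  finally have "1 / 2 ^ s * (\<Sum>k\<in>J s. Re (kern (pole s k) z0)) \<le> 1 / 2 ^ s * (3 * 2 ^ s)"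
    by (rule mult_left_mono) simp
  then show ?thesis by (simp add: sum_distrib_left)
qed

lemma pole_far:
  assumes "norm z0 = 1" "k \<in> J s"
  shows "infdist z0 E \<le> 10 * norm (pole s k - z0)"
proof -
  have "infdist z0 E \<le> infdist (dyadic_root s k) E + dist z0 (dyadic_root s k)" by (rule infdist_triangle)
  moreover have "infdist (dyadic_root s k) E \<le> 8 * (1 / 2 ^ s)" using assms(2) by (simp add: J_def)
  moreover have "dist z0 (dyadic_root s k) \<le> norm (pole s k - z0) + norm (pole s k - dyadic_root s k)"
    using norm_triangle_ineq4[of "pole s k - dyadic_root s k" "pole s k - z0"] by (simp add: dist_norm)
  moreover have "1 / 2 ^ s \<le> norm (pole s k - z0)" using assms by (intro pole_distance) simp
  ultimately show ?thesis unfolding pole_minus_root by linarith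
qed

text \<open>Useful at scales finer than the distance \<rho> of \<open>z0\<close> to
  \<open>E\<close>. The kernels are compared with those at \<open>z'\<close>, of depth
  \<open>\<rho> / 2\<close>: the denominators are comparable because the poles of \<open>J s\<close>
  keep distance \<open>\<rho> / 10\<close> from \<open>z0\<close>, while the numerators gain the
  ratio of \<open>1 / 2 ^ s\<close> to \<rho>. \<open>scale_upper\<close> bounds the sum at
  \<open>z'\<close>.\<close>

lemma scale_upper_small:
  assumes z0: "norm z0 = 1" and \<rho>: "0 < infdist z0 E" "infdist z0 E \<le> 2"
  shows "(\<Sum>k\<in>J s. 1 / 2 ^ s * Re (kern (pole s k) z0)) \<le> 648 / (2 ^ s * infdist z0 E)"
proof -
  define \<rho> where "\<rho> = infdist z0 E"
  define z' where "z' = (1 - of_real (\<rho>/2)) * z0"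
  define e :: real where "e = 1 / 2 ^ s"
  have e: "0 < e" "e \<le> 1" by (auto simp: e_def)
  have \<rho>': "0 < \<rho>" "\<rho> \<le> 2" using \<rho> by (auto simp: \<rho>_def)
  have z': "norm z' = 1 - \<rho>/2"
  proof -
    have "z' = of_real (1 - \<rho>/2) * z0" by (simp add: z'_def)
    then show ?thesis using \<rho>' z0 by (simp add: norm_mult del: of_real_diff of_real_divide)
  qed
  have "z0 - z' = of_real (\<rho>/2) * z0" by (simp add: z'_def algebra_simps)
  then have "norm (z0 - z') = norm (complex_of_real (\<rho>/2)) * norm z0" by (simp only: norm_mult)
  then have zz: "norm (z0 - z') = \<rho>/2" using \<rho>' z0 unfolding norm_of_real by simp
  have le: "Re (kern (pole s k) z0) \<le> 216 * e / \<rho> * Re (kern (pole s k) z')" if k: "k \<in> J s" for k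
  proof -
    define \<xi> where "\<xi> = pole s k"
    have n\<xi>: "norm \<xi> = 1 + e" by (simp add: \<xi>_def norm_pole e_def)
    have ne: "\<xi> \<noteq> z0" "\<xi> \<noteq> z'" unfolding \<xi>_def using z0 z' \<rho>' by (auto intro!: pole_distance)
    define x where "x = norm (\<xi> - z0)"
    define y where "y = norm (\<xi> - z')"
    have xy: "0 < x" "0 < y" using ne by (auto simp: x_def y_def)
    have "y \<le> x + \<rho>/2" using norm_triangle_ineq[of "\<xi> - z0" "z0 - z'"] zz by (simp add: x_def y_def)
    moreover have "\<rho> \<le> 10 * x" using pole_far[OF z0 k] by (simp add: \<rho>_def x_def \<xi>_def)
    ultimately have "y \<le> 6 * x" by simp
    then have yx: "y\<^sup>2 \<le> 36 * x\<^sup>2" using xy power_mono[of y "6 * x" 2] by (simp add: power_mult_distrib)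
    have "Re (kern \<xi> z0) = (2 * e + e\<^sup>2) / x\<^sup>2"
      unfolding Re_kern[OF ne(1)] n\<xi> z0 x_def by (simp add: power2_eq_square algebra_simps)
    also have "\<dots> \<le> (3 * e) / x\<^sup>2"
      using e by (intro divide_right_mono) (auto simp: power2_eq_square mult_left_le)
    also have "\<dots> \<le> 36 * (3 * e / y\<^sup>2)"
      by (rule divide_square_le) (use e xy yx in auto)
    also have "\<dots> = 216 * e / \<rho> * ((\<rho>/2) / y\<^sup>2)" using \<rho>' by simp
    also have "\<dots> \<le> 216 * e / \<rho> * Re (kern \<xi> z')"
    proof (intro mult_left_mono)
      have "\<rho> * \<rho> \<le> 2 * \<rho>" using \<rho>' by (intro mult_right_mono) auto
      then have "(1 - \<rho>/2)\<^sup>2 \<le> 1 - \<rho>/2" by (simp add: power2_eq_square algebra_simps)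
      moreover have "1 \<le> (1 + e)\<^sup>2" using e by (intro one_le_power) auto
      ultimately have "\<rho>/2 \<le> (norm \<xi>)\<^sup>2 - (norm z')\<^sup>2" unfolding n\<xi> z' by simp
      then show "(\<rho>/2) / y\<^sup>2 \<le> Re (kern \<xi> z')"
        unfolding Re_kern[OF ne(2)] y_def by (rule divide_right_mono) simp
    qed (use e \<rho>' in auto)
    finally show ?thesis by (simp add: \<xi>_def)
  qed
  have z'1: "norm z' \<le> 1" using z' \<rho>' by simp
  have "(\<Sum>k\<in>J s. e * Re (kern (pole s k) z0)) \<le> (\<Sum>k\<in>J s. e * (216 * e / \<rho> * Re (kern (pole s k) z')))"
    using e le by (intro sum_mono mult_left_mono) auto
  also have "\<dots> = (216 * e / \<rho>) * (\<Sum>k\<in>J s. e * Re (kern (pole s k) z'))"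
    unfolding sum_distrib_left by (intro sum.cong refl) simp
  also have "\<dots> \<le> (216 * e / \<rho>) * 3"
    using e \<rho>' scale_upper[OF z'1, of s] by (intro mult_left_mono) (auto simp: e_def)
  finally show ?thesis by (simp add: e_def \<rho>_def)
qed

end

section \<open>Localized test functions\<close>

lemma dyadic_tail_sum: "(\<Sum>s\<in>{p..<p + m}. 1 / 2 ^ s :: real) \<le> 2 / 2 ^ p"
proof -
  have "(\<Sum>s\<in>{p..<p + m}. 1 / 2 ^ s :: real) = 2 / 2 ^ p - 2 / 2 ^ (p + m)"
  proof (induction m)
    case (Suc m)
    have "2 / 2 ^ (p + Suc m) = (1 / 2 ^ (p + m) :: real)" by simp
    with Suc show ?case by simp
  qed simp
  then show ?thesis by simp
qed

lemma barrier_Re: "Re (barrier S J w) = (\<Sum>s\<in>S. \<Sum>k\<in>J s. 1 / 2 ^ s * Re (kern (pole s k) w))"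
proof -
  have "Re (of_real x * y) = x * Re y" for x y by simp
  then show ?thesis unfolding barrier_def Re_sum by simp
qed

lemma barrier_nonneg:
  assumes "norm w \<le> 1"
  shows "0 \<le> Re (barrier S J w)"
  unfolding barrier_Re using Re_kern_pole_pos[OF assms]
  by (intro sum_nonneg mult_nonneg_nonneg) (auto intro: less_imp_le)

text \<open>The number \<open>t\<close> counts the dyadic scales from \<open>s0\<close> down to the
  distance of \<open>z0\<close> to \<open>E\<close>. Each of them contributes between 1/32 and 3;
  the finer ones form a geometric tail bounded by \<open>1296 = 2 * 648\<close>.\<close>

lemma barrier_bounds:
  assumes J: "\<And>s. J s = {k. k < 2 ^ s \<and> infdist (dyadic_root s k) E \<le> 8 / 2 ^ s}"
    and z0: "norm z0 = 1" and \<rho>: "0 < infdist z0 E" "infdist z0 E \<le> 2"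
    and S: "s0 \<le> S1" "1 / 2 ^ S1 < infdist z0 E"
  shows "\<exists>t. 1 / 2 ^ (s0 + t) < infdist z0 E \<and> (0 < t \<longrightarrow> infdist z0 E \<le> 2 / 2 ^ (s0 + t)) \<and>
     real t / 32 \<le> Re (barrier {s0..S1} J z0) \<and> Re (barrier {s0..S1} J z0) \<le> 3 * real t + 1296"
proof -
  define \<rho> where "\<rho> = infdist z0 E"
  have \<rho>0: "0 < \<rho>" using \<rho> by (simp add: \<rho>_def)
  define \<sigma> where "\<sigma> s = (\<Sum>k\<in>J s. 1 / 2 ^ s * Re (kern (pole s k) z0))" for s
  have \<sigma>0: "0 \<le> \<sigma> s" for s
    unfolding \<sigma>_def using Re_kern_pole_pos[of z0 s] z0
    by (intro sum_nonneg mult_nonneg_nonneg) (auto intro: less_imp_le)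
  define P where "P t \<longleftrightarrow> 1 / 2 ^ (s0 + t) < \<rho>" for t
  have P1: "P (S1 - s0)" using S by (simp add: P_def \<rho>_def)
  define t where "t = (LEAST t. P t)"
  have t: "P t" "\<And>k. k < t \<Longrightarrow> \<not> P k" "t \<le> S1 - s0"
    unfolding t_def by (rule LeastI[of P, OF P1], erule not_less_Least, rule Least_le[of P, OF P1])
  have \<rho>t: "\<rho> \<le> 2 / 2 ^ (s0 + t)" if t0: "0 < t"
  proof -
    obtain u where u: "t = Suc u" using t0 by (cases t) auto
    then have "\<not> P u" using t(2)[of u] by simp
    then show ?thesis by (simp add: P_def u)
  qed
  have split: "(\<Sum>s\<in>{s0..S1}. \<sigma> s) = (\<Sum>s\<in>{s0..<s0 + t}. \<sigma> s) + (\<Sum>s\<in>{s0 + t..<s0 + t + (S1 + 1 - (s0 + t))}. \<sigma> s)"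
  proof -
    have "{s0..S1} = {s0..<s0 + t} \<union> {s0 + t..<s0 + t + (S1 + 1 - (s0 + t))}" using t(3) S(1) by auto
    then show ?thesis by (simp only:) (rule sum.union_disjoint, auto)
  qed
  have lo: "1 / 32 \<le> \<sigma> s" if "s \<in> {s0..<s0 + t}" for s
    unfolding \<sigma>_def
  proof (rule scale_lower[OF J z0])
    have "s - s0 < t" using that by auto
    then show "infdist z0 E \<le> 1 / 2 ^ s" using t(2)[of "s - s0"] that by (simp add: P_def \<rho>_def not_less)
  qed
  have "real t / 32 = (\<Sum>s\<in>{s0..<s0 + t}. 1 / 32)" by simp
  also have "\<dots> \<le> (\<Sum>s\<in>{s0..<s0 + t}. \<sigma> s)" using lo by (rule sum_mono)
  also have "\<dots> \<le> (\<Sum>s\<in>{s0..S1}. \<sigma> s)" unfolding split using \<sigma>0 by (simp add: sum_nonneg)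
  finally have 1: "real t / 32 \<le> Re (barrier {s0..S1} J z0)" by (simp add: barrier_Re \<sigma>_def)
  have "(\<Sum>s\<in>{s0..<s0 + t}. \<sigma> s) \<le> (\<Sum>s\<in>{s0..<s0 + t}. 3)"
    unfolding \<sigma>_def using z0 by (intro sum_mono scale_upper[OF J]) auto
  then have 2: "(\<Sum>s\<in>{s0..<s0 + t}. \<sigma> s) \<le> 3 * real t" by simp
  have "(\<Sum>s\<in>{s0 + t..<s0 + t + (S1 + 1 - (s0 + t))}. \<sigma> s)
     \<le> (\<Sum>s\<in>{s0 + t..<s0 + t + (S1 + 1 - (s0 + t))}. 648 / \<rho> * (1 / 2 ^ s))"
  proof (rule sum_mono)
    fix s
    show "\<sigma> s \<le> 648 / \<rho> * (1 / 2 ^ s)"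
      using scale_upper_small[OF J z0 \<rho>, of s] by (simp add: \<sigma>_def \<rho>_def mult.commute)
  qed
  also have "\<dots> \<le> 648 / \<rho> * (2 / 2 ^ (s0 + t))"
    unfolding sum_distrib_left[symmetric] using \<rho>0 by (intro mult_left_mono dyadic_tail_sum) auto
  also have "\<dots> \<le> 648 / \<rho> * (2 * \<rho>)"
    using t(1) \<rho>0 by (intro mult_left_mono) (auto simp: P_def)
  also have "\<dots> = 1296" using \<rho>0 by simp
  finally have "Re (barrier {s0..S1} J z0) \<le> 3 * real t + 1296"
    using 2 split by (simp add: barrier_Re \<sigma>_def)
  with 1 t(1) \<rho>t show ?thesis by (intro exI[of _ t]) (simp add: P_def \<rho>_def)
qed

text \<open>
  Per dyadic scale the kernels add at most 3 to the real part of a barrier, by \<open>barrier_bounds\<close>.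
  The fifth power of a function proportional to the scale absorbs the resulting factor \<open>exp 3\<close>.
\<close>

lemma exp3_le: "exp 3 \<le> (2::real) ^ 5"
proof -
  have "exp (3::real) = exp 1 ^ 3" using exp_of_nat_mult[of 3 "1::real"] by simp
  also have "\<dots> \<le> 3 ^ 3" using exp_le by (intro power_mono) auto
  finally show ?thesis by simp
qed

text \<open>
  The function \<open>h\<close> below has real part of order \<open>log (d / \<rho>)\<close> at points of the circle at distance
  \<open>\<rho> \<le> d\<close> from the zeros indexed by \<open>F\<close>, and yet at most \<open>C3\<close> close to \<open>z j\<close>; \<open>q\<close> is comparable
  to \<open>d\<close> plus the distance to \<open>z j\<close>.
\<close>

locale test_setting =
  fixes z :: "nat \<Rightarrow> complex" and C :: real and j :: nat and d :: real and F :: "nat set"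
  assumes C: "bump_const z C" and z: "\<And>l. norm (z l) < 1" and inj: "inj z"
    and d: "1 - norm (z j) \<le> d" "d \<le> 2"
    and F: "finite F" "F \<noteq> {}" "\<And>l. l \<in> F \<Longrightarrow> d \<le> norm (z l - z j)"
begin

definition E where "E = z ` F"

definition \<eta> where "\<eta> = Min ((\<lambda>l. 1 - norm (z l)) ` F)"

definition s0 :: nat where "s0 = (LEAST s. 1 / 2 ^ s \<le> d)"

text \<open>The finest scale lies below the distance of \<open>E\<close> to the circle, so that all
  scales counted by \<open>t\<close> in \<open>barrier_bounds\<close> are present.\<close>

definition S1 :: nat where "S1 = max s0 (LEAST s. 1 / 2 ^ s < \<eta>)"

definition J where "J s = {k. k < 2 ^ s \<and> infdist (dyadic_root s k) E \<le> 8 / 2 ^ s}"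

definition h where "h = barrier {s0..S1} J"

definition q where "q w = 1 - cnj (z j) * w + of_real d"

text \<open>The exponent with \<open>exp C3 = exp 1296 * (64 * C) ^ 5\<close>, the bound that the
  maximum principle yields in \<open>h_upper\<close>.\<close>

definition C3 where "C3 = 1296 + 5 * ln (64 * C)"

lemma C1: "1 \<le> C" using C by (simp add: bump_const_def)

lemma d0: "0 < d" using d z[of j] by linarith

lemma C3: "1296 \<le> C3" "ln (16 * C) \<le> C3" "ln (64 * C) \<ge> 0"
proof -
  show l: "ln (64 * C) \<ge> 0" using C1 by (intro ln_ge_zero) auto
  then show "1296 \<le> C3" by (simp add: C3_def)
  have "ln (16 * C) \<le> ln (64 * C)" using C1 by simp
  then show "ln (16 * C) \<le> C3" using l unfolding C3_def by linarith
qed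

lemma \<eta>: "0 < \<eta>" "\<And>l. l \<in> F \<Longrightarrow> \<eta> \<le> 1 - norm (z l)"
proof -
  show "0 < \<eta>" unfolding \<eta>_def using F z by (subst Min_gr_iff) auto
  show "\<eta> \<le> 1 - norm (z l)" if "l \<in> F" for l unfolding \<eta>_def using F that by (intro Min_le) auto
qed

lemma small_power_ex: "0 < x \<Longrightarrow> \<exists>s::nat. 1 / 2 ^ s < (x::real)"
  using real_arch_pow_inv[of x "1/2"] by (auto simp: power_divide)

lemma s0: "1 / 2 ^ s0 \<le> d" "d \<le> 2 / 2 ^ s0"
proof -
  obtain s where "1 / 2 ^ s < d" using small_power_ex[OF d0] by blast
  then have ex: "1 / 2 ^ s \<le> d" by simp
  show "1 / 2 ^ s0 \<le> d" unfolding s0_def by (rule LeastI[where P = "\<lambda>s. 1 / 2 ^ s \<le> d", OF ex])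
  show "d \<le> 2 / 2 ^ s0"
  proof (cases s0)
    case 0
    then show ?thesis using d by simp
  next
    case (Suc u)
    then have "\<not> 1 / 2 ^ u \<le> d" using not_less_Least[of u "\<lambda>s. 1 / 2 ^ s \<le> d"] by (simp add: s0_def)
    then show ?thesis by (simp add: Suc)
  qed
qed

lemma S1: "s0 \<le> S1" "1 / 2 ^ S1 < \<eta>"
proof -
  show "s0 \<le> S1" by (simp add: S1_def)
  obtain s where s: "1 / 2 ^ s < \<eta>" using small_power_ex[OF \<eta>(1)] by blast
  have l: "1 / 2 ^ (LEAST s. 1 / 2 ^ s < \<eta>) < \<eta>" by (rule LeastI[where P = "\<lambda>s. 1 / 2 ^ s < \<eta>", OF s])
  have "1 / 2 ^ S1 \<le> (1 / 2 ^ (LEAST s. 1 / 2 ^ s < \<eta>) :: real)"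
    by (intro divide_left_mono power_increasing) (auto simp: S1_def)
  with l show "1 / 2 ^ S1 < \<eta>" by linarith
qed

lemma E: "finite E" "E \<noteq> {}" "closed E" "\<And>e. e \<in> E \<Longrightarrow> norm e \<le> 1 - \<eta>"
proof -
  show "finite E" "E \<noteq> {}" "closed E" using F by (auto simp: E_def finite_imp_closed)
  fix e assume "e \<in> E"
  then obtain l where "l \<in> F" "e = z l" by (auto simp: E_def)
  then show "norm e \<le> 1 - \<eta>" using \<eta>(2)[of l] by simp
qed

lemma infdist_circle:
  assumes "norm z0 = 1"
  shows "\<eta> \<le> infdist z0 E" "infdist z0 E \<le> 2" "0 < infdist z0 E"
proof -
  obtain e where e: "e \<in> E" "infdist z0 E = dist z0 e"
    using infdist_attains_inf[OF E(3,2)] by blast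
  have "norm z0 - norm e \<le> dist z0 e" unfolding dist_norm by (rule norm_triangle_ineq2)
  then show 1: "\<eta> \<le> infdist z0 E" using E(4)[OF e(1)] assms e(2) by simp
  show "infdist z0 E \<le> 2"
    using norm_triangle_ineq4[of z0 e] E(4)[OF e(1)] \<eta>(1) assms e(2) by (simp add: dist_norm)
  show "0 < infdist z0 E" using 1 \<eta>(1) by linarith
qed

lemma q_lower:
  assumes "norm w \<le> 1"
  shows "d \<le> norm (q w)" "norm (w - z j) \<le> norm (q w)" "norm (1 - cnj (z j) * w) \<le> norm (q w)" "q w \<noteq> 0"
proof -
  show "d \<le> norm (q w)" "norm (w - z j) \<le> norm (q w)" "norm (1 - cnj (z j) * w) \<le> norm (q w)"
    unfolding q_def using shifted_cnj_lower[OF z assms, of d j] d0 by auto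
  then show "q w \<noteq> 0" using d0 by auto
qed

lemma barrier_circle:
  assumes "norm z0 = 1"
  shows "\<exists>t. 1 / 2 ^ t \<le> 2 * infdist z0 E / d \<and> (0 < t \<longrightarrow> 2 ^ t \<le> 2 * d / infdist z0 E) \<and>
     real t / 32 \<le> Re (h z0) \<and> Re (h z0) \<le> 3 * real t + 1296"
proof -
  define \<rho> where "\<rho> = infdist z0 E"
  have \<rho>: "0 < \<rho>" "\<rho> \<le> 2" "\<eta> \<le> \<rho>" using infdist_circle[OF assms] by (auto simp: \<rho>_def)
  obtain t where t: "1 / 2 ^ (s0 + t) < \<rho>" "0 < t \<Longrightarrow> \<rho> \<le> 2 / 2 ^ (s0 + t)"
     "real t / 32 \<le> Re (h z0)" "Re (h z0) \<le> 3 * real t + 1296"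
    using barrier_bounds[OF J_def assms, of s0 S1] \<rho> S1 by (auto simp: \<rho>_def h_def)
  have p: "0 < (2::real) ^ s0" "0 < (2::real) ^ t" by simp_all
  have "1 / 2 ^ t \<le> 2 * \<rho> / d"
  proof -
    have "d \<le> (2 / 2 ^ s0)" by (rule s0)
    also have "\<dots> = 2 * 2 ^ t * (1 / 2 ^ (s0 + t))" by (simp add: power_add)
    also have "\<dots> \<le> 2 * 2 ^ t * \<rho>" using t(1) by (intro mult_left_mono) auto
    finally show ?thesis using d0 p by (simp add: field_simps)
  qed
  moreover have "2 ^ t \<le> 2 * d / \<rho>" if "0 < t"
  proof -
    have "2 ^ t * \<rho> \<le> 2 ^ t * (2 / 2 ^ (s0 + t))" using t(2)[OF that] by (intro mult_left_mono) auto
    also have "\<dots> = 2 * (1 / 2 ^ s0)" by (simp add: power_add)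
    also have "\<dots> \<le> 2 * d" using s0(1) by simp
    finally show ?thesis using \<rho> by (simp add: field_simps)
  qed
  ultimately show ?thesis using t(3,4) by (intro exI[of _ t]) (auto simp: \<rho>_def)
qed

text \<open>A neighbourhood of the closed disc that avoids the poles of \<open>h\<close>, of
  \<open>1 / q\<close> and of the Blaschke factors over \<open>F\<close>; the Cauchy estimates at
  circle points take place in it.\<close>

definition W where
  "W = {w. q w * (\<Prod>l\<in>F. 1 - cnj (z l) * w) \<noteq> 0} - (\<Union>s\<in>{s0..S1}. pole s ` J s)"

lemma J_fin: "finite (J s)" by (simp add: J_def)

lemma W: "open W" "cball 0 1 \<subseteq> W"
proof -
  have "open {w. q w * (\<Prod>l\<in>F. 1 - cnj (z l) * w) \<noteq> 0}"
    unfolding q_def by (intro open_Collect_neq continuous_intros)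
  then show "open W" unfolding W_def
    by (intro open_Diff finite_imp_closed finite_UN_I finite_imageI J_fin) auto
  show "cball 0 1 \<subseteq> W"
  proof
    fix w :: complex assume "w \<in> cball 0 1"
    then have w: "norm w \<le> 1" by simp
    have "w \<notin> (\<Union>s\<in>{s0..S1}. pole s ` J s)" using pole_distance(2)[OF w] by fastforce
    then show "w \<in> W"
      unfolding W_def using q_lower(4)[OF w] one_minus_cnj_pos(3)[OF z w] F(1) by auto
  qed
qed

lemma h_holo: "h holomorphic_on W"
  unfolding h_def barrier_def[abs_def] kern_def
  by (intro holomorphic_intros) (auto simp: W_def)

text \<open>For \<open>t > 0\<close> the bump is at most \<open>2 * C * \<rho>\<close> by its
  vanishing on \<open>E\<close>, and \<open>2 ^ t\<close> is at most \<open>2 * d / \<rho>\<close>,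
  so their product stays below \<open>4 * C * d\<close>. For \<open>t = 0\<close> the growth of the
  bump suffices.\<close>

lemma bump_circle_bound:
  assumes \<psi>: "deriv_bounded 1 C \<psi>" "\<psi> (z j) = of_real d" "\<And>l. d \<le> norm (z l - z j) \<Longrightarrow> \<psi> (z l) = 0"
    and r: "r < 1" "0 \<le> r" "1 - r \<le> \<eta>" "1 - r \<le> d" and z0: "norm z0 = 1"
  shows "norm (\<psi> (of_real r * z0)) ^ 5 * exp (Re (h z0)) \<le> exp 1296 * (4 * C) ^ 5 * norm (q z0) ^ 5"
proof -
  define \<rho> where "\<rho> = infdist z0 E"
  have \<rho>: "0 < \<rho>" "\<eta> \<le> \<rho>" using infdist_circle[OF z0] by (auto simp: \<rho>_def)
  have rz: "norm (of_real r * z0) < 1" using r z0 by (simp add: norm_mult)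
  have "of_real r * z0 - z0 = - (of_real (1 - r) * z0)" by (simp add: algebra_simps)
  then have "norm (of_real r * z0 - z0) = norm (complex_of_real (1 - r)) * norm z0" by (metis norm_minus_cancel norm_mult)
  then have rzz: "norm (of_real r * z0 - z0) = 1 - r" using r z0 unfolding norm_of_real by simp
  obtain t where t: "0 < t \<Longrightarrow> 2 ^ t \<le> 2 * d / \<rho>" "Re (h z0) \<le> 3 * real t + 1296"
    using barrier_circle[OF z0] by (auto simp: \<rho>_def)
  have "exp (Re (h z0)) \<le> exp (1296 + real t * 3)" using t(2) by simp
  also have "\<dots> = exp 1296 * exp 3 ^ t" by (simp add: exp_add exp_of_nat_mult)
  also have "\<dots> \<le> exp 1296 * (2 ^ 5) ^ t" using exp3_le by (intro mult_left_mono power_mono) auto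
  also have "\<dots> = exp 1296 * (2 ^ t) ^ 5" by (simp only: power_mult[symmetric] mult.commute)
  finally have eh: "exp (Re (h z0)) \<le> exp 1296 * (2 ^ t) ^ 5" .
  have main: "norm (\<psi> (of_real r * z0)) * 2 ^ t \<le> 4 * C * norm (q z0)"
  proof (cases "0 < t")
    case True
    obtain e where e: "e \<in> E" "\<rho> = dist z0 e"
      using infdist_attains_inf[OF E(3,2)] by (auto simp: \<rho>_def)
    then obtain l where l: "l \<in> F" "e = z l" by (auto simp: E_def)
    have "\<psi> e = 0" using \<psi>(3) F(3) l by simp
    then have "norm (\<psi> (of_real r * z0)) \<le> C * norm (of_real r * z0 - e)"
      using deriv_bounded_lipschitz[OF \<psi>(1) rz, of e] z l by simp
    also have "norm (of_real r * z0 - e) \<le> 2 * \<rho>"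
      using norm_triangle_ineq[of "of_real r * z0 - z0" "z0 - e"] rzz e(2) r(3) \<rho>(2) by (simp add: dist_norm)
    finally have "norm (\<psi> (of_real r * z0)) \<le> C * (2 * \<rho>)" using C1 by simp
    then have "norm (\<psi> (of_real r * z0)) * 2 ^ t \<le> C * (2 * \<rho>) * (2 * d / \<rho>)"
      using t(1)[OF True] C1 \<rho>(1) by (intro mult_mono) auto
    also have "\<dots> = 4 * C * d" using \<rho>(1) by simp
    also have "\<dots> \<le> 4 * C * norm (q z0)" using q_lower(1)[of z0] z0 C1 by (intro mult_left_mono) auto
    finally show ?thesis .
  next
    case False
    have "norm (\<psi> (of_real r * z0)) \<le> d + C * norm (of_real r * z0 - z j)"
      by (rule bump_growth(1)[OF \<psi>(1,2) z rz]) (use d0 in simp)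
    also have "\<dots> \<le> C * norm (q z0) + C * (3 * norm (q z0))"
    proof (intro add_mono mult_left_mono)
      have "d \<le> 1 * norm (q z0)" using q_lower(1)[of z0] z0 by simp
      also have "\<dots> \<le> C * norm (q z0)" using C1 by (intro mult_right_mono) auto
      finally show "d \<le> C * norm (q z0)" .
      show "norm (of_real r * z0 - z j) \<le> 3 * norm (q z0)"
      proof -
        have "norm (of_real r * z0 - z j) \<le> (1 - r) + norm (z0 - z j)"
          using norm_triangle_ineq[of "of_real r * z0 - z0" "z0 - z j"] rzz by simp
        moreover have "d \<le> norm (q z0)" "norm (z0 - z j) \<le> norm (q z0)" using q_lower(1,2)[of z0] z0 by auto
        ultimately show ?thesis using r(4) norm_ge_zero[of "q z0"] by linarith
      qed
    qed (use C1 in simp)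
    finally show ?thesis using False by simp
  qed
  have "norm (\<psi> (of_real r * z0)) ^ 5 * exp (Re (h z0)) \<le> norm (\<psi> (of_real r * z0)) ^ 5 * (exp 1296 * (2 ^ t) ^ 5)"
    using eh by (intro mult_left_mono) auto
  also have "\<dots> = exp 1296 * (norm (\<psi> (of_real r * z0)) * 2 ^ t) ^ 5"
    by (simp only: power_mult_distrib mult.left_commute mult.assoc mult.commute)
  also have "\<dots> \<le> exp 1296 * (4 * C * norm (q z0)) ^ 5"
    using main by (intro mult_left_mono power_mono) auto
  finally show ?thesis by (simp add: power_mult_distrib)
qed

text \<open>At \<open>p\<close> the dilated bump is still at least \<open>d / 4\<close> and
  \<open>q\<close> at most \<open>4 * d\<close>, which turns the circle bound into
  \<open>(64 * C) ^ 5\<close>. The result bounds the cut-off from below at \<open>z j\<close> and,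
  taken at \<open>w0\<close>, normalises all kernel sums.\<close>

lemma h_upper:
  assumes p: "norm p < 1" "norm (p - z j) \<le> d / (2 * C)"
  shows "Re (h p) \<le> C3"
proof -
  obtain \<psi> where \<psi>: "deriv_bounded 1 C \<psi>" "\<psi> (z j) = of_real d"
     "\<And>l. d \<le> norm (z l - z j) \<Longrightarrow> \<psi> (z l) = 0"
    using C d(2) d0 unfolding bump_const_def by (metis less_imp_le)
  \<comment> \<open>Dilating moves \<open>p\<close> by at most \<open>d / (4 * C)\<close>; together
    with the given \<open>d / (2 * C)\<close> this leaves a quarter of the height
    \<open>d\<close>.\<close>
  define r where "r = 1 - min (1/2) (min \<eta> (d / (4 * C)))"
  have dC: "0 < d / (4 * C)" "d / (4 * C) \<le> d"
    using d0 C1 by (auto simp: field_simps)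
  have r: "r < 1" "0 \<le> r" "1 - r \<le> \<eta>" "1 - r \<le> d / (4 * C)" "1 - r \<le> d"
    using \<eta>(1) dC by (auto simp: r_def)
  \<comment> \<open>The dilation by \<open>r\<close> makes the bump holomorphic across the circle; there its decay towards the
    other zeros outweighs the growth of \<open>exp h\<close>.\<close>
  define G where "G w = \<psi> (of_real r * w) ^ 5 * exp (h w) / q w ^ 5" for w
  have nr: "norm (of_real r * w) < 1" if "norm w \<le> 1" for w :: complex
  proof -
    have "norm (of_real r * w) \<le> r * 1" using that r unfolding norm_mult norm_of_real by (simp add: mult_left_le)
    then show ?thesis using r by simp
  qed
  have G: "G holomorphic_on cball 0 1"
  proof -
    have "(\<psi> \<circ> (\<lambda>w. of_real r * w)) holomorphic_on cball 0 1"
      using nr by (intro holomorphic_on_compose_gen[OF _ deriv_bounded_holo[OF \<psi>(1)]] holomorphic_intros) auto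
    then have 1: "(\<lambda>w. \<psi> (of_real r * w)) holomorphic_on cball 0 1" by (simp add: o_def)
    have 2: "h holomorphic_on cball 0 1" by (rule holomorphic_on_subset[OF h_holo W(2)])
    have 3: "q holomorphic_on cball 0 1" unfolding q_def[abs_def] by (intro holomorphic_intros)
    show ?thesis unfolding G_def using q_lower(4) by (intro holomorphic_intros 1 2 3) auto
  qed
  have "norm (G p) \<le> exp 1296 * (4 * C) ^ 5"
  proof (rule maximum_modulus_frontier[of G "cball 0 1"])
    show "G holomorphic_on interior (cball 0 1)" by (rule holomorphic_on_subset[OF G]) auto
    show "continuous_on (closure (cball 0 1)) G" using holomorphic_on_imp_continuous_on[OF G] by simp
    show "norm (G w) \<le> exp 1296 * (4 * C) ^ 5" if "w \<in> frontier (cball 0 1)" for w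
    proof -
      have w: "norm w = 1" using that by (simp add: frontier_cball)
      have "norm (G w) = norm (\<psi> (of_real r * w)) ^ 5 * exp (Re (h w)) / norm (q w) ^ 5"
        by (simp add: G_def norm_mult norm_divide norm_power)
      also have "\<dots> \<le> exp 1296 * (4 * C) ^ 5"
        using bump_circle_bound[OF \<psi> r(1,2,3,5) w] q_lower(4)[of w] w by (simp add: divide_le_eq)
      finally show ?thesis .
    qed
  qed (use p in auto)
  then have G1: "norm (\<psi> (of_real r * p)) ^ 5 * exp (Re (h p)) \<le> exp 1296 * (4 * C * norm (q p)) ^ 5"
    using q_lower(4)[of p] p by (simp add: G_def norm_mult norm_divide norm_power divide_le_eq power_mult_distrib)
  have dd: "d / (2 * C) \<le> d" using d0 C1 by (auto simp: field_simps)
  have "norm (1 - cnj (z j) * p) \<le> 2 * (1 - norm (z j)) + norm (p - z j)"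
    using cnj_le_dist[of "z j" p] z[of j] by simp
  then have "norm (1 - cnj (z j) * p) \<le> 3 * d" using d(1) p(2) dd by argo
  then have q4: "norm (q p) \<le> 4 * d"
    unfolding q_def using norm_triangle_ineq[of "1 - cnj (z j) * p" "of_real d"] d0 by simp
  have \<psi>p: "d / 4 \<le> norm (\<psi> (of_real r * p))"
  proof -
    have "of_real r * p - p = - (of_real (1 - r) * p)" by (simp add: algebra_simps)
    then have "norm (of_real r * p - p) = norm (complex_of_real (1 - r)) * norm p" by (metis norm_minus_cancel norm_mult)
    also have "\<dots> \<le> 1 - r" using r p unfolding norm_of_real by (simp add: mult_left_le)
    finally have "norm (of_real r * p - z j) \<le> (1 - r) + d / (2 * C)"
      using norm_triangle_ineq[of "of_real r * p - p" "p - z j"] p(2) by simp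
    then have "norm (of_real r * p - z j) \<le> d / (4 * C) + d / (2 * C)" using r(4) by linarith
    then have "C * norm (of_real r * p - z j) \<le> C * (d / (4 * C) + d / (2 * C))"
      using C1 by (intro mult_left_mono) auto
    also have "\<dots> = 3 * d / 4" using C1 by (simp add: field_simps)
    finally show ?thesis
      using bump_growth(2)[OF \<psi>(1,2) z nr[of p]] p d0 by simp
  qed
  have "(d / 4) ^ 5 * exp (Re (h p)) \<le> norm (\<psi> (of_real r * p)) ^ 5 * exp (Re (h p))"
    using \<psi>p d0 by (intro mult_right_mono power_mono) auto
  also note G1
  also have "exp 1296 * (4 * C * norm (q p)) ^ 5 \<le> exp 1296 * (4 * C * (4 * d)) ^ 5"
    using q4 C1 by (intro mult_left_mono power_mono) auto
  also have "\<dots> = (d / 4) ^ 5 * (exp 1296 * (64 * C) ^ 5)"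
  proof -
    have "4 * C * (4 * d) = (d / 4) * (64 * C)" by simp
    then show ?thesis by (simp only: power_mult_distrib mult.left_commute)
  qed
  finally have "(d / 4) ^ 5 * exp (Re (h p)) \<le> (d / 4) ^ 5 * (exp 1296 * (64 * C) ^ 5)" .
  then have "exp (Re (h p)) \<le> exp 1296 * (64 * C) ^ 5"
    using d0 by (subst (asm) mult_le_cancel_left_pos) auto
  also have "\<dots> = exp C3"
  proof -
    have "exp (5 * ln (64 * C)) = exp (ln (64 * C)) ^ 5" using exp_of_nat_mult[of 5 "ln (64 * C)"] by simp
    then show ?thesis using C1 by (simp add: C3_def exp_add)
  qed
  finally show ?thesis by simp
qed

text \<open>Reference point near \<open>z j\<close> of depth comparable to \<open>d\<close>, where
  \<open>h_upper\<close> and \<open>sum_at_retracted\<close> are available; kernels at circle points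
  are compared with their values here.\<close>

definition w0 where "w0 = (1 - of_real (d / (2 * C))) * z j"

lemma w0: "norm (w0 - z j) \<le> d / (2 * C)" "d / (2 * C) \<le> 1 - norm w0" "norm w0 < 1" "d / (2 * C) \<le> d"
proof -
  have t: "0 \<le> d / (2 * C)" "d / (2 * C) \<le> 1" using C1 d0 d(2) by (auto simp: field_simps)
  note rp = retracted_point[OF z t, of j, folded w0_def]
  show "norm (w0 - z j) \<le> d / (2 * C)" "d / (2 * C) \<le> 1 - norm w0" using rp by auto
  show "norm w0 < 1" using rp(3) z[of j] by linarith
  show "d / (2 * C) \<le> d" using d0 C1 by (auto simp: field_simps)
qed

section \<open>Cauchy radii at points of the circle\<close>

definition \<tau> where "\<tau> z0 = norm (q z0)"

definition rr where "rr z0 = min (infdist z0 E) (\<tau> z0)"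

text \<open>Makes \<open>7056 * \<kappa> * C = 1 / C3\<close>, where
  \<open>7056 = 2 * 8 * 441\<close> collects the constants of \<open>pole_near\<close>.\<close>

definition \<kappa> where "\<kappa> = 1 / (7056 * C * C3)"

text \<open>
  On the ball of radius \<open>rad z0\<close> about a point \<open>z0\<close> of the circle, \<open>h\<close> and the product over \<open>F\<close>
  stay under control, so Cauchy estimates there bound derivatives on the circle.
\<close>

definition rad where "rad z0 = \<kappa> * d * (rr z0 / \<tau> z0)\<^sup>2"

lemma \<kappa>: "0 < \<kappa>" "\<kappa> \<le> 1 / 1000"
proof -
  have "1000 * 1 \<le> (7056 * C) * C3" using C1 C3(1) by (intro mult_mono) auto
  then show "0 < \<kappa>" "\<kappa> \<le> 1 / 1000"
    unfolding \<kappa>_def by (auto intro!: divide_left_mono zero_less_divide_iff[THEN iffD2])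
qed

lemma circle_facts:
  assumes "norm z0 = 1"
  shows "0 < rr z0" "rr z0 \<le> \<tau> z0" "d \<le> \<tau> z0" "norm (z0 - w0) \<le> 2 * \<tau> z0" "0 < rad z0" 
    "rad z0 \<le> rr z0 / 1000" "rad z0 \<le> 1"
proof -
  have \<tau>: "d \<le> \<tau> z0" "norm (z0 - z j) \<le> \<tau> z0" using q_lower[of z0] assms by (auto simp: \<tau>_def)
  then show "d \<le> \<tau> z0" by simp
  show r: "0 < rr z0" "rr z0 \<le> \<tau> z0" using infdist_circle[OF assms] \<tau> d0 by (auto simp: rr_def)
  have "norm (z0 - w0) \<le> norm (z0 - z j) + norm (w0 - z j)"
    using norm_triangle_ineq4[of "z0 - z j" "w0 - z j"] by simp
  then show "norm (z0 - w0) \<le> 2 * \<tau> z0" using \<tau> w0(1,4) by linarith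
  have \<tau>0: "0 < \<tau> z0" using \<tau> d0 by linarith
  show "0 < rad z0" unfolding rad_def using \<kappa> d0 r \<tau>0 by (intro mult_pos_pos zero_less_power divide_pos_pos) auto
  have f: "rr z0 / \<tau> z0 \<le> 1" "0 \<le> rr z0 / \<tau> z0" using r \<tau>0 by auto
  have "rad z0 = \<kappa> * (d * (rr z0 / \<tau> z0) * (rr z0 / \<tau> z0))" by (simp add: rad_def power2_eq_square)
  also have "d * (rr z0 / \<tau> z0) * (rr z0 / \<tau> z0) \<le> \<tau> z0 * (rr z0 / \<tau> z0) * 1"
    using \<tau> f d0 less_imp_le[OF r(1)] by (intro mult_mono) auto
  also have "\<tau> z0 * (rr z0 / \<tau> z0) * 1 = rr z0" using \<tau>0 by simp
  finally have 1: "rad z0 \<le> \<kappa> * rr z0" using \<kappa>(1) by (simp add: mult_left_mono)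
  also have "\<dots> \<le> (1 / 1000) * rr z0" using \<kappa> r by (intro mult_right_mono) auto
  finally show "rad z0 \<le> rr z0 / 1000" by simp
  moreover have "rr z0 \<le> 2" using infdist_circle[OF assms] by (simp add: rr_def)
  ultimately show "rad z0 \<le> 1" by linarith
qed

text \<open>Exchanges \<open>z0\<close> for \<open>w0\<close> in a kernel at the price of the
  squared ratio of \<open>\<tau> z0\<close> to \<open>rr z0\<close>; the square in
  \<open>rad\<close> pays for exactly this factor. In \<open>441 = 21\<^sup>2\<close> the root is
  \<open>1 + 2 * 10\<close>.\<close>

lemma near_ratio:
  fixes x y c :: real
  assumes z0: "norm z0 = 1" and x: "rr z0 \<le> 10 * x" and y: "0 < y" "y \<le> x + 2 * \<tau> z0" and c: "0 \<le> c"
  shows "c / x\<^sup>2 \<le> 441 * (\<tau> z0 / rr z0)\<^sup>2 * (c / y\<^sup>2)"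
proof (rule divide_square_le[OF c y(1)])
  note cf = circle_facts[OF z0]
  show x0: "0 < x" using cf(1) x by linarith
  define m where "m = \<tau> z0 / rr z0"
  have m: "1 \<le> m" "\<tau> z0 = m * rr z0" using cf(1,2) by (auto simp: m_def)
  have "m * rr z0 \<le> m * (10 * x)" using x m(1) by (intro mult_left_mono) auto
  moreover have "1 * x \<le> m * x" using m(1) x0 by (intro mult_right_mono) auto
  ultimately have "y \<le> 21 * m * x" using y(2) m(2) by linarith
  then have "y\<^sup>2 \<le> (21 * m * x)\<^sup>2" using y(1) by (intro power_mono) auto
  then show "y\<^sup>2 \<le> 441 * (\<tau> z0 / rr z0)\<^sup>2 * x\<^sup>2" by (simp add: m_def power_mult_distrib power_divide)
qed

lemma rad_times:
  assumes z0: "norm z0 = 1"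
  shows "rad z0 * (\<tau> z0 / rr z0)\<^sup>2 = \<kappa> * d"
  using circle_facts(1-3)[OF z0] d0 by (simp add: rad_def power_divide)

lemma pole_near:
  assumes z0: "norm z0 = 1" and w: "norm (w - z0) \<le> rad z0" and k: "k \<in> J s"
  shows "pole s k \<noteq> w" "norm (kern (pole s k) w - kern (pole s k) z0) \<le> Re (kern (pole s k) w0) / C3"
proof -
  note cf = circle_facts[OF z0]
  define \<xi> where "\<xi> = pole s k"
  have n\<xi>: "1 \<le> norm \<xi>" "norm \<xi> \<le> 2" by (auto simp: \<xi>_def norm_pole)
  define x where "x = norm (\<xi> - z0)"
  define y where "y = norm (\<xi> - w0)"
  have "infdist z0 E \<le> 10 * x" unfolding x_def \<xi>_def by (rule pole_far[OF J_def z0 k])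
  then have x: "rr z0 \<le> 10 * x" by (simp add: rr_def)
  have x0: "0 < x" using x cf(1) by linarith
  have ne0: "\<xi> \<noteq> w0" "\<xi> \<noteq> z0" unfolding \<xi>_def using w0(3) z0 by (auto intro!: pole_distance(2))
  then have y: "0 < y" "y \<le> x + 2 * \<tau> z0"
    using norm_triangle_ineq[of "\<xi> - z0" "z0 - w0"] cf(4) by (auto simp: x_def y_def)
  have v: "x / 2 \<le> norm (\<xi> - w)"
  proof -
    have "x - norm (w - z0) \<le> norm (\<xi> - w)"
      using norm_triangle_ineq2[of "\<xi> - z0" "w - z0"] by (simp add: x_def)
    then show ?thesis using w cf(6) x x0 by linarith
  qed
  then have ne: "\<xi> \<noteq> w" using x0 by auto
  then show "pole s k \<noteq> w" by (simp add: \<xi>_def)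
  have nz: "\<xi> - w \<noteq> 0" "\<xi> - z0 \<noteq> 0" using ne ne0 by auto
  have "kern \<xi> w - kern \<xi> z0 = ((\<xi> + w) * (\<xi> - z0) - (\<xi> + z0) * (\<xi> - w)) / ((\<xi> - w) * (\<xi> - z0))"
    unfolding kern_def by (rule diff_frac_eq[OF nz])
  also have "(\<xi> + w) * (\<xi> - z0) - (\<xi> + z0) * (\<xi> - w) = 2 * \<xi> * (w - z0)" by (simp add: algebra_simps)
  finally have "norm (kern \<xi> w - kern \<xi> z0) = 2 * norm \<xi> * norm (w - z0) / (norm (\<xi> - w) * x)"
    by (simp add: norm_mult norm_divide x_def)
  also have "\<dots> \<le> 2 * 2 * rad z0 / (x / 2 * x)"
    using n\<xi> w v x0 cf(5) by (intro frac_le mult_mono mult_right_mono) auto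
  also have "\<dots> = 8 * rad z0 * (1 / x\<^sup>2)" by (simp add: power2_eq_square)
  also have "\<dots> \<le> 8 * rad z0 * (441 * (\<tau> z0 / rr z0)\<^sup>2 * (1 / y\<^sup>2))"
    using cf(5) by (intro mult_left_mono near_ratio[OF z0 x y]) auto
  also have "\<dots> = 3528 * (rad z0 * (\<tau> z0 / rr z0)\<^sup>2) * (1 / y\<^sup>2)" by simp
  also have "\<dots> = 7056 * \<kappa> * C * ((d / (2 * C)) / y\<^sup>2)" unfolding rad_times[OF z0] using C1 by simp
  also have "\<dots> \<le> 7056 * \<kappa> * C * Re (kern \<xi> w0)"
  proof (intro mult_left_mono)
    have "(norm w0)\<^sup>2 \<le> norm w0" using w0(3) by (simp add: power2_eq_square mult_left_le)
    moreover have "1 \<le> (norm \<xi>)\<^sup>2" using n\<xi> by (intro one_le_power) auto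
    ultimately have "d / (2 * C) \<le> (norm \<xi>)\<^sup>2 - (norm w0)\<^sup>2" using w0(2) by linarith
    then show "(d / (2 * C)) / y\<^sup>2 \<le> Re (kern \<xi> w0)"
      unfolding Re_kern[OF ne0(1)] y_def by (rule divide_right_mono) simp
  qed (use \<kappa> C1 in auto)
  also have "\<dots> = Re (kern \<xi> w0) / C3" using C1 C3(1) by (simp add: \<kappa>_def)
  finally show "norm (kern (pole s k) w - kern (pole s k) z0) \<le> Re (kern (pole s k) w0) / C3" by (simp add: \<xi>_def)
qed

text \<open>The variation of each kernel is charged to its own positive real part at
  \<open>w0\<close>. The weighted sum is \<open>Re (h w0) / C3\<close>, at most 1 by
  \<open>h_upper\<close>, so the number of kernels does not enter.\<close>

lemma h_near:
  assumes z0: "norm z0 = 1" and w: "norm (w - z0) \<le> rad z0"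
  shows "Re (h z0) - 1 \<le> Re (h w)"
proof -
  have "h w - h z0 = (\<Sum>s\<in>{s0..S1}. \<Sum>k\<in>J s. of_real (1 / 2 ^ s) * (kern (pole s k) w - kern (pole s k) z0))"
    by (simp add: h_def barrier_def sum_subtractf right_diff_distrib)
  also have "norm \<dots> \<le> (\<Sum>s\<in>{s0..S1}. \<Sum>k\<in>J s. 1 / 2 ^ s * (Re (kern (pole s k) w0) / C3))"
  proof (intro sum_norm_le)
    fix s k assume "k \<in> J s"
    from pole_near(2)[OF z0 w this]
    show "norm (of_real (1 / 2 ^ s) * (kern (pole s k) w - kern (pole s k) z0)) \<le> 1 / 2 ^ s * (Re (kern (pole s k) w0) / C3)"
    proof -
      assume *: "norm (kern (pole s k) w - kern (pole s k) z0) \<le> Re (kern (pole s k) w0) / C3"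
      have "norm (of_real (1 / 2 ^ s) :: complex) = 1 / 2 ^ s" by (simp add: norm_divide norm_power)
      then show ?thesis using mult_left_mono[OF *, of "1 / 2 ^ s"] unfolding norm_mult by simp
    qed
  qed
  also have "\<dots> = Re (h w0) / C3" unfolding h_def barrier_Re by (simp add: sum_divide_distrib)
  also have "\<dots> \<le> 1" using h_upper[OF w0(3,1)] C3(1) by simp
  finally have "norm (h z0 - h w) \<le> 1" by (simp add: norm_minus_commute)
  then show ?thesis using complex_Re_le_cmod[of "h z0 - h w"] by simp
qed

lemma zeros_near:
  assumes z0: "norm z0 = 1" and w: "norm (w - z0) \<le> rad z0" and l: "l \<in> F"
  shows "norm (z l - z0) / 2 \<le> norm (1 - cnj (z l) * w)" "rr z0 \<le> norm (z l - z0)"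
proof -
  note cf = circle_facts[OF z0]
  have "infdist z0 E \<le> dist z0 (z l)" using l by (intro infdist_le) (auto simp: E_def)
  then show r: "rr z0 \<le> norm (z l - z0)" by (simp add: rr_def dist_norm norm_minus_commute)
  have "norm (z l - z0) \<le> norm (1 - cnj (z l) * z0)" using z[of l] z0 by (intro dist_le_cnj) auto
  moreover have "1 - cnj (z l) * z0 = (1 - cnj (z l) * w) + cnj (z l) * (w - z0)" by (simp add: algebra_simps)
  then have "norm (1 - cnj (z l) * z0) \<le> norm (1 - cnj (z l) * w) + norm (cnj (z l) * (w - z0))"
    by (metis norm_triangle_ineq)
  moreover have "norm (cnj (z l) * (w - z0)) \<le> norm (w - z0)"
    using z[of l] by (simp add: norm_mult mult_left_le_one_le)
  ultimately show "norm (z l - z0) / 2 \<le> norm (1 - cnj (z l) * w)" using r w cf(1,6) by linarith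
qed

lemma near_W:
  assumes z0: "norm z0 = 1" and w: "norm (w - z0) \<le> rad z0"
  shows "w \<in> W" "\<tau> z0 / 2 \<le> norm (q w)"
proof -
  note cf = circle_facts[OF z0]
  have "q z0 - q w = cnj (z j) * (w - z0)" by (simp add: q_def algebra_simps)
  then have "norm (q z0 - q w) \<le> norm (w - z0)"
    using z[of j] by (simp add: norm_mult mult_left_le_one_le)
  then have "\<tau> z0 - norm (q w) \<le> rad z0" using norm_triangle_ineq2[of "q z0" "q w"] w by (simp add: \<tau>_def)
  then show q: "\<tau> z0 / 2 \<le> norm (q w)" using cf(1,2,6) by linarith
  have "q w \<noteq> 0" using q cf(1,2) by auto
  moreover have "1 - cnj (z l) * w \<noteq> 0" if "l \<in> F" for l
    using zeros_near[OF z0 w that] cf(1) by auto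
  moreover have "w \<notin> (\<Union>s\<in>{s0..S1}. pole s ` J s)" using pole_near(1)[OF z0 w] by fastforce
  ultimately show "w \<in> W" using F(1) by (auto simp: W_def)
qed

text \<open>Where the disc leaves the unit disc, a squared factor exceeds 1 by at most a multiple of
  \<open>rad z0 * (c l / (s l)\<^sup>2)\<close>. Comparison with \<open>w0\<close> leads to the sum
  of \<open>sum_at_retracted\<close>, and the choice of \<open>\<kappa>\<close> brings the total
  exponent down to 6.\<close>

lemma bprod_near:
  assumes z0: "norm z0 = 1" and w: "norm (w - z0) \<le> rad z0"
  shows "norm (bprod z F w) \<le> exp 3"
proof -
  note cf = circle_facts[OF z0]
  define c where "c l = 1 - norm (z l)" for l
  define s where "s l = norm (z l - z0)" for l
  have c: "0 < c l" "c l \<le> 1" for l using z[of l] by (auto simp: c_def)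
  have s: "rr z0 \<le> s l" "0 < s l" if "l \<in> F" for l
    using zeros_near(2)[OF z0 w that] cf(1) by (auto simp: s_def)
  have wn: "(norm w)\<^sup>2 - 1 \<le> 3 * rad z0"
  proof -
    have "norm w \<le> 1 + rad z0" using norm_triangle_ineq2[of w z0] z0 w by linarith
    then have "(norm w)\<^sup>2 \<le> (1 + rad z0)\<^sup>2" by (intro power_mono) auto
    also have "\<dots> = 1 + 2 * rad z0 + rad z0 * rad z0" by (simp add: power2_eq_square algebra_simps)
    also have "rad z0 * rad z0 \<le> 1 * rad z0" using cf(5,7) by (intro mult_right_mono) auto
    finally show ?thesis by linarith
  qed
  have one: "(norm (bfactor (z l) w))\<^sup>2 \<le> exp (24 * rad z0 * (c l / (s l)\<^sup>2))" if l: "l \<in> F" for l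
  proof -
    define x where "x = norm (1 - cnj (z l) * w)"
    have x: "s l / 2 \<le> x" "0 < x" using zeros_near(1)[OF z0 w l] s(2)[OF l] by (auto simp: x_def s_def)
    have nz: "1 - cnj (z l) * w \<noteq> 0" using x by (auto simp: x_def)
    have "0 \<le> (1 - norm (z l))\<^sup>2" by simp
    then have c2: "1 - (norm (z l))\<^sup>2 \<le> 2 * c l" "0 \<le> 1 - (norm (z l))\<^sup>2"
      using z[of l] by (auto simp: c_def power2_eq_square algebra_simps mult_le_one)
    have "(norm (bfactor (z l) w))\<^sup>2 = 1 + (1 - (norm (z l))\<^sup>2) * ((norm w)\<^sup>2 - 1) / x\<^sup>2"
      unfolding norm_bfactor_square[OF nz] x_def by (simp add: algebra_simps diff_divide_distrib)
    also have "\<dots> \<le> 1 + (2 * c l) * (3 * rad z0) / (s l / 2)\<^sup>2"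
    proof -
      have "(1 - (norm (z l))\<^sup>2) * ((norm w)\<^sup>2 - 1) \<le> (1 - (norm (z l))\<^sup>2) * (3 * rad z0)"
        using wn c2 by (intro mult_left_mono) auto
      also have "\<dots> \<le> (2 * c l) * (3 * rad z0)" using c2 cf(5) by (intro mult_right_mono) auto
      finally have "(1 - (norm (z l))\<^sup>2) * ((norm w)\<^sup>2 - 1) / x\<^sup>2 \<le> (2 * c l) * (3 * rad z0) / x\<^sup>2"
        by (rule divide_right_mono) simp
      also have "\<dots> \<le> (2 * c l) * (3 * rad z0) / (s l / 2)\<^sup>2"
        using x s(2)[OF l] c[of l] cf(5) by (intro divide_left_mono power_mono mult_pos_pos zero_less_power) auto
      finally show ?thesis by simp
    qed
    also have "\<dots> = 1 + 24 * rad z0 * (c l / (s l)\<^sup>2)" by (simp add: power_divide)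
    also have "\<dots> \<le> exp (24 * rad z0 * (c l / (s l)\<^sup>2))" by (rule exp_ge_add_one_self)
    finally show ?thesis .
  qed
  have "(\<Sum>l\<in>F. c l / (s l)\<^sup>2) \<le> (\<Sum>l\<in>F. 441 * (\<tau> z0 / rr z0)\<^sup>2 * (c l / (norm (1 - cnj (z l) * w0))\<^sup>2))"
  proof (rule sum_mono)
    fix l assume l: "l \<in> F"
    show "c l / (s l)\<^sup>2 \<le> 441 * (\<tau> z0 / rr z0)\<^sup>2 * (c l / (norm (1 - cnj (z l) * w0))\<^sup>2)"
    proof (rule near_ratio[OF z0])
      show "rr z0 \<le> 10 * s l" using s[OF l] by linarith
      show "0 < norm (1 - cnj (z l) * w0)" using one_minus_cnj_pos(3)[OF z, of w0 l] w0(3) by simp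
      have "norm (1 - cnj (z l) * z0) = s l"
      proof -
        have "norm (bfactor (z l) z0) = 1" by (rule norm_bfactor_circle[OF z z0])
        then have "norm (z l - z0) / norm (1 - cnj (z l) * z0) = 1" unfolding norm_bfactor .
        moreover have "z l \<noteq> z0" using z[of l] z0 by auto
        ultimately show ?thesis unfolding s_def by (simp add: divide_eq_1_iff)
      qed
      moreover have "1 - cnj (z l) * w0 = (1 - cnj (z l) * z0) + cnj (z l) * (z0 - w0)" by (simp add: algebra_simps)
      then have "norm (1 - cnj (z l) * w0) \<le> norm (1 - cnj (z l) * z0) + norm (cnj (z l) * (z0 - w0))"
        by (metis norm_triangle_ineq)
      moreover have "norm (cnj (z l) * (z0 - w0)) \<le> norm (z0 - w0)"
        using z[of l] by (simp add: norm_mult mult_left_le_one_le)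
      ultimately show "norm (1 - cnj (z l) * w0) \<le> s l + 2 * \<tau> z0" using cf(4) by linarith
    qed (use c[of l] in simp)
  qed
  also have "\<dots> = 441 * (\<tau> z0 / rr z0)\<^sup>2 * (\<Sum>l\<in>F. c l / (norm (1 - cnj (z l) * w0))\<^sup>2)"
    by (simp add: sum_distrib_left)
  also have "\<dots> \<le> 441 * (\<tau> z0 / rr z0)\<^sup>2 * (4 * C * ln (16 * C) / d)"
    unfolding c_def by (intro mult_left_mono sum_at_retracted[OF C z inj d F(1,3) w0_def]) auto
  finally have sum: "(\<Sum>l\<in>F. c l / (s l)\<^sup>2) \<le> 441 * (\<tau> z0 / rr z0)\<^sup>2 * (4 * C * ln (16 * C) / d)" .
  have "(norm (bprod z F w))\<^sup>2 = (\<Prod>l\<in>F. (norm (bfactor (z l) w))\<^sup>2)"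
    by (simp add: bprod_def prod_norm[symmetric] prod_power_distrib)
  also have "\<dots> \<le> (\<Prod>l\<in>F. exp (24 * rad z0 * (c l / (s l)\<^sup>2)))"
    using one by (intro prod_mono) auto
  also have "\<dots> = exp (24 * rad z0 * (\<Sum>l\<in>F. c l / (s l)\<^sup>2))"
    using F(1) by (simp add: exp_sum sum_distrib_left)
  also have "\<dots> \<le> exp 6"
  proof -
    have "24 * rad z0 * (\<Sum>l\<in>F. c l / (s l)\<^sup>2) \<le> 24 * rad z0 * (441 * (\<tau> z0 / rr z0)\<^sup>2 * (4 * C * ln (16 * C) / d))"
      using sum cf(5) by (intro mult_left_mono) auto
    also have "\<dots> = 24 * 441 * (rad z0 * (\<tau> z0 / rr z0)\<^sup>2) * (4 * C * ln (16 * C) / d)" by simp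
    also have "\<dots> = 6 * (7056 * \<kappa> * C * ln (16 * C))" unfolding rad_times[OF z0] using d0 by simp
    also have "7056 * \<kappa> * C * ln (16 * C) = ln (16 * C) / C3" using C1 C3(1) by (simp add: \<kappa>_def)
    also have "\<dots> \<le> 1" using C3 by simp
    finally show ?thesis by simp
  qed
  also have "\<dots> = (exp 3)\<^sup>2" by (simp add: exp_double[symmetric])
  finally show ?thesis by (rule power2_le_imp_le) simp
qed

text \<open>The factor \<open>64 * (n + 1)\<close> turns the lower bound \<open>t / 32\<close> for
  \<open>Re h\<close> into decay of order \<open>(rr / d) ^ (2 * n + 2)\<close> on the circle. The
  powers of \<open>d\<close> and \<open>q\<close> fit two demands: \<open>core * \<tau> ^ n\<close>
  of order \<open>rad ^ (n + 1)\<close> on the circle, and \<open>core\<close> of order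
  \<open>d\<close> at \<open>z j\<close>.\<close>

definition core where
  "core n w = of_real (d ^ (3 * n + 3)) * exp (- (of_real (64 * (real n + 1)) * h w)) / q w ^ (3 * n + 2)"

definition Bf where "Bf n = 64 ^ n * 16 * exp (64 * (real n + 1)) / \<kappa> ^ (n + 1)"

lemma core_holo: "core n holomorphic_on W"
  unfolding core_def[abs_def] q_def by (intro holomorphic_intros h_holo) (auto simp: W_def q_def)

lemma norm_core: "norm (core n w) = d ^ (3 * n + 3) * exp (- (64 * (real n + 1) * Re (h w))) / norm (q w) ^ (3 * n + 2)"
  using d0 unfolding core_def norm_divide norm_mult norm_power norm_of_real norm_exp_eq_Re by simp

lemma exp_h_circle:
  assumes z0: "norm z0 = 1"
  shows "exp (- (64 * (real n + 1) * Re (h z0))) \<le> (2 * rr z0 / d) ^ (2 * n + 2)"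
proof -
  note cf = circle_facts[OF z0]
  obtain t where t: "1 / 2 ^ t \<le> 2 * infdist z0 E / d" "real t / 32 \<le> Re (h z0)"
    using barrier_circle[OF z0] by blast
  have "exp (- (64 * (real n + 1) * Re (h z0))) \<le> exp (- (64 * (real n + 1) * (real t / 32)))"
    using t(2) by simp
  also have "\<dots> = exp (real (2 * n + 2) * (real t * (- 1)))" by (simp add: algebra_simps)
  also have "\<dots> = (exp (- 1) ^ t) ^ (2 * n + 2)" by (simp only: exp_of_nat_mult)
  also have "\<dots> \<le> (2 * rr z0 / d) ^ (2 * n + 2)"
  proof (intro power_mono)
    have "exp (- 1) \<le> (1 / 2 :: real)" using exp_ge_add_one_self[of 1] by (simp add: exp_minus field_simps)
    then have e: "exp (- 1) ^ t \<le> (1 / 2 :: real) ^ t" by (intro power_mono) auto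
    show "exp (- 1) ^ t \<le> 2 * rr z0 / d"
    proof (cases "infdist z0 E \<le> \<tau> z0")
      case True
      then show ?thesis using e t(1) by (simp add: rr_def power_divide)
    next
      case False
      have "(1 / 2 :: real) ^ t \<le> 1" by (intro power_le_one) auto
      also have "1 \<le> 2 * rr z0 / d" using False cf(3) d0 by (simp add: rr_def field_simps)
      finally show ?thesis using e by simp
    qed
  qed simp
  finally show ?thesis .
qed

lemma core_near:
  assumes z0: "norm z0 = 1" and w: "norm (w - z0) \<le> rad z0" and p: "norm p \<le> 2 * \<tau> z0"
  shows "norm (core n w) * norm p ^ n \<le> Bf n * rad z0 ^ (n + 1)"
proof -
  note cf = circle_facts[OF z0]
  define M where "M = 64 * (real n + 1)"
  have \<tau>0: "0 < \<tau> z0" using cf(1,2) by linarith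
  have q2: "0 < \<tau> z0 / 2" "\<tau> z0 / 2 \<le> norm (q w)" using near_W(2)[OF z0 w] \<tau>0 by auto
  have "exp (- (M * Re (h w))) \<le> exp (M + - (M * Re (h z0)))"
  proof -
    have "M * (Re (h z0) - 1) \<le> M * Re (h w)" using h_near[OF z0 w] by (intro mult_left_mono) (auto simp: M_def)
    then show ?thesis by (simp add: algebra_simps)
  qed
  also have "\<dots> = exp M * exp (- (M * Re (h z0)))" by (rule exp_add)
  also have "\<dots> \<le> exp M * (2 * rr z0 / d) ^ (2 * n + 2)"
    using exp_h_circle[OF z0] by (intro mult_left_mono) (auto simp: M_def)
  finally have e: "exp (- (M * Re (h w))) \<le> exp M * (2 * rr z0 / d) ^ (2 * n + 2)" .
  have "norm (core n w) * norm p ^ n \<le> (d ^ (3 * n + 3) * (exp M * (2 * rr z0 / d) ^ (2 * n + 2)) / (\<tau> z0 / 2) ^ (3 * n + 2)) * (2 * \<tau> z0) ^ n"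
    unfolding norm_core M_def[symmetric] using e p q2 d0 cf(1) \<tau>0
    by (intro mult_mono frac_le power_mono mult_left_mono divide_nonneg_pos mult_nonneg_nonneg) auto
  also have "\<dots> = (d ^ 3 * (2 * rr z0 / d)\<^sup>2 / (\<tau> z0 / 2) ^ 3 * (2 * \<tau> z0)) ^ n * (exp M * (d ^ 3 * (2 * rr z0 / d)\<^sup>2 / (\<tau> z0 / 2)\<^sup>2))"
  proof -
    have "x ^ (3 * n + 3) = (x ^ 3) ^ n * x ^ 3" "x ^ (2 * n + 2) = (x\<^sup>2) ^ n * x\<^sup>2" "x ^ (3 * n + 2) = (x ^ 3) ^ n * x\<^sup>2" for x :: real
      by (simp_all only: power_add power_mult)
    note split = this
    have gen: "(a ^ n * a * (m * (b ^ n * b)) / (t ^ n * t')) * p ^ n = (a * b / t * p) ^ n * (m * (a * b / t'))"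
      for a b m t t' p :: real
      by (simp add: power_mult_distrib power_divide)
    show ?thesis unfolding split by (rule gen)
  qed
  also have "d ^ 3 * (2 * rr z0 / d)\<^sup>2 / (\<tau> z0 / 2) ^ 3 * (2 * \<tau> z0) = 64 * (rad z0 / \<kappa>)"
    using d0 \<tau>0 \<kappa>(1) unfolding rad_def by (simp add: power_divide field_simps power2_eq_square power3_eq_cube)
  also have "d ^ 3 * (2 * rr z0 / d)\<^sup>2 / (\<tau> z0 / 2)\<^sup>2 = 16 * (rad z0 / \<kappa>)"
    using d0 \<tau>0 \<kappa>(1) unfolding rad_def by (simp add: power_divide field_simps power2_eq_square power3_eq_cube)
  also have "(64 * (rad z0 / \<kappa>)) ^ n * (exp M * (16 * (rad z0 / \<kappa>))) = Bf n * rad z0 ^ (n + 1)"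
    by (simp add: Bf_def M_def power_mult_distrib power_divide mult_ac)
  finally show ?thesis .
qed

text \<open>The power of \<open>rad z0\<close> in the hypothesis cancels in Cauchy's inequality.
  Bounds on the circle suffice, since the \<open>N\<close>-th derivative is holomorphic on
  \<open>W\<close> and obeys the maximum principle.\<close>

lemma circle_deriv_bound:
  assumes G: "G holomorphic_on W" and B: "0 \<le> B"
    and b: "\<And>z0 w. norm z0 = 1 \<Longrightarrow> norm (w - z0) \<le> rad z0 \<Longrightarrow> norm (G w) \<le> B * rad z0 ^ N"
  shows "deriv_bounded N (fact N * B) G"
  unfolding deriv_bounded_def
proof (intro conjI ballI)
  show "G holomorphic_on disc" by (rule holomorphic_on_subset[OF G]) (use W(2) ball_subset_cball[of 0 1] in blast)
  have dG: "(deriv ^^ N) G holomorphic_on W" by (rule holomorphic_higher_deriv[OF G W(1)])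
  fix w :: complex assume w: "w \<in> disc"
  show "norm ((deriv ^^ N) G w) \<le> fact N * B"
  proof (rule maximum_modulus_frontier[of "(deriv ^^ N) G" "cball 0 1"])
    show "(deriv ^^ N) G holomorphic_on interior (cball 0 1)"
      by (rule holomorphic_on_subset[OF dG]) (use W(2) interior_subset in blast)
    show "continuous_on (closure (cball 0 1)) ((deriv ^^ N) G)"
      using continuous_on_subset[OF holomorphic_on_imp_continuous_on[OF dG] W(2)] by simp
    show "norm ((deriv ^^ N) G z0) \<le> fact N * B" if "z0 \<in> frontier (cball 0 1)" for z0
    proof -
      have z0: "norm z0 = 1" using that by (simp add: frontier_cball)
      note cf = circle_facts[OF z0]
      have "norm ((deriv ^^ N) G z0) \<le> fact N * (B * rad z0 ^ N) / rad z0 ^ N"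
      proof (rule cauchy_ball_bound[of z0 "rad z0" G])
        show "G field_differentiable at w" if "norm (w - z0) \<le> rad z0" for w
          using holomorphic_on_imp_differentiable_at[OF G W(1) near_W(1)[OF z0 that]] .
        show "norm (G w) \<le> B * rad z0 ^ N" if "norm (w - z0) \<le> rad z0" for w by (rule b[OF z0 that])
      qed (use cf B in auto)
      also have "\<dots> = fact N * B" using cf(5) by simp
      finally show ?thesis .
    qed
  qed (use w in auto)
qed

text \<open>\<open>TK\<close> and \<open>tc\<close> depend on \<open>C\<close> and \<open>n\<close>
  only, not on \<open>j\<close>, \<open>d\<close> or \<open>F\<close>; this uniformity lets them
  survive the limit over \<open>F\<close> and the later summation over many zeros.\<close>

definition TK where "TK n = max (2 ^ (n + 1)) (fact (n + 1) * (Bf n * exp 3 ^ n))"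

definition tc where "tc n = exp (- (64 * (real n + 1) * C3)) / 3 ^ (3 * n + 2)"

lemma tc_pos: "0 < tc n"
  by (simp add: tc_def)

text \<open>The function is \<open>core\<close> times \<open>(1 - cnj a * w) ^ n\<close>.
  Multiplication by the \<open>n\<close>-th power of the factor of \<open>z j\<close> cancels its
  denominator and replaces \<open>1 - cnj a * w\<close> by \<open>u * (a - w)\<close>, so both
  functions fall under the same circle estimate \<open>core_near\<close>.\<close>

lemma test_function:
  "\<exists>f. deriv_bounded 0 (TK n) f \<and> deriv_bounded (n + 1) (TK n) f \<and>
     deriv_bounded (n + 1) (TK n) (\<lambda>w. f w * bprod z (insert j F) w ^ n) \<and>
     tc n * d * (1 - norm (z j)) ^ n \<le> norm (f (z j))"
proof -
  define a where "a = z j"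
  have a1: "norm a < 1" using z by (simp add: a_def)
  define u where "u = (if a = 0 then -1 else cnj a / of_real (norm a))"
  have u: "norm u = 1" by (simp add: u_def norm_divide)
  define f where "f w = core n w * (1 - cnj a * w) ^ n" for w
  define g where "g w = core n w * (u * (a - w)) ^ n * bprod z F w ^ n" for w
  have Bf0: "0 \<le> Bf n" using \<kappa>(1) by (simp add: Bf_def)
  have near: "norm (1 - cnj a * w) \<le> 2 * \<tau> z0" "norm (u * (a - w)) \<le> 2 * \<tau> z0"
    if z0: "norm z0 = 1" and w: "norm (w - z0) \<le> rad z0" for z0 w
  proof -
    note cf = circle_facts[OF z0]
    have r: "rad z0 \<le> \<tau> z0" using cf by linarith
    have "1 - cnj a * w = (1 - cnj a * z0) - cnj a * (w - z0)" by (simp add: algebra_simps)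
    then have "norm (1 - cnj a * w) \<le> norm (1 - cnj a * z0) + norm (cnj a * (w - z0))"
      by (metis norm_triangle_ineq4)
    moreover have "norm (cnj a * (w - z0)) \<le> norm (w - z0)"
      using a1 by (simp add: norm_mult mult_left_le_one_le)
    moreover have "norm (1 - cnj a * z0) \<le> \<tau> z0" using q_lower(3)[of z0] z0 by (simp add: \<tau>_def a_def)
    ultimately show "norm (1 - cnj a * w) \<le> 2 * \<tau> z0" using w r by linarith
    have "norm (a - w) \<le> norm (z0 - a) + norm (w - z0)"
      using norm_triangle_ineq[of "z0 - a" "w - z0"] by (simp add: norm_minus_commute)
    moreover have "norm (z0 - a) \<le> \<tau> z0" using q_lower(2)[of z0] z0 by (simp add: \<tau>_def a_def)
    ultimately show "norm (u * (a - w)) \<le> 2 * \<tau> z0" unfolding norm_mult u using w r by linarith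
  qed
  have fW: "f holomorphic_on W" unfolding f_def by (intro holomorphic_intros core_holo)
  have bW: "bprod z F holomorphic_on W"
    unfolding bprod_def[abs_def] bfactor_def[abs_def] using F(1)
    by (intro holomorphic_on_prod holomorphic_intros) (auto simp: W_def)
  have gW: "g holomorphic_on W" unfolding g_def by (intro holomorphic_intros core_holo bW)
  have f1: "deriv_bounded (n + 1) (fact (n + 1) * Bf n) f"
  proof (rule circle_deriv_bound[OF fW Bf0])
    fix z0 w :: complex assume z0: "norm z0 = 1" and w: "norm (w - z0) \<le> rad z0"
    show "norm (f w) \<le> Bf n * rad z0 ^ (n + 1)"
      unfolding f_def norm_mult norm_power by (rule core_near[OF z0 w near(1)[OF z0 w]])
  qed
  have g1: "deriv_bounded (n + 1) (fact (n + 1) * (Bf n * exp 3 ^ n)) g"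
  proof (rule circle_deriv_bound[OF gW])
    fix z0 w :: complex assume z0: "norm z0 = 1" and w: "norm (w - z0) \<le> rad z0"
    have "norm (g w) = (norm (core n w) * norm (u * (a - w)) ^ n) * norm (bprod z F w) ^ n"
      by (simp add: g_def norm_mult norm_power)
    also have "\<dots> \<le> (Bf n * rad z0 ^ (n + 1)) * exp 3 ^ n"
      using circle_facts[OF z0] Bf0
      by (intro mult_mono power_mono core_near[OF z0 w near(2)[OF z0 w]] bprod_near[OF z0 w]) auto
    finally show "norm (g w) \<le> Bf n * exp 3 ^ n * rad z0 ^ (n + 1)" by (simp add: algebra_simps)
  qed (use Bf0 in simp)
  have jF: "j \<notin> F" using F(3)[of j] d0 by auto
  have eq: "f w * bprod z (insert j F) w ^ n = g w" if w: "norm w < 1" for w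
  proof -
    have nz: "1 - cnj a * w \<noteq> 0" using one_minus_cnj_pos(3)[OF a1, of w] w by simp
    have "(1 - cnj a * w) * bfactor a w = u * (a - w)" using nz by (simp add: bfactor_def u_def)
    then have "(1 - cnj a * w) * bprod z (insert j F) w = u * (a - w) * bprod z F w"
      using jF F(1) by (simp add: bprod_def a_def flip: mult.assoc)
    then have "(1 - cnj a * w) ^ n * bprod z (insert j F) w ^ n = (u * (a - w)) ^ n * bprod z F w ^ n"
      by (metis power_mult_distrib)
    then show ?thesis by (simp add: f_def g_def mult.assoc)
  qed
  have e3: "1 \<le> exp (3::real) ^ n" by (intro one_le_power) simp
  have "fact (n + 1) * Bf n * 1 \<le> fact (n + 1) * Bf n * exp 3 ^ n"
    using Bf0 e3 by (intro mult_left_mono mult_nonneg_nonneg) auto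
  then have TK1: "fact (n + 1) * Bf n \<le> TK n" "fact (n + 1) * (Bf n * exp 3 ^ n) \<le> TK n"
    unfolding TK_def by (auto simp: le_max_iff_disj mult.assoc)
  have f2: "deriv_bounded (n + 1) (TK n) f" by (rule deriv_bounded_mono[OF f1 TK1(1)])
  have "deriv_bounded (n + 1) (TK n) g" by (rule deriv_bounded_mono[OF g1 TK1(2)])
  then have g2: "deriv_bounded (n + 1) (TK n) (\<lambda>w. f w * bprod z (insert j F) w ^ n)"
    using deriv_bounded_cong[of "\<lambda>w. f w * bprod z (insert j F) w ^ n" g] eq by simp
  have f0: "deriv_bounded 0 (TK n) f"
    unfolding deriv_bounded_def
  proof (intro conjI ballI)
    show "f holomorphic_on disc" by (rule deriv_bounded_holo[OF f2])
    fix w :: complex assume "w \<in> disc"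
    then have w: "norm w \<le> 1" by simp
    have "norm (cnj a * w) \<le> 1" using a1 w by (simp add: norm_mult mult_le_one)
    then have 1: "norm (1 - cnj a * w) \<le> 2" using norm_triangle_ineq4[of 1 "cnj a * w"] by simp
    have "0 \<le> Re (h w)" unfolding h_def by (rule barrier_nonneg[OF w])
    then have e1: "exp (- (64 * (real n + 1) * Re (h w))) \<le> 1" by simp
    have "norm (core n w) \<le> d ^ (3 * n + 3) * 1 / d ^ (3 * n + 2)"
      unfolding norm_core using e1 q_lower(1)[OF w] d0
      by (intro frac_le mult_left_mono power_mono) auto
    also have "\<dots> = d"
      using d0 power_Suc[of d "3 * n + 2"] by (simp only: mult_1_right) (simp add: numeral_3_eq_3)
    finally have 2: "norm (core n w) \<le> 2" using d(2) by simp
    have "norm (f w) \<le> 2 * 2 ^ n"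
      unfolding f_def norm_mult norm_power using 1 2 by (intro mult_mono power_mono) auto
    then show "norm ((deriv ^^ 0) f w) \<le> TK n" by (simp add: TK_def le_max_iff_disj)
  qed
  have low: "tc n * d * (1 - norm (z j)) ^ n \<le> norm (f (z j))"
  proof -
    have "norm a * norm a \<le> norm a" using a1 by (simp add: mult_left_le)
    then have r: "1 - norm a \<le> 1 - (norm a)\<^sup>2" by (simp add: power2_eq_square)
    have eqa: "1 - cnj a * a = of_real (1 - (norm a)\<^sup>2)"
      by (simp add: mult.commute[of "cnj a"] complex_norm_square[symmetric])
    have na: "norm (1 - cnj a * a) = 1 - (norm a)\<^sup>2"
      unfolding eqa norm_of_real using r a1 by simp
    have "norm (1 - cnj a * a) \<le> 2 * (1 - norm a)" using cnj_le_dist[of a a] a1 by simp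
    then have q3: "norm (q a) \<le> 3 * d"
      unfolding q_def a_def[symmetric] using norm_triangle_ineq[of "1 - cnj a * a" "of_real d"] d(1) d0
      by (simp add: a_def)
    have qa: "0 < norm (q a)" using q_lower(4)[of a] a1 by simp
    have h3: "Re (h a) \<le> C3" by (rule h_upper) (use a1 C1 d0 in \<open>auto simp: a_def\<close>)
    have ex: "exp (- (64 * (real n + 1) * C3)) \<le> exp (- (64 * (real n + 1) * Re (h a)))"
      using h3 by simp
    have "tc n * d = d ^ (3 * n + 3) * exp (- (64 * (real n + 1) * C3)) / (3 * d) ^ (3 * n + 2)"
    proof -
      have "d ^ (3 * n + 3) = d * d ^ (3 * n + 2)" by (simp add: numeral_3_eq_3)
      then show ?thesis using d0 by (simp add: tc_def power_mult_distrib)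
    qed
    also have "\<dots> \<le> norm (core n a)"
      unfolding norm_core using ex q3 qa d0
      by (intro frac_le mult_left_mono power_mono) auto
    finally have "tc n * d \<le> norm (core n a)" .
    moreover have "(1 - norm a) ^ n \<le> norm (1 - cnj a * a) ^ n"
      unfolding na using r a1 by (intro power_mono) auto
    moreover have "0 \<le> (1 - norm a) ^ n" using a1 by (intro zero_le_power) simp
    ultimately have "(tc n * d) * (1 - norm a) ^ n \<le> norm (core n a) * norm (1 - cnj a * a) ^ n"
      by (intro mult_mono) auto
    then show ?thesis by (simp add: f_def a_def norm_mult norm_power)
  qed
  show ?thesis using f0 f2 g2 low by blast
qed

end

lemma test_function_limit:
  assumes C: "bump_const z C" and z: "blaschke_seq z" and inj: "inj z"
    and d: "1 - norm (z j) \<le> d" "d \<le> 2" "\<And>l. l \<noteq> j \<Longrightarrow> d \<le> norm (z l - z j)"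
  shows "\<exists>f. deriv_bounded 0 (test_setting.TK C n) f \<and> deriv_bounded (n + 1) (test_setting.TK C n) f \<and>
     deriv_bounded (n + 1) (test_setting.TK C n) (\<lambda>w. f w * blaschke z w ^ n) \<and>
     test_setting.tc C n * d * (1 - norm (z j)) ^ n \<le> norm (f (z j))"
    and "0 < test_setting.tc C n"
proof -
  note z1 = blaschke_seqD(1)[OF z]
  define K where "K = test_setting.TK C n"
  define c where "c = test_setting.tc C n * d * (1 - norm (z j)) ^ n"
  have ex: "0 < test_setting.tc C n \<and> (\<exists>f. deriv_bounded 0 K f \<and> deriv_bounded (n + 1) K f \<and>
     deriv_bounded (n + 1) K (\<lambda>w. f w * bprod z {..<i + j + 2} w ^ n) \<and> c \<le> norm (f (z j)))" for i
  proof -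
    \<comment> \<open>The offset 2 puts \<open>Suc j\<close> into the index set, so that
      \<open>F\<close> is nonempty.\<close>
    have "{..<i + j + 2} - {j} \<noteq> {}"
    proof -
      have "Suc j \<in> {..<i + j + 2} - {j}" by simp
      then show ?thesis by blast
    qed
    then interpret test_setting z C j d "{..<i + j + 2} - {j}"
      using C z1 inj d by unfold_locales auto
    have "insert j ({..<i + j + 2} - {j}) = {..<i + j + 2}" by auto
    then show ?thesis using test_function[of n] tc_pos by (simp add: K_def c_def)
  qed
  then show "0 < test_setting.tc C n" by blast
  have "\<forall>i. \<exists>f. deriv_bounded 0 K f \<and> deriv_bounded (n + 1) K f \<and>
     deriv_bounded (n + 1) K (\<lambda>w. f w * bprod z {..<i + j + 2} w ^ n) \<and> c \<le> norm (f (z j))" using ex by blast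
  then obtain f where f: "\<forall>i. deriv_bounded 0 K (f i) \<and> deriv_bounded (n + 1) K (f i) \<and>
     deriv_bounded (n + 1) K (\<lambda>w. f i w * bprod z {..<i + j + 2} w ^ n) \<and> c \<le> norm (f i (z j))"
    by (rule choice[THEN exE])
  have h: "f i holomorphic_on disc" for i using f deriv_bounded_holo by blast
  have b: "norm (f i w) \<le> K" if "norm w < 1" for i w
    using f deriv_boundedD[of 0 K "f i" w] that by simp
  obtain g r where g: "g holomorphic_on disc" "strict_mono (r :: nat \<Rightarrow> nat)"
    "\<And>w. norm w < 1 \<Longrightarrow> (\<lambda>i. f (r i) w) \<longlonglongrightarrow> g w"
    using bounded_deriv_limit[OF h b, of "\<lambda>i. i"] by metis
  have g0: "deriv_bounded 0 K g"
    by (rule deriv_bounded_pointwise_limit[where f = "\<lambda>i. f (r i)" and C = K]) (use f b g in auto)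
  have g1: "deriv_bounded (n + 1) K g"
    by (rule deriv_bounded_pointwise_limit[where f = "\<lambda>i. f (r i)" and C = K]) (use f b g in auto)
  have "deriv_bounded (n + 1) K (\<lambda>w. g w * blaschke z w ^ n)"
  proof (rule deriv_bounded_pointwise_limit[where f = "\<lambda>i w. f (r i) w * bprod z {..<r i + j + 2} w ^ n" and C = K])
    show "deriv_bounded (n + 1) K (\<lambda>w. f (r i) w * bprod z {..<r i + j + 2} w ^ n)" for i
      using f by blast
    fix w :: complex assume w: "norm w < 1"
    show "norm (f (r i) w * bprod z {..<r i + j + 2} w ^ n) \<le> K" for i
    proof -
      have "norm (bprod z {..<r i + j + 2} w) \<le> 1" using z1 w by (intro norm_bprod_le_1) auto
      then have "norm (f (r i) w) * norm (bprod z {..<r i + j + 2} w) ^ n \<le> norm (f (r i) w) * 1"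
        by (intro mult_left_mono power_le_one) auto
      then show ?thesis using b[OF w, of "r i"] by (simp add: norm_mult norm_power)
    qed
    have "(\<lambda>i. bprod z {..<i + (j + 2)} w) \<longlonglongrightarrow> blaschke z w"
      using LIMSEQ_ignore_initial_segment[OF bprod_LIMSEQ[OF z w]] .
    from LIMSEQ_subseq_LIMSEQ[OF this g(2)]
    have "(\<lambda>i. bprod z {..<r i + j + 2} w) \<longlonglongrightarrow> blaschke z w" by (simp add: o_def add.assoc)
    then show "(\<lambda>i. f (r i) w * bprod z {..<r i + j + 2} w ^ n) \<longlonglongrightarrow> g w * blaschke z w ^ n"
      by (intro tendsto_intros g(3) w)
  qed
  moreover have "c \<le> norm (g (z j))"
    by (rule tendsto_lowerbound[OF tendsto_norm[OF g(3)[OF z1]]]) (use f in auto)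
  ultimately show "\<exists>f. deriv_bounded 0 (test_setting.TK C n) f \<and> deriv_bounded (n + 1) (test_setting.TK C n) f \<and>
     deriv_bounded (n + 1) (test_setting.TK C n) (\<lambda>w. f w * blaschke z w ^ n) \<and>
     test_setting.tc C n * d * (1 - norm (z j)) ^ n \<le> norm (f (z j))"
    using g0 g1 by (auto simp: K_def c_def)
qed

section \<open>The ideals\<close>

lemma deriv_bounded_sum:
  fixes m :: nat
  assumes "\<And>i. i < m \<Longrightarrow> deriv_bounded N (K i) (f i)"
  shows "deriv_bounded N (\<Sum>i<m. K i) (\<lambda>w. \<Sum>i<m. f i w)"
  using assms
proof (induction m)
  case 0
  have "(deriv ^^ N) (\<lambda>z. 0::complex) = (\<lambda>z. 0)" by (induction N) auto
  then show ?case by (simp add: deriv_bounded_def)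
next
  case (Suc m)
  then show ?case using deriv_bounded_add[of N "\<Sum>i<m. K i" "\<lambda>w. \<Sum>i<m. f i w" "K m" "f m"] by simp
qed

lemma deriv_bounded_subset_sum:
  assumes f: "\<And>i. deriv_bounded N (K / 2 ^ i) (f i)" and K: "\<And>i w. norm w < 1 \<Longrightarrow> norm (f i w) \<le> K / 2 ^ i"
  shows "deriv_bounded N (2 * K) (\<lambda>w. subset_sum (\<lambda>i. f i w) A)"
proof -
  have K0: "0 \<le> K" using deriv_bounded_nonneg[OF f[of 0]] by simp
  define s where "s m w = (\<Sum>i<m. if i \<in> A then f i w else 0)" for m :: nat and w
  have le: "(\<Sum>i<m. K / 2 ^ i) \<le> 2 * K" for m
    using sum_le_suminf[OF summable_dyadic(1)[of K], of "{..<m}"] K0 summable_dyadic(2)[of K] by simp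
  show ?thesis
  proof (rule deriv_bounded_pointwise_limit[where f = s and C = "2 * K"])
    show "deriv_bounded N (2 * K) (s m)" for m
    proof -
      have "deriv_bounded N (K / 2 ^ i) (\<lambda>w. if i \<in> A then f i w else 0)" for i
      proof (cases "i \<in> A")
        case False
        then show ?thesis using deriv_bounded_mono[OF deriv_bounded_cmult[OF f[of i], of 0], of "K / 2 ^ i"] K0 by simp
      qed (use f in simp)
      then have "deriv_bounded N (\<Sum>i<m. K / 2 ^ i) (\<lambda>w. \<Sum>i<m. if i \<in> A then f i w else 0)"
        by (rule deriv_bounded_sum)
      then show ?thesis unfolding s_def[abs_def] by (rule deriv_bounded_mono[OF _ le])
    qed
    fix w :: complex assume w: "norm w < 1"
    show "norm (s m w) \<le> 2 * K" for m
    proof -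
      have "norm (s m w) \<le> (\<Sum>i<m. K / 2 ^ i)"
        unfolding s_def
      proof (rule sum_norm_le)
        show "norm (if i \<in> A then f i w else 0) \<le> K / 2 ^ i" for i using K[OF w, of i] K0 by simp
      qed
      with le[of m] show ?thesis by linarith
    qed
    show "(\<lambda>m. s m w) \<longlonglongrightarrow> subset_sum (\<lambda>i. f i w) A"
      unfolding s_def subset_sum_def by (rule summable_LIMSEQ[OF subset_sum_summable[OF K[OF w]]])
  qed
qed

lemma I_ideal_algebra_ideal:
  "algebra_ideal (HinfN (n + 1)) (I_ideal n B k)"
  unfolding algebra_ideal_def linear_subspace_def
proof (intro conjI ballI allI subsetI)
  show "f \<in> HinfN (n + 1)" if "f \<in> I_ideal n B k" for f using that by (simp add: I_ideal_def)
  show "(\<lambda>w. 0) \<in> I_ideal n B k" using HinfN_zero by (simp add: I_ideal_def)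
  fix f assume f: "f \<in> I_ideal n B k"
  show "(\<lambda>w. f w + g w) \<in> I_ideal n B k" if "g \<in> I_ideal n B k" for g
    using f that HinfN_add[of _ "n + 1"] unfolding I_ideal_def by (simp add: distrib_right)
  show "(\<lambda>w. c * f w) \<in> I_ideal n B k" for c
    using f HinfN_cmult[of _ "n + 1"] unfolding I_ideal_def by (simp add: mult.assoc)
  show "(\<lambda>w. f w * g w) \<in> I_ideal n B k" if g: "g \<in> HinfN (n + 1)" for g
  proof -
    have f': "f \<in> HinfN (n + 1)" "(\<lambda>w. f w * B w ^ k) \<in> HinfN (n + 1)" using f by (auto simp: I_ideal_def)
    show ?thesis
      using HinfN_mult[OF f'(1) g] HinfN_mult[OF f'(2) g] by (simp add: I_ideal_def mult_ac)
  qed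
qed

lemma blaschke_power_descend:
  assumes mass: "mass_const z A" and z: "blaschke_seq z" and f: "f holomorphic_on disc"
    and F: "(\<lambda>w. f w * blaschke z w ^ m) \<in> HinfN N" and k: "k \<le> m"
  shows "(\<lambda>w. f w * blaschke z w ^ k) \<in> HinfN N"
  using k
proof (induction k rule: inc_induct)
  case (step k)
  have "(\<lambda>w. f w * blaschke z w ^ k) holomorphic_on disc"
    by (intro holomorphic_intros f blaschke_holo z)
  moreover have "(\<lambda>w. f w * blaschke z w ^ k * blaschke z w) \<in> HinfN N"
    using step.IH by (simp add: mult_ac)
  ultimately show ?case by (rule HinfN_blaschke_divide[OF mass z])
qed (rule F)

lemma sep_dist_le:
  assumes "l \<noteq> j" shows "sep_dist z j \<le> norm (z l - z j)"
  unfolding sep_dist_def norm_minus_commute[of "z l"]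
  by (rule cINF_lower) (use assms in \<open>auto intro: bdd_belowI[of _ 0]\<close>)

lemma sep_dist_less:
  assumes "sep_dist z j < x" obtains l where "l \<noteq> j" "norm (z l - z j) < x"
proof -
  have "Suc j \<in> UNIV - {j}" by simp
  then have "(\<lambda>l. norm (z j - z l)) ` (UNIV - {j}) \<noteq> {}" by blast
  from cInf_lessD[OF this assms[unfolded sep_dist_def]]
  obtain y where "y \<in> (\<lambda>l. norm (z j - z l)) ` (UNIV - {j})" "y < x" by blast
  then show thesis using that by (auto simp: norm_minus_commute)
qed

lemma SUP_ereal_top_iff:
  fixes f :: "nat \<Rightarrow> real"
  shows "(SUP j. ereal (f j)) = \<infinity> \<longleftrightarrow> (\<forall>A. \<exists>j. A < f j)"
proof
  assume "(SUP j. ereal (f j)) = \<infinity>"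
  then have "ereal A < (SUP j. ereal (f j))" for A by simp
  then show "\<forall>A. \<exists>j. A < f j" by (simp add: less_SUP_iff)
next
  assume A: "\<forall>A. \<exists>j. A < f j"
  show "(SUP j. ereal (f j)) = \<infinity>"
  proof (rule SUP_PInfty)
    fix n :: nat
    obtain j where "real n < f j" using A by blast
    then show "\<exists>i\<in>UNIV. ereal (real n) \<le> ereal (f i)" by (intro bexI[of _ j]) auto
  qed
qed

lemma ideal_of_comparable_separation:
  assumes mass: "mass_const z M" and z: "blaschke_seq z" and n: "1 \<le> n"
    and A: "0 \<le> A" "\<And>j. \<exists>l. l \<noteq> j \<and> norm (z l - z j) \<le> A * (1 - norm (z j))"
  shows "f \<in> I_ideal n (blaschke z) n \<longleftrightarrow> f \<in> HinfN (n + 1) \<and>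
    (\<exists>K. \<forall>j w. norm w < 1 \<longrightarrow> norm (f w) \<le> K * norm (1 - cnj (z j) * w) ^ (n + 1))" (is "_ \<longleftrightarrow> _ \<and> ?S f")
    and "f \<in> HinfN (n + 1) \<Longrightarrow>
      \<exists>K. \<forall>j w. norm w < 1 \<longrightarrow> norm (f w) \<le> K * norm (1 - cnj (z j) * w) ^ (n + 1) \<Longrightarrow>
      f \<in> I_ideal n (blaschke z) m"
proof -
  show small: "f \<in> I_ideal n (blaschke z) m" if f: "f \<in> HinfN (n + 1)" and S: "?S f" for m
  proof -
    obtain K where K: "\<And>j w. norm w < 1 \<Longrightarrow> norm (f w) \<le> K * norm (1 - cnj (z j) * w) ^ (n + 1)"
      using S by blast
    obtain L where L: "deriv_bounded (n + 1) L f" using f HinfN_iff' by blast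
    have "(\<lambda>w. f w * blaschke z w ^ m) \<in> HinfN (n + 1)"
    proof (rule HinfN_small_mult[OF mass z])
      show "deriv_bounded (n + 1) (max K L) f" by (rule deriv_bounded_mono[OF L]) simp
      show "norm (f w) \<le> max K L * norm (1 - cnj (z j) * w) ^ (n + 1)" if "norm w < 1" for j w
        using K[OF that, of j] mult_right_mono[of K "max K L" "norm (1 - cnj (z j) * w) ^ (n + 1)"] by simp
    qed
    with f show ?thesis by (simp add: I_ideal_def)
  qed
  have "?S f" if f: "f \<in> I_ideal n (blaschke z) n"
  proof -
    obtain K where K: "deriv_bounded (n + 1) K (\<lambda>w. f w * blaschke z w ^ n)"
      using f HinfN_iff' unfolding I_ideal_def by blast
    have h: "f holomorphic_on disc" using f HinfN_holo by (auto simp: I_ideal_def)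
    have "norm (f w) \<le> K * (1 + A) ^ (n + 1) * norm (1 - cnj (z j) * w) ^ (n + 1)" if w: "norm w < 1" for j w
    proof -
      obtain l where "l \<noteq> j" "norm (z l - z j) \<le> A * (1 - norm (z j))" using A(2) by blast
      then show ?thesis by (intro two_zeros_bound[OF z h n K w]) (use A(1) in auto)
    qed
    then show ?thesis by blast
  qed
  with small[of n] show "f \<in> I_ideal n (blaschke z) n \<longleftrightarrow> f \<in> HinfN (n + 1) \<and> ?S f"
    by (auto simp: I_ideal_def)
qed

lemma ideal_drop_of_large_separation:
  assumes C: "bump_const z C" and z: "blaschke_seq z" and inj: "inj z"
    and large: "\<And>A. \<exists>j. A < sep_dist z j / (1 - norm (z j))"
  shows "\<not> I_ideal n (blaschke z) n \<subseteq> I_ideal n (blaschke z) (n + 1)"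
proof
  assume sub: "I_ideal n (blaschke z) n \<subseteq> I_ideal n (blaschke z) (n + 1)"
  note z1 = blaschke_seqD(1)[OF z]
  define B where "B = blaschke z"
  have B1: "norm (B w) \<le> 1" if "norm w < 1" for w unfolding B_def by (rule norm_blaschke_le_1[OF z that])
  define K where "K = test_setting.TK C n"
  define t where "t = test_setting.tc C n"
  \<comment> \<open>The gap \<open>4 ^ i\<close> leaves a factor \<open>2 ^ i\<close> after the
    summands have been scaled by \<open>1 / 2 ^ i\<close>.\<close>
  have "\<forall>i. \<exists>j. 4 ^ i < sep_dist z j / (1 - norm (z j))" using large by blast
  then obtain J :: "nat \<Rightarrow> nat" where J: "\<And>i. 4 ^ i < sep_dist z (J i) / (1 - norm (z (J i)))" by metis
  define d where "d i = sep_dist z (J i)" for i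
  define c where "c i = 1 - norm (z (J i))" for i
  have c: "0 < c i" for i using z1 by (simp add: c_def)
  have dc: "4 ^ i * c i < d i" for i
    using J[of i] c[of i] by (simp add: d_def c_def field_simps)
  have ex: "0 < t \<and> (\<exists>f. deriv_bounded 0 K f \<and> deriv_bounded (n + 1) K f \<and> deriv_bounded (n + 1) K (\<lambda>w. f w * B w ^ n) \<and>
     t * d i * c i ^ n \<le> norm (f (z (J i))))" for i
  proof -
    have 1: "1 - norm (z (J i)) \<le> d i"
    proof -
      have "1 * c i \<le> 4 ^ i * c i" using c[of i] by (intro mult_right_mono) auto
      then show ?thesis using dc[of i] by (simp add: c_def)
    qed
    have "d i \<le> norm (z (Suc (J i)) - z (J i))" unfolding d_def by (rule sep_dist_le) simp
    also have "\<dots> \<le> 2" using norm_triangle_ineq4[of "z (Suc (J i))" "z (J i)"] z1[of "Suc (J i)"] z1[of "J i"] by linarith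
    finally have 2: "d i \<le> 2" .
    have 3: "d i \<le> norm (z l - z (J i))" if "l \<noteq> J i" for l unfolding d_def by (rule sep_dist_le[OF that])
    from test_function_limit[OF C z inj 1 2 3, of n] show ?thesis by (simp add: K_def t_def B_def c_def)
  qed
  then have t: "0 < t" by blast
  have "\<forall>i. \<exists>f. deriv_bounded 0 K f \<and> deriv_bounded (n + 1) K f \<and> deriv_bounded (n + 1) K (\<lambda>w. f w * B w ^ n) \<and>
     t * d i * c i ^ n \<le> norm (f (z (J i)))" using ex by blast
  then obtain f where f: "\<forall>i. deriv_bounded 0 K (f i) \<and> deriv_bounded (n + 1) K (f i) \<and>
     deriv_bounded (n + 1) K (\<lambda>w. f i w * B w ^ n) \<and> t * d i * c i ^ n \<le> norm (f i (z (J i)))"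
    by (rule choice[THEN exE])
  define X where "X i w = f i w / 2 ^ i" for i :: nat and w
  have Xc: "X i = (\<lambda>w. (1 / 2 ^ i) * f i w)" for i by (simp add: X_def fun_eq_iff)
  have n2: "norm (1 / 2 ^ i :: complex) * K = K / 2 ^ i" for i by (simp add: norm_divide norm_power)
  have X1: "deriv_bounded (n + 1) (K / 2 ^ i) (X i)" for i
    using deriv_bounded_cmult[of "n + 1" K "f i" "1 / 2 ^ i"] f unfolding Xc n2 by blast
  have X2: "deriv_bounded (n + 1) (K / 2 ^ i) (\<lambda>w. X i w * B w ^ n)" for i
    using deriv_bounded_cmult[of "n + 1" K "\<lambda>w. f i w * B w ^ n" "1 / 2 ^ i"] f unfolding Xc n2 mult.assoc by blast
  have X0: "norm (X i w) \<le> K / 2 ^ i" if "norm w < 1" for i w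
    using f deriv_boundedD[of 0 K "f i" w] that by (simp add: X_def norm_divide norm_power divide_right_mono)
  have XB: "norm (X i w * B w ^ n) \<le> K / 2 ^ i" if w: "norm w < 1" for i w
  proof -
    have "norm (X i w) * norm (B w) ^ n \<le> norm (X i w) * 1"
      using B1[OF w] by (intro mult_left_mono power_le_one) auto
    then show ?thesis using X0[OF w, of i] by (simp add: norm_mult norm_power)
  qed
  define F where "F A w = subset_sum (\<lambda>i. X i w) A" for A w
  have FI: "F A \<in> I_ideal n B n" for A
  proof -
    have "deriv_bounded (n + 1) (2 * K) (F A)"
      unfolding F_def by (rule deriv_bounded_subset_sum[OF X1 X0])
    moreover have "deriv_bounded (n + 1) (2 * K) (\<lambda>w. subset_sum (\<lambda>i. X i w * B w ^ n) A)"
      by (rule deriv_bounded_subset_sum[OF X2 XB])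
    moreover have "subset_sum (\<lambda>i. X i w * B w ^ n) A = F A w * B w ^ n" if w: "norm w < 1" for w
    proof -
      have "F A w * B w ^ n = (\<Sum>i. (if i \<in> A then X i w else 0) * B w ^ n)"
        unfolding F_def subset_sum_def by (rule suminf_mult2[OF subset_sum_summable[OF X0[OF w]]])
      also have "\<dots> = subset_sum (\<lambda>i. X i w * B w ^ n) A"
        unfolding subset_sum_def by (intro suminf_cong) simp
      finally show ?thesis by simp
    qed
    ultimately show ?thesis
      using deriv_bounded_cong[of "\<lambda>w. subset_sum (\<lambda>i. X i w * B w ^ n) A" "\<lambda>w. F A w * B w ^ n"] HinfN_from
      by (auto simp: I_ideal_def)
  qed
  \<comment> \<open>Reduces the question to single terms, where no cancellation can occur: if every
    partial choice of summands gave an element of the smaller ideal, the terms themselves would be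
    bounded there uniformly.\<close>
  define P where "P D A \<longleftrightarrow> deriv_bounded (n + 1) (real D) (\<lambda>w. F A w * B w ^ (n + 1))" for D :: nat and A
  have "\<exists>D. \<forall>m. P D {m}"
  proof (rule gliding_hump)
    fix A
    have "F A \<in> I_ideal n B (n + 1)" using FI[of A] sub unfolding B_def by blast
    then obtain L where L: "deriv_bounded (n + 1) L (\<lambda>w. F A w * B w ^ (n + 1))"
      using HinfN_iff' unfolding I_ideal_def by blast
    have "P (nat \<lceil>L\<rceil>) A" unfolding P_def by (rule deriv_bounded_mono[OF L]) (rule real_nat_ceiling_ge)
    then show "\<exists>D. P D A" ..
  next
    show "P D' A" if "P D A" "D \<le> D'" for A D D'
      using that deriv_bounded_mono[of "n + 1" "real D" _ "real D'"] unfolding P_def by simp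
  next
    fix A D m
    assume 1: "P D A" and 2: "P D (insert m A)" and m: "m \<notin> A"
    have "deriv_bounded (n + 1) (real D + real D) (\<lambda>w. F (insert m A) w * B w ^ (n + 1) - F A w * B w ^ (n + 1))"
      using 1 2 unfolding P_def by (intro deriv_bounded_diff)
    moreover have "F (insert m A) w * B w ^ (n + 1) - F A w * B w ^ (n + 1) = F {m} w * B w ^ (n + 1)" if w: "norm w < 1" for w
      using subset_sum_insert[OF X0[OF w] m] subset_sum_single[OF X0[OF w], of m]
      unfolding F_def left_diff_distrib[symmetric] by simp
    ultimately have "deriv_bounded (n + 1) (real D + real D) (\<lambda>w. F {m} w * B w ^ (n + 1))"
      using deriv_bounded_cong[of "\<lambda>w. F (insert m A) w * B w ^ (n + 1) - F A w * B w ^ (n + 1)" "\<lambda>w. F {m} w * B w ^ (n + 1)"] by blast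
    then show "P (2 * D) {m}" unfolding P_def by simp
  next
    fix A D
    assume "\<And>i. \<exists>A'. A' \<inter> {..<i} = A \<inter> {..<i} \<and> P D A'"
    then have "\<forall>i. \<exists>A'. A' \<inter> {..<i} = A \<inter> {..<i} \<and> P D A'" by simp
    then obtain A' where A': "\<forall>i. A' i \<inter> {..<i} = A \<inter> {..<i} \<and> P D (A' i)"
      by (rule choice[THEN exE])
    show "P D A"
      unfolding P_def
    proof (rule deriv_bounded_pointwise_limit[where f = "\<lambda>i w. F (A' i) w * B w ^ (n + 1)" and C = "2 * K"])
      show "deriv_bounded (n + 1) (real D) (\<lambda>w. F (A' i) w * B w ^ (n + 1))" for i
        using A' unfolding P_def by blast
      fix w :: complex assume w: "norm w < 1"
      show "norm (F (A' i) w * B w ^ (n + 1)) \<le> 2 * K" for i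
      proof -
        have "norm (F (A' i) w) * norm (B w) ^ (n + 1) \<le> norm (F (A' i) w) * 1"
          using B1[OF w] by (intro mult_left_mono power_le_one) auto
        moreover have "norm (F (A' i) w) \<le> 2 * K" unfolding F_def by (rule norm_subset_sum[OF X0[OF w]])
        ultimately show ?thesis unfolding norm_mult norm_power by linarith
      qed
      have "(\<lambda>i. F (A' i) w) \<longlonglongrightarrow> F A w"
      proof (rule LIM_zero_cancel, rule Lim_null_comparison)
        have "norm (F (A' i) w - F A w) \<le> 4 * K / 2 ^ i" for i
          unfolding F_def by (rule subset_sum_agree[OF X0[OF w]]) (use A' in blast)
        then show "\<forall>\<^sub>F i in sequentially. norm (F (A' i) w - F A w) \<le> 4 * K / 2 ^ i" by simp
        show "(\<lambda>i. 4 * K / 2 ^ i) \<longlonglongrightarrow> 0" by (rule summable_LIMSEQ_zero[OF summable_dyadic(1)])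
      qed
      then show "(\<lambda>i. F (A' i) w * B w ^ (n + 1)) \<longlonglongrightarrow> F A w * B w ^ (n + 1)"
        by (rule tendsto_mult_right)
    qed
  qed
  then obtain D where D: "\<And>m. P D {m}" by blast
  \<comment> \<open>At the zero \<open>a\<close>, the upper bound from \<open>one_zero_bound\<close>
    has order \<open>c m ^ (n + 1)\<close> and the lower bound order
    \<open>d m * c m ^ n / 2 ^ m\<close>, which is larger by at least the order
    \<open>2 ^ m\<close>.\<close>
  have main: "t * 2 ^ m \<le> real D * 2 ^ (n + 1)" for m
  proof -
    define a where "a = z (J m)"
    have a1: "norm a < 1" using z1 by (simp add: a_def)
    have "F {m} w * B w ^ (n + 1) = X m w * B w ^ (n + 1)" if w: "norm w < 1" for w
      using subset_sum_single[OF X0[OF w], of m] by (simp add: F_def)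
    then have XD: "deriv_bounded (n + 1) (real D) (\<lambda>w. X m w * blaschke z w ^ (n + 1))"
      using D[of m] deriv_bounded_cong[of "\<lambda>w. F {m} w * B w ^ (n + 1)" "\<lambda>w. X m w * B w ^ (n + 1)"]
      unfolding P_def B_def[symmetric] by blast
    have "norm (X m a) \<le> real D * norm (1 - cnj a * a) ^ (n + 1)"
      unfolding a_def by (rule one_zero_bound[OF z deriv_bounded_holo[OF X1] XD z1])
    also have "\<dots> \<le> real D * (2 * c m) ^ (n + 1)"
      using cnj_le_dist[of a a] a1 by (intro mult_left_mono power_mono) (auto simp: c_def a_def)
    finally have up: "norm (X m a) \<le> real D * (2 * c m) ^ (n + 1)" .
    have "t * d m * c m ^ n / 2 ^ m \<le> norm (X m a)"
      using f by (simp add: X_def a_def norm_divide norm_power divide_right_mono)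
    moreover have "t * (4 ^ m * c m) * c m ^ n / 2 ^ m \<le> t * d m * c m ^ n / 2 ^ m"
      using dc[of m] t c[of m] by (intro divide_right_mono mult_right_mono mult_left_mono) auto
    moreover have "t * (4 ^ m * c m) * c m ^ n / 2 ^ m = (t * 2 ^ m) * c m ^ (n + 1)"
    proof -
      have "(4::real) ^ m = 2 ^ m * 2 ^ m" by (simp flip: power_mult_distrib)
      then show ?thesis by simp
    qed
    ultimately have "(t * 2 ^ m) * c m ^ (n + 1) \<le> (real D * 2 ^ (n + 1)) * c m ^ (n + 1)"
      using up unfolding power_mult_distrib by linarith
    then show ?thesis by (rule mult_right_le_imp_le) (use c[of m] in simp)
  qed
  obtain m where "real D * 2 ^ (n + 1) / t < 2 ^ m" using real_arch_pow[of 2 "real D * 2 ^ (n + 1) / t"] by auto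
  then have "real D * 2 ^ (n + 1) < t * 2 ^ m" using t by (simp add: field_simps)
  with main[of m] show False by simp
qed

theorem theorem1p2:
  fixes n :: nat and z :: "nat \<Rightarrow> complex" and B :: "complex \<Rightarrow> complex"
    and I :: "nat \<Rightarrow> (complex \<Rightarrow> complex) set" and d :: "nat \<Rightarrow> real"
  assumes "n \<ge> 1"
    and "Hinf1_interpolating_blaschke z"
  defines "B \<equiv> blaschke z"
    and "I \<equiv> I_ideal n B"
    and "d \<equiv> sep_dist z"
  shows "((\<forall>k\<in>{1..n}. nonideal (HinfN (n + 1)) (I k)) \<longleftrightarrow> (\<forall>k\<in>{1..n}. I (k + 1) \<subset> I k))
       \<and> ((\<forall>k\<in>{1..n}. I (k + 1) \<subset> I k) \<longleftrightarrow> nonideal (HinfN (n + 1)) (I n))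
       \<and> (nonideal (HinfN (n + 1)) (I n) \<longleftrightarrow> I (n + 1) \<noteq> I n)
       \<and> (I (n + 1) \<noteq> I n \<longleftrightarrow> (SUP j. ereal (d j / (1 - norm (z j)))) = \<infinity>)"
proof -
  have z: "blaschke_seq z" and E: "Hinf1_interpolating_set (closure (range z))"
    and simple: "\<forall>w\<in>ball 0 1. blaschke z w = 0 \<longrightarrow> zorder (blaschke z) w = 1"
    using assms(2) by (auto simp: Hinf1_interpolating_blaschke_def)
  note z1 = blaschke_seqD(1)[OF z]
  have inj: "inj z" by (rule blaschke_simple_zeros_inj[OF z simple])
  obtain C where C: "bump_const z C"
    using bump_interpolation[OF z1 E] unfolding bump_const_def by blast
  obtain M where mass: "mass_const z M" using mass_const_exists[OF C z1 inj] by blast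
  have holo: "f holomorphic_on disc" if "f \<in> I k" for f k
    using that HinfN_holo by (auto simp: I_def I_ideal_def)
  have down: "(\<lambda>w. f w * B w ^ k) \<in> HinfN (n + 1)"
    if "f holomorphic_on disc" "(\<lambda>w. f w * B w ^ m) \<in> HinfN (n + 1)" "k \<le> m" for f k m
    using blaschke_power_descend[OF mass z that(1) _ that(3)] that(2) by (simp add: B_def)
  have subset: "I (k + 1) \<subseteq> I k" for k
  proof
    fix f assume f: "f \<in> I (k + 1)"
    then show "f \<in> I k" using down[OF holo[OF f], of "k + 1" k] by (auto simp: I_def I_ideal_def)
  qed
  have nonid: "nonideal (HinfN (n + 1)) (I k)" if k: "1 \<le> k" and ne: "I (k + 1) \<noteq> I k" for k
  proof -
    obtain f where f: "f \<in> I k" "f \<notin> I (k + 1)" using ne subset[of k] by blast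
    define g where "g = (\<lambda>w. f w * B w)"
    have fk: "(\<lambda>w. f w * B w ^ k) \<in> HinfN (n + 1)" "f \<in> HinfN (n + 1)" using f(1) by (auto simp: I_def I_ideal_def)
    have g: "g \<in> HinfN (n + 1)" using down[OF holo[OF f(1)] fk(1) k] by (simp add: g_def)
    have "g \<notin> I k"
    proof
      assume "g \<in> I k"
      then have "(\<lambda>w. f w * B w ^ (k + 1)) \<in> HinfN (n + 1)" by (simp add: I_def I_ideal_def g_def mult_ac)
      with fk(2) f(2) show False by (simp add: I_def I_ideal_def)
    qed
    moreover have "norm (g w) \<le> norm (f w)" if "w \<in> ball 0 1" for w
      using norm_blaschke_le_1[OF z, of w] that by (simp add: g_def B_def norm_mult mult_left_le)
    ultimately have "\<not> ideal_subspace (HinfN (n + 1)) (I k)"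
      using f(1) g unfolding ideal_subspace_def by blast
    then show ?thesis using I_ideal_algebra_ideal[of n B k] by (simp add: nonideal_def I_def)
  qed
  have all: "I (k + 1) \<noteq> I k" if ne: "I (n + 1) \<noteq> I n" and k: "k \<in> {1..n}" for k
  proof -
    obtain f where f: "f \<in> I n" "f \<notin> I (n + 1)" using ne subset[of n] by blast
    define g where "g = (\<lambda>w. f w * B w ^ (n - k))"
    have fn: "(\<lambda>w. f w * B w ^ n) \<in> HinfN (n + 1)" "f \<in> HinfN (n + 1)" using f(1) by (auto simp: I_def I_ideal_def)
    have g: "g \<in> HinfN (n + 1)" unfolding g_def by (rule down[OF holo[OF f(1)] fn(1)]) simp
    have e: "g w * B w ^ (k + i) = f w * B w ^ (n + i)" for w i
    proof -
      have "n + i = (n - k) + (k + i)" using k by simp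
      then show ?thesis unfolding g_def by (simp only: power_add mult.assoc)
    qed
    have "g \<in> I k" using g fn(1) e[of _ 0] by (simp add: I_def I_ideal_def)
    moreover have "g \<notin> I (k + 1)"
      using f(2) fn(2) e[of _ 1] by (simp add: I_def I_ideal_def del: power_Suc)
    ultimately show ?thesis by blast
  qed
  have large: "I (n + 1) \<noteq> I n" if "\<And>A. \<exists>j. A < d j / (1 - norm (z j))"
    using ideal_drop_of_large_separation[OF C z inj, of n] that by (auto simp: I_def B_def d_def)
  have small: "I (n + 1) = I n \<and> \<not> nonideal (HinfN (n + 1)) (I n)" if "\<not> (\<forall>A. \<exists>j. A < d j / (1 - norm (z j)))"
  proof -
    obtain A where A: "\<And>j. d j / (1 - norm (z j)) \<le> A" using \<open>\<not> (\<forall>A. _ A)\<close> by (auto simp: not_less)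
    \<comment> \<open>The added 1 makes the inequality strict, so that the infimum is undercut by an
      actual zero.\<close>
    have comp: "\<exists>l. l \<noteq> j \<and> norm (z l - z j) \<le> (\<bar>A\<bar> + 1) * (1 - norm (z j))" for j
    proof -
      have c: "0 < 1 - norm (z j)" using z1 by simp
      have "d j \<le> A * (1 - norm (z j))" using A[of j] c by (simp add: divide_le_eq)
      also have "\<dots> < (\<bar>A\<bar> + 1) * (1 - norm (z j))" using c by (intro mult_strict_right_mono) auto
      finally have lt: "sep_dist z j < (\<bar>A\<bar> + 1) * (1 - norm (z j))" by (simp add: d_def)
      obtain l where "l \<noteq> j" "norm (z l - z j) < (\<bar>A\<bar> + 1) * (1 - norm (z j))"
        by (rule sep_dist_less[OF lt])
      then show ?thesis by (intro exI[of _ l]) simp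
    qed
    have A0: "0 \<le> \<bar>A\<bar> + 1" by simp
    note char = ideal_of_comparable_separation[OF mass z assms(1) A0 comp, folded B_def, folded I_def]
    have eq: "I (n + 1) = I n" using subset[of n] char by blast
    have "ideal_subspace (HinfN (n + 1)) (I n)"
      unfolding ideal_subspace_def
    proof (intro conjI ballI impI)
      show "linear_subspace (HinfN (n + 1)) (I n)"
        using I_ideal_algebra_ideal[of n B n] by (simp add: algebra_ideal_def I_def)
      fix f g assume f: "f \<in> I n" and g: "g \<in> HinfN (n + 1)" and le: "\<forall>w\<in>ball 0 1. norm (g w) \<le> norm (f w)"
      obtain K where K: "\<And>j w. norm w < 1 \<Longrightarrow> norm (f w) \<le> K * norm (1 - cnj (z j) * w) ^ (n + 1)"
        using f char(1) by blast
      have "norm (g w) \<le> K * norm (1 - cnj (z j) * w) ^ (n + 1)" if "norm w < 1" for j w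
        using K[OF that, of j] le that by (meson mem_ball_0 order_trans)
      then show "g \<in> I n" using g char(1) by blast
    qed
    with eq show ?thesis by (simp add: nonideal_def)
  qed
  have n: "n \<in> {1..n}" using assms(1) by simp
  \<comment> \<open>All five conditions hold if the ratios are unbounded, and all fail otherwise;
    those quantified over \<open>{1..n}\<close> fail already at \<open>k = n\<close>.\<close>
  show ?thesis
  proof (cases "\<forall>A. \<exists>j. A < d j / (1 - norm (z j))")
    case True
    have ne: "I (n + 1) \<noteq> I n" by (rule large[OF spec[OF True]])
    have "\<forall>k\<in>{1..n}. I (k + 1) \<noteq> I k" using all[OF ne] by blast
    then have 1: "\<forall>k\<in>{1..n}. I (k + 1) \<subset> I k" "\<forall>k\<in>{1..n}. nonideal (HinfN (n + 1)) (I k)"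
      using subset nonid by auto
    have "(SUP j. ereal (d j / (1 - norm (z j)))) = \<infinity>" by (subst SUP_ereal_top_iff) (rule True)
    with 1 ne n show ?thesis by blast
  next
    case False
    have "(SUP j. ereal (d j / (1 - norm (z j)))) \<noteq> \<infinity>" using False by (subst SUP_ereal_top_iff)
    with small[OF False] n show ?thesis by blast
  qed
qed

end
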